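(* Let $Q$ be any fixed cellular q-cofibrant replacement of the final $\mathcal M$-multipointed $d$-space $\mathbf 1$, and let $\mathsf C_{\mathrm{gl}}=\overrightarrow{\mathrm{Sp}}(Q)$. For every q-cofibrant $\mathcal M$-multipointed $d$-space $A$, there exists a morphism of $\mathcal M$-multipointed $d$-spaces $f:A\to Q$ such that the directed map $\overrightarrow{\mathrm{Sp}}(f):\overrightarrow{\mathrm{Sp}}(A)\to\mathsf C_{\mathrm{gl}}$ is regular.
   Context: $\mathbb I=[0,1]$. $\mathbf{Top}$ denotes one of the following two categories (the statement is asserted for each choice): the category of $\Delta$-generated spaces (topology final with respect to continuous maps from standard simplices), or its full subcategory of $\Delta$-Hausdorff spaces (images of continuous maps from $\mathbb I$ are closed). A directed space $X=(|X|,dX)$ is a space $|X|\in\mathbf{Top}$ with a set $dX$ of continuous maps $\mathbb I\to|X|$ (directed paths) containing constant paths and closed under precomposition with continuous nondecreasing maps $\mathbb I\to\mathbb I$ and under normalized composition $(x*_Ny)(t)=x(2t)$ for $t\le\frac12$, $y(2t-1)$ for $t\ge\frac12$, when $x(1)=y(0)$. Directed maps are continuous maps preserving directed paths. A directed map $p$ is regular if $p\circ x$ constant implies $x$ constant for every directed path $x$. $\mathsf{Rep}_+$ is the monoid of continuous nondecreasing surjections $\mathbb I\to\mathbb I$. An $\mathcal M$-multipointed $d$-space $A=(|A|,A^0,\mathbb P^{\mathrm{top}}A)$ is a space $|A|\in\mathbf{Top}$, a set of states $A^0\subset|A|$, and a set $\mathbb P^{\mathrm{top}}A$ of continuous maps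 $\mathbb I\to|A|$ (execution paths) with endpoints in $A^0$, closed under precomposition with elements of $\mathsf{Rep}_+$ and under normalized composition; constant paths need not be execution paths. Morphisms are continuous maps preserving states and execution paths. The final object $\mathbf 1$ has one point, which is a state, and its constant path is an execution path. The globe $\mathrm{Glob}^{\mathrm{top}}_{\mathcal M}(Z)$ of a space $Z$ has underlying space $(\{0,1\}\sqcup(Z\times\mathbb I))/((z,0)\sim0,(z,1)\sim1)$, states $0,1$, and execution paths $t\mapsto[z,\phi(t)]$, $z\in Z$, $\phi\in\mathsf{Rep}_+$. A cellular object is the colimit of a transfinite tower starting from a discrete set of states (no execution paths), whose successor steps are pushouts along $\mathrm{Glob}^{\mathrm{top}}_{\mathcal M}(\mathsf S^{n-1})\subset\mathrm{Glob}^{\mathrm{top}}_{\mathcal M}(\mathsf D^n)$, $n\ge0$ ($\mathsf S^{-1}=\varnothing$), with colimits at limit stages. $A$ is q-cofibrant if it is a retract of a cellular object. The generating cofibrations of the q-model structure are these globe inclusions together with $\varnothing\to\{0\}$ and $\{0,1\}\to\{0\}$ between discrete state spaces. A cellular q-cofibrant replacement of $\mathbf 1$ is a cellular object $Q$ such that $Q\to\mathbf 1$ is a trivial q-fibration, i.e. has the right lifting property with respect to all generating cofibrations. $\overrightarrow{\mathrm{Sp}}(A)$ is the directed space with underlying space $|A|$ and the smallest directed structure containing the execution paths of $A$ (generated from them by adding constant paths, precomposing with continuous nondecreasing maps $\mathbb I\to\mathbb I$, and concatenating); $\overrightarrow{\mathrm{Sp}}(f)$ has the same underlying map as $f$. 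*)

theory Defs
  imports "HOL-Homology.Homology"
begin

section \<open>The two categories of spaces\<close>

definition probe_open :: "'a topology \<Rightarrow> 'a set \<Rightarrow> bool" where
  "probe_open X U \<longleftrightarrow> U \<subseteq> topspace X \<and>
     (\<forall>p \<sigma>. singular_simplex p X \<sigma> \<longrightarrow>
        openin (subtopology (powertop_real UNIV) (standard_simplex p))
          {s \<in> standard_simplex p. \<sigma> s \<in> U})"

definition delta_generated :: "'a topology \<Rightarrow> bool" where
  "delta_generated X \<longleftrightarrow> (\<forall>U. probe_open X U \<longrightarrow> openin X U)"

definition delta_Hausdorff :: "'a topology \<Rightarrow> bool" where
  "delta_Hausdorff X \<longleftrightarrow> (\<forall>g. pathin X g \<longrightarrow> closedin X (g ` {0..1}))"

datatype top_cat = Delta_Generated | Delta_Hausdorff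

fun in_Top :: "top_cat \<Rightarrow> 'a topology \<Rightarrow> bool" where
  "in_Top Delta_Generated X \<longleftrightarrow> delta_generated X"
| "in_Top Delta_Hausdorff X \<longleftrightarrow> delta_generated X \<and> delta_Hausdorff X"

text \<open>The coreflection into \<open>\<Delta>\<close>-generated spaces; products of \<open>\<Delta>\<close>-generated spaces are
  the coreflections of the topological products.\<close>

definition deltafy :: "'a topology \<Rightarrow> 'a topology" where
  "deltafy X = topology (probe_open X)"

lemma istopology_probe_open: "istopology (probe_open X)"
  unfolding istopology_def
proof (intro conjI allI impI)
  fix S T assume ST: "probe_open X S" "probe_open X T"
  have "openin (subtopology (powertop_real UNIV) (standard_simplex p))
      {s \<in> standard_simplex p. \<sigma> s \<in> S \<inter> T}" if "singular_simplex p X \<sigma>" for p \<sigma>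
  proof -
    have "{s \<in> standard_simplex p. \<sigma> s \<in> S \<inter> T} =
        {s \<in> standard_simplex p. \<sigma> s \<in> S} \<inter> {s \<in> standard_simplex p. \<sigma> s \<in> T}"
      by blast
    with ST that show ?thesis
      unfolding probe_open_def by (simp only: openin_Int)
  qed
  with ST show "probe_open X (S \<inter> T)"
    unfolding probe_open_def by blast
next
  fix K assume K: "\<forall>S\<in>K. probe_open X S"
  have "{s \<in> standard_simplex p. \<sigma> s \<in> \<Union>K} =
      (\<Union>S\<in>K. {s \<in> standard_simplex p. \<sigma> s \<in> S})" for p \<sigma>
    by auto
  with K show "probe_open X (\<Union>K)"
    unfolding probe_open_def by (auto intro!: openin_Union)
qed

lemma openin_deltafy: "openin (deltafy X) U \<longleftrightarrow> probe_open X U"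
  by (simp add: deltafy_def topology_inverse'[OF istopology_probe_open])

lemma openin_imp_probe_open:
  assumes "openin X U"
  shows "probe_open X U"
  unfolding probe_open_def
proof (intro conjI allI impI)
  show "U \<subseteq> topspace X" using assms by (rule openin_subset)
next
  fix p \<sigma> assume "singular_simplex p X \<sigma>"
  then have "continuous_map (subtopology (powertop_real UNIV) (standard_simplex p)) X \<sigma>"
    by (simp add: singular_simplex_def)
  from openin_continuous_map_preimage[OF this assms]
  show "openin (subtopology (powertop_real UNIV) (standard_simplex p))
      {s \<in> standard_simplex p. \<sigma> s \<in> U}"
    by simp
qed

lemma topspace_deltafy [simp]: "topspace (deltafy X) = topspace X"
proof
  show "topspace (deltafy X) \<subseteq> topspace X"
    using openin_deltafy[of X "topspace (deltafy X)"] by (simp add: probe_open_def)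
  show "topspace X \<subseteq> topspace (deltafy X)"
    using openin_imp_probe_open[OF openin_topspace] by (intro openin_subset) (simp add: openin_deltafy)
qed


section \<open>Paths\<close>

text \<open>A path \<open>[0,1] \<rightarrow> X\<close> is encoded as a function that is \<open>undefined\<close> outside \<open>[0,1]\<close>, so that
  equality of functions is equality of paths.\<close>

definition paths_in :: "'a topology \<Rightarrow> (real \<Rightarrow> 'a) set" where
  "paths_in X = {x \<in> extensional {0..1}. pathin X x}"

definition const_path :: "'a \<Rightarrow> real \<Rightarrow> 'a" where
  "const_path a = (\<lambda>t\<in>{0..1}. a)"

definition norm_comp :: "(real \<Rightarrow> 'a) \<Rightarrow> (real \<Rightarrow> 'a) \<Rightarrow> real \<Rightarrow> 'a" where
  "norm_comp x y = (\<lambda>t\<in>{0..1}. if t \<le> 1/2 then x (2 * t) else y (2 * t - 1))"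

definition nondecr :: "(real \<Rightarrow> real) set" where
  "nondecr = {\<phi>. continuous_on {0..1} \<phi> \<and> mono_on {0..1} \<phi> \<and> \<phi> ` {0..1} \<subseteq> {0..1}}"

definition Rep_plus :: "(real \<Rightarrow> real) set" where
  "Rep_plus = {\<phi>. continuous_on {0..1} \<phi> \<and> mono_on {0..1} \<phi> \<and> \<phi> ` {0..1} = {0..1}}"


section \<open>Directed spaces\<close>

record 'a dspace =
  dund :: "'a topology"
  dpaths :: "(real \<Rightarrow> 'a) set"

definition directed_structure :: "'a topology \<Rightarrow> (real \<Rightarrow> 'a) set \<Rightarrow> bool" where
  "directed_structure X D \<longleftrightarrow> D \<subseteq> paths_in X \<and>
     (\<forall>a\<in>topspace X. const_path a \<in> D) \<and>
     (\<forall>x\<in>D. \<forall>\<phi>\<in>nondecr. compose {0..1} x \<phi> \<in> D) \<and>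
     (\<forall>x\<in>D. \<forall>y\<in>D. x 1 = y 0 \<longrightarrow> norm_comp x y \<in> D)"

definition directed_space :: "top_cat \<Rightarrow> 'a dspace \<Rightarrow> bool" where
  "directed_space T X \<longleftrightarrow> in_Top T (dund X) \<and> directed_structure (dund X) (dpaths X)"

definition directed_map :: "'a dspace \<Rightarrow> 'b dspace \<Rightarrow> ('a \<Rightarrow> 'b) \<Rightarrow> bool" where
  "directed_map X Y p \<longleftrightarrow> continuous_map (dund X) (dund Y) p \<and>
     (\<forall>x\<in>dpaths X. compose {0..1} p x \<in> dpaths Y)"

definition regular_map :: "'a dspace \<Rightarrow> 'b dspace \<Rightarrow> ('a \<Rightarrow> 'b) \<Rightarrow> bool" where
  "regular_map X Y p \<longleftrightarrow> directed_map X Y p \<and>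
     (\<forall>x\<in>dpaths X. (p \<circ> x) constant_on {0..1} \<longrightarrow> x constant_on {0..1})"


section \<open>Multipointed d-spaces\<close>

record 'a mdspace =
  und :: "'a topology"
  states :: "'a set"
  epaths :: "(real \<Rightarrow> 'a) set"

abbreviation pts :: "'a mdspace \<Rightarrow> 'a set" where
  "pts A \<equiv> topspace (und A)"

definition mdspace :: "top_cat \<Rightarrow> 'a mdspace \<Rightarrow> bool" where
  "mdspace T A \<longleftrightarrow> in_Top T (und A) \<and> states A \<subseteq> pts A \<and>
     epaths A \<subseteq> {x \<in> paths_in (und A). x 0 \<in> states A \<and> x 1 \<in> states A} \<and>
     (\<forall>x\<in>epaths A. \<forall>\<phi>\<in>Rep_plus. compose {0..1} x \<phi> \<in> epaths A) \<and>
     (\<forall>x\<in>epaths A. \<forall>y\<in>epaths A. x 1 = y 0 \<longrightarrow> norm_comp x y \<in> epaths A)"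

text \<open>Only the restriction of a map to the points of its source matters; equality of morphisms
  is always stated pointwise on these.\<close>

definition md_map :: "'a mdspace \<Rightarrow> 'b mdspace \<Rightarrow> ('a \<Rightarrow> 'b) \<Rightarrow> bool" where
  "md_map A B f \<longleftrightarrow> continuous_map (und A) (und B) f \<and> f ` states A \<subseteq> states B \<and>
     (\<forall>x\<in>epaths A. compose {0..1} f x \<in> epaths B)"

definition final_md :: "unit mdspace" where
  "final_md = \<lparr>und = discrete_topology UNIV, states = UNIV, epaths = {const_path ()}\<rparr>"

definition discrete_md :: "'a set \<Rightarrow> 'a mdspace" where
  "discrete_md S = \<lparr>und = discrete_topology S, states = S, epaths = {}\<rparr>"


subsection \<open>Globes\<close>

text \<open>The points of the globe of \<open>Z\<close>: the two states, and the classes \<open>[z,t]\<close> with \<open>0 < t < 1\<close>,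
  which are singletons.\<close>

datatype 'z globe_pt = Src | Tgt | Mid 'z real

definition glob_class :: "'z \<times> real \<Rightarrow> 'z globe_pt" where
  "glob_class = (\<lambda>(z, t). if t = 0 then Src else if t = 1 then Tgt else Mid z t)"

definition cylinder :: "'z topology \<Rightarrow> ('z \<times> real) topology" where
  "cylinder Z = deltafy (prod_topology Z (top_of_set {0..1}))"

text \<open>The quotient topology from \<open>{0,1} \<squnion> (Z \<times> [0,1])\<close>; the discrete summand \<open>{0,1}\<close> imposes
  no condition on an open set.\<close>

definition globe_open :: "'z topology \<Rightarrow> 'z globe_pt set \<Rightarrow> bool" where
  "globe_open Z U \<longleftrightarrow> U \<subseteq> {Src, Tgt} \<union> glob_class ` topspace (cylinder Z) \<and>
     openin (cylinder Z) {c \<in> topspace (cylinder Z). glob_class c \<in> U}"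

definition globe :: "'z topology \<Rightarrow> 'z globe_pt mdspace" where
  "globe Z = \<lparr>und = topology (globe_open Z), states = {Src, Tgt},
     epaths = {(\<lambda>t\<in>{0..1}. glob_class (z, \<phi> t)) | z \<phi>. z \<in> topspace Z \<and> \<phi> \<in> Rep_plus}\<rparr>"

lemma istopology_globe_open: "istopology (globe_open Z)"
  unfolding istopology_def
proof (intro conjI allI impI)
  fix S T assume "globe_open Z S" "globe_open Z T"
  then have "S \<inter> T \<subseteq> {Src, Tgt} \<union> glob_class ` topspace (cylinder Z)"
    and "openin (cylinder Z) ({c \<in> topspace (cylinder Z). glob_class c \<in> S} \<inter>
      {c \<in> topspace (cylinder Z). glob_class c \<in> T})"
    unfolding globe_open_def by (blast, simp only: openin_Int)
  moreover have "{c \<in> topspace (cylinder Z). glob_class c \<in> S} \<inter>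
      {c \<in> topspace (cylinder Z). glob_class c \<in> T} =
      {c \<in> topspace (cylinder Z). glob_class c \<in> S \<inter> T}"
    by blast
  ultimately show "globe_open Z (S \<inter> T)"
    by (simp only: globe_open_def)
next
  fix K assume K: "\<forall>S\<in>K. globe_open Z S"
  have "{c \<in> topspace (cylinder Z). glob_class c \<in> \<Union>K} =
      (\<Union>S\<in>K. {c \<in> topspace (cylinder Z). glob_class c \<in> S})"
    by auto
  with K show "globe_open Z (\<Union>K)"
    unfolding globe_open_def by (auto intro!: openin_Union)
qed

lemma openin_globe: "openin (und (globe Z)) U \<longleftrightarrow> globe_open Z U"
  by (simp add: globe_def topology_inverse'[OF istopology_globe_open])

lemma pts_globe:
  "pts (globe Z) = {Src, Tgt} \<union> {Mid z t | z t. z \<in> topspace Z \<and> 0 < t \<and> t < 1}"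
proof -
  have "globe_open Z ({Src, Tgt} \<union> glob_class ` topspace (cylinder Z))"
  proof -
    have "{c \<in> topspace (cylinder Z). glob_class c \<in>
        {Src, Tgt} \<union> glob_class ` topspace (cylinder Z)} = topspace (cylinder Z)"
      by auto
    then show ?thesis by (simp add: globe_open_def)
  qed
  then have "{Src, Tgt} \<union> glob_class ` topspace (cylinder Z) \<subseteq> pts (globe Z)"
    by (intro openin_subset) (simp add: openin_globe)
  moreover have "pts (globe Z) \<subseteq> {Src, Tgt} \<union> glob_class ` topspace (cylinder Z)"
    using openin_globe[of Z "pts (globe Z)"] by (simp add: globe_open_def)
  ultimately have "pts (globe Z) = {Src, Tgt} \<union> glob_class ` topspace (cylinder Z)"
    by (simp only: subset_antisym)
  also have "\<dots> = {Src, Tgt} \<union> {Mid z t | z t. z \<in> topspace Z \<and> 0 < t \<and> t < 1}"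
  proof (intro equalityI subsetI)
    fix x assume "x \<in> {Src, Tgt} \<union> {Mid z t | z t. z \<in> topspace Z \<and> 0 < t \<and> t < 1}"
    moreover have "Mid z t \<in> glob_class ` topspace (cylinder Z)"
      if "z \<in> topspace Z" "0 < t" "t < 1" for z t
      using that by (intro image_eqI[of _ _ "(z, t)"]) (auto simp: cylinder_def glob_class_def)
    ultimately show "x \<in> {Src, Tgt} \<union> glob_class ` topspace (cylinder Z)"
      by blast
  next
    fix x assume "x \<in> {Src, Tgt} \<union> glob_class ` topspace (cylinder Z)"
    moreover have "glob_class c \<in> {Src, Tgt} \<union> {Mid z t | z t. z \<in> topspace Z \<and> 0 < t \<and> t < 1}"
      if "c \<in> topspace (cylinder Z)" for c
    proof -
      obtain z t where "c = (z, t)" "z \<in> topspace Z" "0 \<le> t" "t \<le> 1"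
        using \<open>c \<in> topspace (cylinder Z)\<close> by (cases c) (simp add: cylinder_def)
      then show ?thesis
        by (cases "t = 0"; cases "t = 1") (simp_all add: glob_class_def)
    qed
    ultimately show "x \<in> {Src, Tgt} \<union> {Mid z t | z t. z \<in> topspace Z \<and> 0 < t \<and> t < 1}"
      by blast
  qed
  finally show ?thesis .
qed

text \<open>Unit discs and their boundary spheres in \<open>\<real>\<^sup>n\<close>; for \<open>n = 0\<close> the sphere is empty.\<close>

definition disc :: "nat \<Rightarrow> (nat \<Rightarrow> real) topology" where
  "disc n = subtopology (Euclidean_space n) {x. (\<Sum>i<n. (x i)\<^sup>2) \<le> 1}"

definition disc_bd :: "nat \<Rightarrow> (nat \<Rightarrow> real) topology" where
  "disc_bd n = subtopology (Euclidean_space n) {x. (\<Sum>i<n. (x i)\<^sup>2) = 1}"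


subsection \<open>Colimits\<close>

text \<open>In both universal properties below, the test objects range over all multipointed d-spaces
  carried by the type \<open>'t\<close>. Such a property characterises the colimit in the whole category as
  soon as \<open>'t\<close> is large enough to carry copies of the candidate and of the actual colimit.\<close>

definition is_pushout ::
  "'t itself \<Rightarrow> top_cat \<Rightarrow> 'b mdspace \<Rightarrow> 'c mdspace \<Rightarrow> 'a mdspace \<Rightarrow> 'd mdspace \<Rightarrow>
     ('b \<Rightarrow> 'c) \<Rightarrow> ('b \<Rightarrow> 'a) \<Rightarrow> ('a \<Rightarrow> 'd) \<Rightarrow> ('c \<Rightarrow> 'd) \<Rightarrow> bool" where
  "is_pushout _ T A B X Y i u j v \<longleftrightarrow>
     mdspace T Y \<and>
     md_map A B i \<and> md_map A X u \<and> md_map X Y j \<and> md_map B Y v \<and>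
     (\<forall>a\<in>pts A. j (u a) = v (i a)) \<and>
     (\<forall>(E :: 't mdspace) g h. mdspace T E \<and> md_map X E g \<and> md_map B E h \<and>
        (\<forall>a\<in>pts A. g (u a) = h (i a)) \<longrightarrow>
        (\<exists>k. md_map Y E k \<and> (\<forall>a\<in>pts X. k (j a) = g a) \<and> (\<forall>b\<in>pts B. k (v b) = h b) \<and>
           (\<forall>k'. md_map Y E k' \<and> (\<forall>a\<in>pts X. k' (j a) = g a) \<and> (\<forall>b\<in>pts B. k' (v b) = h b)
              \<longrightarrow> (\<forall>y\<in>pts Y. k' y = k y))))"

text \<open>The colimit of a diagram \<open>X\<close> indexed by the subset \<open>I\<close> of an ordered type, with transition
  maps \<open>t\<close> and cocone \<open>c\<close>.\<close>

definition is_chain_colimit ::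
  "'t itself \<Rightarrow> top_cat \<Rightarrow> 'i::order set \<Rightarrow> ('i \<Rightarrow> 'a mdspace) \<Rightarrow> ('i \<Rightarrow> 'i \<Rightarrow> 'a \<Rightarrow> 'a) \<Rightarrow>
     'd mdspace \<Rightarrow> ('i \<Rightarrow> 'a \<Rightarrow> 'd) \<Rightarrow> bool" where
  "is_chain_colimit _ T I X t Y c \<longleftrightarrow>
     mdspace T Y \<and>
     (\<forall>i\<in>I. md_map (X i) Y (c i)) \<and>
     (\<forall>i\<in>I. \<forall>j\<in>I. i \<le> j \<longrightarrow> (\<forall>a\<in>pts (X i). c j (t i j a) = c i a)) \<and>
     (\<forall>(E :: 't mdspace) g. mdspace T E \<and> (\<forall>i\<in>I. md_map (X i) E (g i)) \<and>
        (\<forall>i\<in>I. \<forall>j\<in>I. i \<le> j \<longrightarrow> (\<forall>a\<in>pts (X i). g j (t i j a) = g i a)) \<longrightarrow>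
        (\<exists>k. md_map Y E k \<and> (\<forall>i\<in>I. \<forall>a\<in>pts (X i). k (c i a) = g i a) \<and>
           (\<forall>k'. md_map Y E k' \<and> (\<forall>i\<in>I. \<forall>a\<in>pts (X i). k' (c i a) = g i a)
              \<longrightarrow> (\<forall>y\<in>pts Y. k' y = k y))))"


subsection \<open>Cellular and q-cofibrant objects\<close>

definition is_least :: "'i::order \<Rightarrow> bool" where
  "is_least i \<longleftrightarrow> (\<forall>j. i \<le> j)"

definition is_succ :: "'i::order \<Rightarrow> 'i \<Rightarrow> bool" where
  "is_succ i j \<longleftrightarrow> i < j \<and> (\<forall>k. i < k \<longrightarrow> j \<le> k)"

definition is_limit :: "'i::order \<Rightarrow> bool" where
  "is_limit l \<longleftrightarrow> \<not> is_least l \<and> (\<nexists>i. is_succ i l)"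

definition is_tower ::
  "top_cat \<Rightarrow> 'i::order \<Rightarrow> ('i \<Rightarrow> 'a mdspace) \<Rightarrow> ('i \<Rightarrow> 'i \<Rightarrow> 'a \<Rightarrow> 'a) \<Rightarrow> bool" where
  "is_tower T \<mu> X t \<longleftrightarrow>
     (\<forall>i\<le>\<mu>. mdspace T (X i)) \<and>
     (\<forall>i j. i \<le> j \<and> j \<le> \<mu> \<longrightarrow> md_map (X i) (X j) (t i j)) \<and>
     (\<forall>i\<le>\<mu>. \<forall>a\<in>pts (X i). t i i a = a) \<and>
     (\<forall>i j k. i \<le> j \<and> j \<le> k \<and> k \<le> \<mu> \<longrightarrow> (\<forall>a\<in>pts (X i). t j k (t i j a) = t i k a))"

text \<open>The ordinal of the tower is the position of \<open>\<mu>\<close> in the well-ordered type \<open>'i\<close>, and the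
  colimit of the tower is its value at \<open>\<mu>\<close>. All stages may be carried by the type of \<open>Q\<close>, since
  they inject into the colimit. The type \<open>'a \<times> 'i \<times> real\<close> carries copies of every pushout of an
  object on \<open>'a\<close> along a globe inclusion and of every colimit of objects on \<open>'a\<close> indexed by a
  subset of \<open>'i\<close>, so it is large enough to test the universal properties.\<close>

definition cellular :: "'i::wellorder itself \<Rightarrow> top_cat \<Rightarrow> 'a mdspace \<Rightarrow> bool" where
  "cellular _ T Q \<longleftrightarrow>
     (\<exists>(\<mu>::'i) X t. is_tower T \<mu> X t \<and> X \<mu> = Q \<and>
        (\<forall>i\<le>\<mu>. is_least i \<longrightarrow> (\<exists>S. X i = discrete_md S)) \<and>
        (\<forall>i j. j \<le> \<mu> \<and> is_succ i j \<longrightarrow>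
           (\<exists>n u v. is_pushout TYPE('a \<times> 'i \<times> real) T
              (globe (disc_bd n)) (globe (disc n)) (X i) (X j) (\<lambda>x. x) u (t i j) v)) \<and>
        (\<forall>l\<le>\<mu>. is_limit l \<longrightarrow>
           is_chain_colimit TYPE('a \<times> 'i \<times> real) T {..<l} X t (X l) (\<lambda>i. t i l)))"

definition is_retract :: "'a mdspace \<Rightarrow> 'b mdspace \<Rightarrow> bool" where
  "is_retract A B \<longleftrightarrow>
     (\<exists>s r. md_map A B s \<and> md_map B A r \<and> (\<forall>a\<in>pts A. r (s a) = a))"

text \<open>The type arguments \<open>'b\<close> (points of the cellular object) and \<open>'i\<close> (stages of its tower) stand
  for the existential quantification over types that HOL cannot express: a hypothesis
  \<open>q_cofibrant TYPE('b) TYPE('i) T A\<close> with free \<open>'b\<close> and \<open>'i\<close> covers all of them. The same holds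
  for the type argument of \<open>cellular\<close>.\<close>

definition q_cofibrant ::
  "'b itself \<Rightarrow> 'i::wellorder itself \<Rightarrow> top_cat \<Rightarrow> 'a mdspace \<Rightarrow> bool" where
  "q_cofibrant _ I T A \<longleftrightarrow>
     mdspace T A \<and> (\<exists>B :: 'b mdspace. cellular I T B \<and> is_retract A B)"


subsection \<open>Trivial q-fibrations\<close>

definition has_rlp ::
  "'b mdspace \<Rightarrow> 'c mdspace \<Rightarrow> ('b \<Rightarrow> 'c) \<Rightarrow> 'a mdspace \<Rightarrow> 'd mdspace \<Rightarrow> ('a \<Rightarrow> 'd) \<Rightarrow> bool" where
  "has_rlp A B i X Y p \<longleftrightarrow>
     (\<forall>u v. md_map A X u \<and> md_map B Y v \<and> (\<forall>a\<in>pts A. p (u a) = v (i a)) \<longrightarrow>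
        (\<exists>l. md_map B X l \<and> (\<forall>a\<in>pts A. l (i a) = u a) \<and> (\<forall>b\<in>pts B. p (l b) = v b)))"

text \<open>For uniformity the points \<open>0,1\<close> of the discrete state spaces are taken in the type of
  points of a globe.\<close>

inductive generating_cofibration ::
  "(nat \<Rightarrow> real) globe_pt mdspace \<Rightarrow> (nat \<Rightarrow> real) globe_pt mdspace \<Rightarrow>
     ((nat \<Rightarrow> real) globe_pt \<Rightarrow> (nat \<Rightarrow> real) globe_pt) \<Rightarrow> bool" where
  "generating_cofibration (globe (disc_bd n)) (globe (disc n)) (\<lambda>x. x)"
| "generating_cofibration (discrete_md {}) (discrete_md {Src}) (\<lambda>x. x)"
| "generating_cofibration (discrete_md {Src, Tgt}) (discrete_md {Src}) (\<lambda>x. Src)"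

definition trivial_q_fibration :: "'a mdspace \<Rightarrow> 'd mdspace \<Rightarrow> ('a \<Rightarrow> 'd) \<Rightarrow> bool" where
  "trivial_q_fibration X Y p \<longleftrightarrow> md_map X Y p \<and>
     (\<forall>A B i. generating_cofibration A B i \<longrightarrow> has_rlp A B i X Y p)"

definition cellular_replacement_of_final ::
  "'i::wellorder itself \<Rightarrow> top_cat \<Rightarrow> 'a mdspace \<Rightarrow> bool" where
  "cellular_replacement_of_final I T Q \<longleftrightarrow>
     cellular I T Q \<and> trivial_q_fibration Q final_md (\<lambda>_. ())"


section \<open>The directed space of a multipointed d-space\<close>

inductive_set generated_dpaths :: "'a mdspace \<Rightarrow> (real \<Rightarrow> 'a) set" for A where
  gen_exec: "x \<in> epaths A \<Longrightarrow> x \<in> generated_dpaths A"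
| gen_const: "a \<in> pts A \<Longrightarrow> const_path a \<in> generated_dpaths A"
| gen_reparam: "x \<in> generated_dpaths A \<Longrightarrow> \<phi> \<in> nondecr \<Longrightarrow>
    compose {0..1} x \<phi> \<in> generated_dpaths A"
| gen_concat: "x \<in> generated_dpaths A \<Longrightarrow> y \<in> generated_dpaths A \<Longrightarrow> x 1 = y 0 \<Longrightarrow>
    norm_comp x y \<in> generated_dpaths A"

definition Sp :: "'a mdspace \<Rightarrow> 'a dspace" where
  "Sp A = \<lparr>dund = und A, dpaths = generated_dpaths A\<rparr>"

lemma generated_dpaths_least:
  assumes "directed_structure (und A) D" "epaths A \<subseteq> D"
  shows "generated_dpaths A \<subseteq> D"
proof
  fix x assume "x \<in> generated_dpaths A"
  then show "x \<in> D"
    by induction (use assms in \<open>auto simp: directed_structure_def\<close>)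
qed

lemma const_path_in_paths: "a \<in> topspace X \<Longrightarrow> const_path a \<in> paths_in X"
  using continuous_map_eq[of "top_of_set {0..1}" X "\<lambda>_. a" "const_path a"]
  by (simp add: paths_in_def pathin_def const_path_def)

lemma compose_in_paths:
  assumes "x \<in> paths_in X" "\<phi> \<in> nondecr"
  shows "compose {0..1} x \<phi> \<in> paths_in X"
proof -
  have "continuous_map (top_of_set {0..1}) (top_of_set {0..1}) \<phi>"
    using assms(2) by (auto simp: nondecr_def)
  then have "continuous_map (top_of_set {0..1}) X (x \<circ> \<phi>)"
    by (rule continuous_map_compose) (use assms(1) in \<open>simp add: paths_in_def pathin_def\<close>)
  then have "continuous_map (top_of_set {0..1}) X (compose {0..1} x \<phi>)"
    by (rule continuous_map_eq) (simp add: compose_def)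
  then show ?thesis
    by (simp add: paths_in_def pathin_def compose_extensional)
qed

lemma norm_comp_in_paths:
  assumes x: "x \<in> paths_in X" and y: "y \<in> paths_in X" and xy: "x 1 = y 0"
  shows "norm_comp x y \<in> paths_in X"
proof -
  let ?I = "top_of_set {0..1::real}"
  have "continuous_map ?I X (\<lambda>t. if t \<le> 1/2 then x (2 * t) else y (2 * t - 1))"
  proof (rule continuous_map_cases_le)
    show "continuous_map ?I euclideanreal (\<lambda>t. t)" "continuous_map ?I euclideanreal (\<lambda>t. 1/2)"
      by simp_all
    have "continuous_map (subtopology ?I {t \<in> topspace ?I. t \<le> 1/2}) ?I (\<lambda>t. 2 * t)"
      by (simp add: subtopology_subtopology image_subset_iff Pi_iff continuous_intros)
    then have "continuous_map (subtopology ?I {t \<in> topspace ?I. t \<le> 1/2}) X (x \<circ> (\<lambda>t. 2 * t))"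
      by (rule continuous_map_compose) (use x in \<open>simp add: paths_in_def pathin_def\<close>)
    then show "continuous_map (subtopology ?I {t \<in> topspace ?I. t \<le> 1/2}) X (\<lambda>t. x (2 * t))"
      by (simp add: o_def)
    have "continuous_map (subtopology ?I {t \<in> topspace ?I. 1/2 \<le> t}) ?I (\<lambda>t. 2 * t - 1)"
      by (simp add: subtopology_subtopology image_subset_iff Pi_iff continuous_intros)
    then have "continuous_map (subtopology ?I {t \<in> topspace ?I. 1/2 \<le> t}) X (y \<circ> (\<lambda>t. 2 * t - 1))"
      by (rule continuous_map_compose) (use y in \<open>simp add: paths_in_def pathin_def\<close>)
    then show "continuous_map (subtopology ?I {t \<in> topspace ?I. 1/2 \<le> t}) X (\<lambda>t. y (2 * t - 1))"
      by (simp add: o_def)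
    show "x (2 * t) = y (2 * t - 1)" if "t \<in> topspace ?I" "t = 1/2" for t
    proof -
      have "2 * t = 1" "2 * t - 1 = 0" using that by simp_all
      then show ?thesis using xy by (simp only:)
    qed
  qed
  then have "continuous_map ?I X (norm_comp x y)"
    by (rule continuous_map_eq) (simp add: norm_comp_def)
  then show ?thesis
    by (simp add: paths_in_def pathin_def norm_comp_def)
qed

lemma directed_space_Sp:
  assumes "mdspace T A"
  shows "directed_space T (Sp A)"
proof -
  have "x \<in> paths_in (und A)" if "x \<in> generated_dpaths A" for x
    using that
    by induction (use assms in \<open>auto simp: mdspace_def const_path_in_paths compose_in_paths
      norm_comp_in_paths\<close>)
  with assms show ?thesis
    by (auto simp: directed_space_def directed_structure_def Sp_def mdspace_def
      intro: generated_dpaths.intros)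
qed

end

theory Submission
  imports Defs "HOL-Analysis.Uniform_Limit"
begin

text \<open>A morphism to \<open>Q\<close> exists by lifting, cell by cell, but an arbitrary lift may create stops.
  Each lift over a globe \<open>D\<^sup>n\<close> is therefore repaired in the interior of the disc. In the cellular
  object \<open>Q\<close> every execution path is \<open>c \<circ> \<phi>\<close> with \<open>\<phi>\<close> in \<open>Rep_plus\<close> and \<open>c\<close> without stops, and its stops
  are detected by real functions on \<open>Q\<close>. Summing the oscillations of countably many such functions
  yields, for the family \<open>H(z,-)\<close> of paths given by a lift, reparametrisations \<open>\<tau>(z,-)\<close>, continuous
  in \<open>z\<close>, whose stops are exactly those of \<open>H(z,-)\<close>. Hence \<open>H(z,s) = Hr(z,\<tau>(z,s))\<close> with \<open>Hr\<close> continuous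
  and without stops, and \<open>Hr(z, (1 - |z|\<^sup>2) s + |z|\<^sup>2 \<tau>(z,s))\<close> agrees with \<open>H\<close> on the boundary of the
  disc and has no stops inside. A map built from such fillings is regular on execution paths,
  hence on the directed paths they generate, and composing with the section of a retraction keeps
  this property.\<close>

section \<open>\<open>\<Delta>\<close>-generated spaces\<close>

text \<open>The obstacle is continuity in \<open>z\<close>. Each path \<open>H(z,-)\<close> factors
  as \<open>c \<circ> \<phi>\<close> with \<open>c\<close> free of stops, but \<open>c\<close> and
  \<open>\<phi>\<close> are chosen for each \<open>z\<close> separately and nothing makes them vary
  continuously; they only serve to locate the stops. The oscillation of
  \<open>g \<circ> H(z,-)\<close> does depend continuously on \<open>z\<close> for every real
  function \<open>g\<close> on \<open>Q\<close>, and every interval on which a path moves is seen by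
  some \<open>g\<close>, so \<open>\<tau>\<close> is built from such functions. Countably many
  suffice by the Lindelof property of the space of triples \<open>(z, a, b)\<close>.
  \<open>Hr\<close> is continuous because \<open>(z, s) \<mapsto> (z, \<tau>(z,s))\<close> is a
  quotient map of a compact space. The values over the boundary sphere are imposed by the attaching
  map, stops included, so the repair has to fade out there: this is the origin of the weight
  \<open>|z|\<^sup>2\<close>. Paths over the boundary come from an earlier stage, where they have
  been treated already.\<close>

abbreviation simplex_top :: "nat \<Rightarrow> (nat \<Rightarrow> real) topology" where
  "simplex_top p \<equiv> subtopology (powertop_real UNIV) (standard_simplex p)"

text \<open>\<open>singular_simplex\<close> demands functions that are undefined off the simplex.
  Restricting a continuous map to the simplex leaves its preimages unchanged, so arbitrary
  continuous maps may serve as probes.\<close>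

lemma delta_generated_simplexI:
  assumes "\<And>U. \<lbrakk>U \<subseteq> topspace X; \<And>p \<sigma>. continuous_map (simplex_top p) X \<sigma> \<Longrightarrow>
    openin (simplex_top p) {s \<in> standard_simplex p. \<sigma> s \<in> U}\<rbrakk> \<Longrightarrow> openin X U"
  shows "delta_generated X"
  unfolding delta_generated_def
proof (intro allI impI)
  fix U assume U: "probe_open X U"
  show "openin X U"
  proof (rule assms)
    show "U \<subseteq> topspace X" using U by (simp add: probe_open_def)
    fix p \<sigma> assume \<sigma>: "continuous_map (simplex_top p) X \<sigma>"
    have "continuous_map (simplex_top p) X (restrict \<sigma> (standard_simplex p))"
      by (rule continuous_map_eq[OF \<sigma>]) simp
    then have "singular_simplex p X (restrict \<sigma> (standard_simplex p))"
      by (simp add: singular_simplex_def)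
    with U have "openin (simplex_top p) {s \<in> standard_simplex p. restrict \<sigma> (standard_simplex p) s \<in> U}"
      unfolding probe_open_def by blast
    moreover have "{s \<in> standard_simplex p. restrict \<sigma> (standard_simplex p) s \<in> U} =
        {s \<in> standard_simplex p. \<sigma> s \<in> U}" by auto
    ultimately show "openin (simplex_top p) {s \<in> standard_simplex p. \<sigma> s \<in> U}" by (simp only:)
  qed
qed

section \<open>The coreflection into Delta-generated spaces\<close>

lemma probe_open_preimage:
  assumes f: "continuous_map X Y f" and U: "probe_open Y U"
  shows "probe_open X {x \<in> topspace X. f x \<in> U}"
  unfolding probe_open_def
proof (intro conjI allI impI)
  fix p \<sigma> assume \<sigma>: "singular_simplex p X \<sigma>"
  then have c: "continuous_map (simplex_top p) X \<sigma>" by (simp add: singular_simplex_def)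
  have "continuous_map (simplex_top p) Y (restrict (f \<circ> \<sigma>) (standard_simplex p))"
    by (rule continuous_map_eq[OF continuous_map_compose[OF c f]]) simp
  then have "singular_simplex p Y (restrict (f \<circ> \<sigma>) (standard_simplex p))"
    by (simp add: singular_simplex_def)
  with U have "openin (simplex_top p)
      {s \<in> standard_simplex p. restrict (f \<circ> \<sigma>) (standard_simplex p) s \<in> U}"
    unfolding probe_open_def by blast
  moreover have "{s \<in> standard_simplex p. restrict (f \<circ> \<sigma>) (standard_simplex p) s \<in> U} =
      {s \<in> standard_simplex p. \<sigma> s \<in> {x \<in> topspace X. f x \<in> U}}"
    using continuous_map_image_subset_topspace[OF c] by auto
  ultimately show "openin (simplex_top p)
      {s \<in> standard_simplex p. \<sigma> s \<in> {x \<in> topspace X. f x \<in> U}}" by (simp only:)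
qed auto

lemma continuous_map_deltafy:
  assumes "continuous_map X Y f"
  shows "continuous_map (deltafy X) (deltafy Y) f"
  using assms probe_open_preimage[OF assms]
  by (auto simp: continuous_map_def openin_deltafy)

lemma continuous_map_deltafy_id: "continuous_map (deltafy X) X (\<lambda>x. x)"
proof -
  have "{x \<in> topspace X. x \<in> U} = U" if "openin X U" for U
    using openin_subset[OF that] by auto
  then show ?thesis
    by (auto simp: continuous_map_def openin_deltafy openin_imp_probe_open)
qed

lemma continuous_map_from_deltafy:
  assumes "continuous_map X Y f"
  shows "continuous_map (deltafy X) Y f"
  using continuous_map_compose[OF continuous_map_deltafy_id assms] by (simp add: o_def)

lemma deltafy_eq: "delta_generated X \<Longrightarrow> deltafy X = X"
  by (auto simp: topology_eq openin_deltafy delta_generated_def intro: openin_imp_probe_open)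

text \<open>Functoriality of \<open>deltafy\<close> together with \<open>deltafy X = X\<close>; this
  is one half of the universal property of the coreflection.\<close>

lemma continuous_map_into_deltafy:
  assumes "delta_generated X" "continuous_map X Y f"
  shows "continuous_map X (deltafy Y) f"
  using continuous_map_deltafy[OF assms(2)] by (simp add: deltafy_eq[OF assms(1)])

lemma delta_generated_simplex: "delta_generated (simplex_top p)"
proof (rule delta_generated_simplexI)
  fix U assume U: "U \<subseteq> topspace (simplex_top p)"
    and *: "\<And>q \<sigma>. continuous_map (simplex_top q) (simplex_top p) \<sigma> \<Longrightarrow>
      openin (simplex_top q) {s \<in> standard_simplex q. \<sigma> s \<in> U}"
  have "{s \<in> standard_simplex p. s \<in> U} = U" using U by auto
  with *[of p "\<lambda>x. x"] show "openin (simplex_top p) U" by simp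
qed

text \<open>Simplices are Delta-generated, so every singular simplex of \<open>X\<close> is also one
  of \<open>deltafy X\<close>: the two spaces have the same probes and the coreflection is
  idempotent.\<close>

lemma delta_generated_deltafy: "delta_generated (deltafy X)"
  unfolding delta_generated_def openin_deltafy
proof (intro allI impI)
  fix U assume U: "probe_open (deltafy X) U"
  show "probe_open X U"
    unfolding probe_open_def
  proof (intro conjI allI impI)
    show "U \<subseteq> topspace X" using U by (simp add: probe_open_def)
    fix p \<sigma> assume "singular_simplex p X \<sigma>"
    then have "singular_simplex p (deltafy X) \<sigma>"
      unfolding singular_simplex_def
      by (blast intro: continuous_map_into_deltafy[OF delta_generated_simplex])
    with U show "openin (simplex_top p) {s \<in> standard_simplex p. \<sigma> s \<in> U}"
      by (simp add: probe_open_def)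
  qed
qed

text \<open>A probe-open \<open>U\<close> pulls back along \<open>r\<close> to an open set of
  \<open>Y\<close>, and then along \<open>i\<close> to \<open>U \<inter> N\<close>. The local form
  is meant for spheres, which are retracts of discs only near each of their points.\<close>

lemma delta_generated_local_retract:
  assumes "\<And>x. x \<in> topspace X \<Longrightarrow> \<exists>N (Y::'b topology) r i. openin X N \<and> x \<in> N \<and> delta_generated Y \<and>
    continuous_map Y X r \<and> continuous_map (subtopology X N) Y i \<and> (\<forall>y\<in>N. r (i y) = y)"
  shows "delta_generated X"
  unfolding delta_generated_def
proof (intro allI impI)
  fix U assume U: "probe_open X U"
  then have UX: "U \<subseteq> topspace X" by (simp add: probe_open_def)
  have "\<exists>V. openin X V \<and> x \<in> V \<and> V \<subseteq> U" if x: "x \<in> U" for x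
  proof -
    obtain N r i and Y :: "'b topology" where N: "openin X N" "x \<in> N" "delta_generated Y"
      and r: "continuous_map Y X r" and i: "continuous_map (subtopology X N) Y i"
      and ri: "\<And>y. y \<in> N \<Longrightarrow> r (i y) = y"
      using assms x UX by (metis subsetD)
    have "openin Y {y \<in> topspace Y. r y \<in> U}"
      using probe_open_preimage[OF r U] N(3) by (simp add: delta_generated_def)
    from openin_continuous_map_preimage[OF i this]
    have "openin (subtopology X N) {y \<in> topspace (subtopology X N). i y \<in> {y \<in> topspace Y. r y \<in> U}}" .
    moreover have "{y \<in> topspace (subtopology X N). i y \<in> {y \<in> topspace Y. r y \<in> U}} = U \<inter> N"
      using ri continuous_map_image_subset_topspace[OF i] UX by auto
    ultimately have "openin X (U \<inter> N)"
      using N(1) by (metis openin_open_subtopology)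
    then show ?thesis using x N(2) by blast
  qed
  then show "openin X U" by (subst openin_subopen) blast
qed

lemma delta_generated_retract:
  fixes Y :: "'b topology"
  assumes "delta_generated Y" "continuous_map Y X r" "continuous_map X Y i"
    "\<And>x. x \<in> topspace X \<Longrightarrow> r (i x) = x"
  shows "delta_generated X"
  by (rule delta_generated_local_retract[where 'b='b], rule exI[of _ "topspace X"], use assms in auto)

section \<open>Cylinders over discs and spheres\<close>

definition disc_set :: "nat \<Rightarrow> (nat \<Rightarrow> real) set" where
  "disc_set n = {x. (\<forall>i\<ge>n. x i = 0) \<and> (\<Sum>i<n. (x i)\<^sup>2) \<le> 1}"

definition sphere_set :: "nat \<Rightarrow> (nat \<Rightarrow> real) set" where
  "sphere_set n = {x. (\<forall>i\<ge>n. x i = 0) \<and> (\<Sum>i<n. (x i)\<^sup>2) = 1}"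

lemma sphere_subset_disc: "sphere_set n \<subseteq> disc_set n"
  by (auto simp: sphere_set_def disc_set_def)

text \<open>The class topology of \<open>nat \<Rightarrow> real\<close> is the product topology, so
  discs and spheres become plain sets, open to \<open>continuous_on\<close> and to the metric of
  this type.\<close>

lemma disc_eq: "disc n = top_of_set (disc_set n)"
  by (auto simp: disc_def disc_set_def Euclidean_space_def subtopology_subtopology
      euclidean_product_topology Collect_conj_eq)

lemma disc_bd_eq: "disc_bd n = top_of_set (sphere_set n)"
  by (auto simp: disc_bd_def sphere_set_def Euclidean_space_def subtopology_subtopology
      euclidean_product_topology Collect_conj_eq)

lemma topspace_disc [simp]: "topspace (disc n) = disc_set n"
  by (simp add: disc_eq)

lemma topspace_disc_bd [simp]: "topspace (disc_bd n) = sphere_set n"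
  by (simp add: disc_bd_eq)

lemma prod_top_of_set: "prod_topology (top_of_set S) (top_of_set T) = top_of_set (S \<times> T)"
  by (simp add: subtopology_Times )

lemma continuous_on_coord:
  fixes f :: "'c::topological_space \<Rightarrow> nat \<Rightarrow> real"
  assumes "continuous_on S f"
  shows "continuous_on S (\<lambda>x. f x i)"
  using continuous_on_compose2[OF continuous_on_product_coordinates assms subset_UNIV] .

text \<open>Makes \<open>cylinder (disc n)\<close> an ordinary subspace of a product: the
  coreflection in the definition of \<open>cylinder\<close> then changes nothing.\<close>

lemma delta_generated_disc_cylinder: "delta_generated (top_of_set (disc_set n \<times> {0..1::real}))"
proof -
  \<comment> \<open>The cylinder has \<open>n + 1\<close> coordinates. Each is scaled into
    \<open>[0, 1/N]\<close>, so their sum is at most 1 and the barycentric coordinate of index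
    \<open>n + 1\<close> takes up the remainder.\<close>
  define N where "N = real (n + 1)"
  have N: "N \<ge> 1" by (simp add: N_def)
  \<comment> \<open>An affine copy of the cylinder in a simplex, retracted onto by clamping radially and in time.\<close>
  define w where "w = (\<lambda>x::nat\<Rightarrow>real. \<lambda>k. if k < n then 2 * N * x k - 1 else 0)"
  define m where "m = (\<lambda>x. max 1 (sqrt (\<Sum>i<n. (w x i)\<^sup>2)))"
  define r where "r = (\<lambda>x. (\<lambda>k. w x k / m x, max 0 (min 1 (N * x n))))"
  define j where "j = (\<lambda>(z, t) k. if k < n then (z k + 1) / (2 * N) else if k = n then t / N else (0::real))"
  define i where "i = (\<lambda>c k. if k = n + 1 then 1 - (\<Sum>l\<le>n. j c l) else j c (k::nat) :: real)"
  have coord: "\<bar>z k\<bar> \<le> 1" if "z \<in> disc_set n" "k < n" for z k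
  proof -
    have "(z k)\<^sup>2 \<le> (\<Sum>i<n. (z i)\<^sup>2)" using that by (intro member_le_sum) auto
    also have "\<dots> \<le> 1" using that by (simp add: disc_set_def)
    finally show ?thesis by (simp add: abs_square_le_1)
  qed
  have m: "m x \<ge> 1" for x by (simp add: m_def)
  have jb: "0 \<le> j c k" "j c k \<le> 1 / N" if cD: "c \<in> disc_set n \<times> {0..1}" for c k
  proof -
    obtain z t where c: "c = (z, t)" "z \<in> disc_set n" "0 \<le> t" "t \<le> 1" using cD by (cases c) auto
    show "0 \<le> j c k" "j c k \<le> 1 / N"
      using coord[OF c(2), of k] c N by (auto simp: j_def abs_le_iff field_simps)
  qed
  have isimp: "i c \<in> standard_simplex (n + 1)" if c: "c \<in> disc_set n \<times> {0..1}" for c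
  proof -
    have s: "(\<Sum>l\<le>n. j c l) \<le> 1"
      using sum_bounded_above[of "{..n}" "j c" "1 / N"] jb[OF c] by (simp add: N_def)
    have s0: "0 \<le> (\<Sum>l\<le>n. j c l)" using jb[OF c] by (simp add: sum_nonneg)
    have "j c k \<le> 1" for k
      using jb(2)[OF c, of k] N by (smt (verit) divide_le_eq_1_pos)
    moreover have "(\<Sum>k\<le>n+1. i c k) = 1"
      by (simp add: i_def)
    moreover have "i c k = 0" if "k > n + 1" for k
      using that by (auto simp: i_def j_def split: prod.split)
    ultimately show ?thesis
      using s s0 jb(1)[OF c] by (auto simp: standard_simplex_def i_def)
  qed
  have ri: "r (i c) = c" if cD: "c \<in> disc_set n \<times> {0..1}" for c
  proof -
    obtain z t where c: "c = (z, t)" "z \<in> disc_set n" "0 \<le> t" "t \<le> 1" using cD by (cases c) auto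
    have z: "w (i c) = z"
      using N c by (auto simp: w_def i_def j_def fun_eq_iff disc_set_def)
    then have "m (i c) = 1" using c(2) by (simp add: m_def disc_set_def)
    then show ?thesis using z c N by (simp add: r_def i_def j_def)
  qed
  have "continuous_on UNIV r"
    unfolding r_def
  proof (intro continuous_on_Pair continuous_on_coordinatewise_then_product)
    have cw: "continuous_on UNIV (\<lambda>x. w x k)" for k
      by (cases "k < n") (auto simp: w_def intro!: continuous_intros)
    then have "continuous_on UNIV m"
      unfolding m_def by (intro continuous_intros)
    with cw show "continuous_on UNIV (\<lambda>x. w x k / m x)" for k
    proof (intro continuous_intros ballI)
      show "m x \<noteq> 0" for x using m[of x] by linarith
    qed auto
  qed (intro continuous_intros continuous_on_product_coordinates)
  moreover have "r x \<in> disc_set n \<times> {0..1}" for x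
  proof -
    have "(\<Sum>i<n. (w x i / m x)\<^sup>2) = (\<Sum>i<n. (w x i)\<^sup>2) / (m x)\<^sup>2"
      by (simp add: power_divide sum_divide_distrib)
    also have "\<dots> \<le> 1"
    proof -
      have "sqrt (\<Sum>i<n. (w x i)\<^sup>2) \<le> m x" by (simp add: m_def)
      then have "(\<Sum>i<n. (w x i)\<^sup>2) \<le> (m x)\<^sup>2"
        by (rule sqrt_le_D)
      then show ?thesis using m[of x] by (simp add: divide_le_eq)
    qed
    finally show ?thesis by (auto simp: r_def disc_set_def w_def)
  qed
  ultimately have rc: "continuous_map (simplex_top (n+1)) (top_of_set (disc_set n \<times> {0..1})) r"
    by (auto simp: euclidean_product_topology intro: continuous_on_subset)
  have jc: "continuous_on UNIV (\<lambda>c. j c k)" for k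
    unfolding j_def case_prod_beta using N
    by (cases "k < n"; cases "k = n") (auto intro!: continuous_intros continuous_on_coord[OF continuous_on_fst])
  have "continuous_on UNIV i"
  proof (intro continuous_on_coordinatewise_then_product)
    fix k show "continuous_on UNIV (\<lambda>c. i c k)"
      unfolding i_def by (cases "k = n + 1") (auto intro!: continuous_intros jc)
  qed
  then have "continuous_map (top_of_set (disc_set n \<times> {0..1})) (simplex_top (n+1)) i"
    using isimp by (auto simp: euclidean_product_topology intro: continuous_on_subset)
  from delta_generated_retract[OF delta_generated_simplex rc this] ri show ?thesis by simp
qed

text \<open>\<open>disc 0\<close> consists of one point, so the interval is a retract of the
  cylinder over it.\<close>

lemma delta_generated_unit_interval: "delta_generated (top_of_set {0..1::real})"
proof (rule delta_generated_retract[OF delta_generated_disc_cylinder[of 0]])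
  show "continuous_map (top_of_set (disc_set 0 \<times> {0..1})) (top_of_set {0..1}) snd"
    by (auto intro!: continuous_intros)
  show "continuous_map (top_of_set {0..1}) (top_of_set (disc_set 0 \<times> {0..1})) (\<lambda>t. (\<lambda>_. 0, t))"
    by (auto simp: disc_set_def intro!: continuous_intros)
qed simp

lemma delta_generated_sphere_cylinder: "delta_generated (top_of_set (sphere_set n \<times> {0..1::real}))"
proof (rule delta_generated_local_retract)
  fix c assume "c \<in> topspace (top_of_set (sphere_set n \<times> {0..1::real}))"
  then obtain x0 t0 where c: "c = (x0, t0)" "x0 \<in> sphere_set n" "0 \<le> t0" "t0 \<le> 1" by auto
  \<comment> \<open>Near \<open>x0\<close>, the sphere is a retract of the disc by \<open>y \<mapsto> (x0 + y/2) / |x0 + y/2|\<close>.\<close>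
  define sn where "sn = (\<lambda>x::nat\<Rightarrow>real. sqrt (\<Sum>i<n. (x i)\<^sup>2))"
  have snL: "sn x = L2_set x {..<n}" for x by (simp add: sn_def L2_set_def)
  have x0: "sn x0 = 1" "\<And>i. i \<ge> n \<Longrightarrow> x0 i = 0" using c(2) by (auto simp: sn_def sphere_set_def)
  define a where "a = (\<lambda>y::nat\<Rightarrow>real. \<lambda>k. x0 k + y k / 2)"
  \<comment> \<open>Halving \<open>y\<close> keeps the norm of \<open>x0 + y/2\<close> at least
    \<open>1 - 1/2\<close>, so the normalisation in \<open>r\<close> never divides by zero.\<close>
  have a: "sn (a y) \<ge> 1/2" if "y \<in> disc_set n" for y
  proof -
    have y: "sn y \<le> 1" using that by (simp add: sn_def disc_set_def)
    have "sn x0 \<le> sn (a y) + sn (\<lambda>k. - (1/2) * y k)"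
      using L2_set_triangle_ineq[of "a y" "\<lambda>k. - (1/2) * y k" "{..<n}"] by (simp add: snL a_def)
    moreover have "sn (\<lambda>k. - (1/2) * y k) = sn y / 2"
      by (simp add: sn_def power_mult_distrib power_divide flip: sum_divide_distrib)
        (simp add: real_sqrt_divide)
    ultimately show ?thesis using x0 y by simp
  qed
  define r where "r = (\<lambda>(y, t::real). (\<lambda>k. a y k / sn (a y), t))"
  \<comment> \<open>The factor 2 undoes the half in \<open>a\<close>, so that \<open>a\<close> takes
    \<open>2 * (x - x0)\<close> back to \<open>x\<close>; the radius 1/2 of \<open>N\<close> keeps
    \<open>2 * (x - x0)\<close> in the unit disc.\<close>
  define i where "i = (\<lambda>(x::nat\<Rightarrow>real, t::real). (\<lambda>k. 2 * (x k - x0 k), t))"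
  define N where "N = {(x, t). x \<in> sphere_set n \<and> t \<in> {0..1::real} \<and> sn (\<lambda>k. x k - x0 k) < 1/2}"
  have snc: "continuous_on UNIV sn" unfolding sn_def by (intro continuous_intros continuous_on_product_coordinates)
  have "openin (top_of_set (sphere_set n \<times> {0..1})) N"
  proof -
    have "continuous_on UNIV (\<lambda>c::(nat\<Rightarrow>real)\<times>real. sn (\<lambda>k. fst c k - x0 k))"
      unfolding sn_def by (intro continuous_intros continuous_on_coord[OF continuous_on_fst])
    then have "open {c::(nat\<Rightarrow>real)\<times>real. sn (\<lambda>k. fst c k - x0 k) < 1/2}"
      by (intro open_Collect_less) auto
    moreover have "N = (sphere_set n \<times> {0..1}) \<inter> {c. sn (\<lambda>k. fst c k - x0 k) < 1/2}"
      by (auto simp: N_def)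
    ultimately show ?thesis by (simp add: openin_open_Int)
  qed
  moreover have "c \<in> N" using c by (simp add: N_def sn_def)
  moreover have "continuous_map (top_of_set (disc_set n \<times> {0..1})) (top_of_set (sphere_set n \<times> {0..1})) r"
  proof -
    have "r p \<in> sphere_set n \<times> {0..1}" if p: "p \<in> disc_set n \<times> {0..1}" for p
    proof -
      obtain y t where p: "p = (y, t)" "y \<in> disc_set n" "0 \<le> t" "t \<le> 1" using p by auto
      have "(\<Sum>i<n. (a y i / sn (a y))\<^sup>2) = (\<Sum>i<n. (a y i)\<^sup>2) / (sn (a y))\<^sup>2"
        by (simp add: power_divide sum_divide_distrib)
      also have "\<dots> = 1"
      proof -
        have "sn (a y) \<noteq> 0" using a[OF p(2)] by linarith
        then show ?thesis by (simp add: sn_def sum_nonneg)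
      qed
      finally show ?thesis using p x0 by (auto simp: r_def sphere_set_def a_def disc_set_def)
    qed
    moreover have "continuous_on (disc_set n \<times> {0..1}) r"
      unfolding r_def case_prod_beta
    proof (intro continuous_on_Pair continuous_on_coordinatewise_then_product)
      have ac: "continuous_on S (\<lambda>p. a (fst p))" for S :: "((nat\<Rightarrow>real)\<times>real) set"
        unfolding a_def by (intro continuous_intros continuous_on_coord[OF continuous_on_fst]) auto
      have "continuous_on (disc_set n \<times> {0..1::real}) (\<lambda>p. sn (a (fst p)))"
        using continuous_on_compose2[OF snc ac] by blast
      then show "continuous_on (disc_set n \<times> {0..1::real}) (\<lambda>p. a (fst p) k / sn (a (fst p)))" for k
      proof (intro continuous_intros continuous_on_coord[OF ac] ballI)
        show "sn (a (fst p)) \<noteq> 0" if "p \<in> disc_set n \<times> {0..1::real}" for p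
          using a[of "fst p"] that by (auto simp: mem_Times_iff)
      qed
    qed (intro continuous_intros)
    ultimately show ?thesis by auto
  qed
  moreover have "continuous_map (subtopology (top_of_set (sphere_set n \<times> {0..1})) N)
      (top_of_set (disc_set n \<times> {0..1})) i"
  proof -
    have "i p \<in> disc_set n \<times> {0..1}" if "p \<in> N" for p
    proof -
      obtain x t where p: "p = (x, t)" "x \<in> sphere_set n" "0 \<le> t" "t \<le> 1" "sn (\<lambda>k. x k - x0 k) < 1/2"
        using \<open>p \<in> N\<close> by (auto simp: N_def)
      have "(sn (\<lambda>k. x k - x0 k))\<^sup>2 \<le> (1/2)\<^sup>2"
        using p(5) by (intro power_mono) (auto simp: sn_def sum_nonneg)
      then have "(\<Sum>i<n. (x i - x0 i)\<^sup>2) \<le> 1/4"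
        by (simp add: sn_def sum_nonneg power2_eq_square)
      moreover have "(\<Sum>i<n. (2 * (x i - x0 i))\<^sup>2) = 4 * (\<Sum>i<n. (x i - x0 i)\<^sup>2)"
        by (simp only: power_mult_distrib sum_distrib_left) simp
      ultimately show ?thesis using p x0 by (auto simp: i_def disc_set_def sphere_set_def)
    qed
    moreover have "continuous_on N i"
      unfolding i_def case_prod_beta
      by (intro continuous_intros continuous_on_coord[OF continuous_on_fst])
    moreover have "subtopology (top_of_set (sphere_set n \<times> {0..1})) N = top_of_set N"
      by (auto simp: subtopology_subtopology N_def intro!: arg_cong[where f="subtopology _"])
    ultimately show ?thesis by auto
  qed
  moreover have "r (i p) = p" if "p \<in> N" for p
  proof -
    obtain x t where p: "p = (x, t)" "x \<in> sphere_set n"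
      using \<open>p \<in> N\<close> by (auto simp: N_def)
    have "a (\<lambda>k. 2 * (x k - x0 k)) = x" by (simp add: a_def fun_eq_iff field_simps)
    moreover have "sn x = 1" using p by (simp add: sn_def sphere_set_def)
    ultimately show ?thesis using p by (simp add: r_def i_def)
  qed
  ultimately show "\<exists>N (Y::((nat\<Rightarrow>real)\<times>real) topology) r i. openin (top_of_set (sphere_set n \<times> {0..1})) N \<and> c \<in> N \<and> delta_generated Y \<and>
    continuous_map Y (top_of_set (sphere_set n \<times> {0..1})) r \<and>
    continuous_map (subtopology (top_of_set (sphere_set n \<times> {0..1})) N) Y i \<and> (\<forall>y\<in>N. r (i y) = y)"
    using delta_generated_disc_cylinder[of n] by blast
qed

lemma cylinder_disc: "cylinder (disc n) = top_of_set (disc_set n \<times> {0..1})"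
  by (simp add: cylinder_def disc_eq prod_top_of_set deltafy_eq delta_generated_disc_cylinder)

lemma cylinder_disc_bd: "cylinder (disc_bd n) = top_of_set (sphere_set n \<times> {0..1})"
  by (simp add: cylinder_def disc_bd_eq prod_top_of_set deltafy_eq delta_generated_sphere_cylinder)

section \<open>Globes\<close>

text \<open>The values at the two states are separate arguments, because for empty \<open>Z\<close>
  no point of the cylinder lies over a state. If \<open>H\<close> takes these values at its two
  ends, this is the map it induces on the quotient.\<close>

definition glob_fun :: "'e \<Rightarrow> 'e \<Rightarrow> ('z \<times> real \<Rightarrow> 'e) \<Rightarrow> 'z globe_pt \<Rightarrow> 'e" where
  "glob_fun a b H = case_globe_pt a b (\<lambda>z t. H (z, t))"

lemma glob_fun_class:
  assumes "H (z, 0) = a" "H (z, 1) = b"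
  shows "glob_fun a b H (glob_class (z, t)) = H (z, t)"
  using assms by (simp add: glob_fun_def glob_class_def)

lemma topspace_cylinder [simp]: "topspace (cylinder Z) = topspace Z \<times> {0..1}"
  by (simp add: cylinder_def)

lemma pts_globe_cases:
  assumes "c \<in> pts (globe Z)"
  obtains "c = Src" | "c = Tgt" | z t where "z \<in> topspace Z" "0 \<le> t" "t \<le> 1" "c = glob_class (z, t)"
proof -
  consider "c = Src" | "c = Tgt" | z t where "z \<in> topspace Z" "0 < t" "t < 1" "c = Mid z t"
    using assms by (auto simp: pts_globe)
  then show thesis
  proof cases
    case (3 z t)
    with that(3)[of z t] show ?thesis by (simp add: glob_class_def)
  qed (use that in auto)
qed

lemma glob_class_in_pts:
  "z \<in> topspace Z \<Longrightarrow> 0 \<le> t \<Longrightarrow> t \<le> 1 \<Longrightarrow> glob_class (z, t) \<in> pts (globe Z)"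
  by (auto simp: pts_globe glob_class_def)

lemma states_globe [simp]: "states (globe Z) = {Src, Tgt}"
  by (simp add: globe_def)

text \<open>The property of the quotient topology. The membership conditions on the states do not
  follow from continuity on the cylinder when \<open>Z\<close> is empty, as for the boundary of the
  0-disc.\<close>

lemma continuous_map_globe:
  "continuous_map (und (globe Z)) Y f \<longleftrightarrow>
     continuous_map (cylinder Z) Y (f \<circ> glob_class) \<and> f Src \<in> topspace Y \<and> f Tgt \<in> topspace Y"
  (is "?L \<longleftrightarrow> ?R")
proof
  assume L: ?L
  have "continuous_map (cylinder Z) (und (globe Z)) glob_class"
    unfolding continuous_map_def using glob_class_in_pts[where Z=Z]
    by (auto simp: openin_globe globe_open_def)
  from continuous_map_compose[OF this L] have "continuous_map (cylinder Z) Y (f \<circ> glob_class)" .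
  moreover have "f Src \<in> topspace Y \<and> f Tgt \<in> topspace Y"
    using continuous_map_image_subset_topspace[OF L] by (auto simp: pts_globe image_subset_iff)
  ultimately show ?R by simp
next
  assume R: ?R
  then have c: "continuous_map (cylinder Z) Y (f \<circ> glob_class)" by simp
  show ?L
    unfolding continuous_map_def
  proof (intro conjI allI impI)
    show "f \<in> pts (globe Z) \<rightarrow> topspace Y"
      using continuous_map_image_subset_topspace[OF c] R
      by (auto elim!: pts_globe_cases simp: image_subset_iff)
    fix U assume "openin Y U"
    from openin_continuous_map_preimage[OF c this]
    have "openin (cylinder Z) {x \<in> topspace (cylinder Z). (f \<circ> glob_class) x \<in> U}" .
    moreover have "{x \<in> topspace (cylinder Z). (f \<circ> glob_class) x \<in> U} =
      {c \<in> topspace (cylinder Z). glob_class c \<in> {x \<in> pts (globe Z). f x \<in> U}}"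
      using glob_class_in_pts[where Z=Z] by auto
    moreover have "{x \<in> pts (globe Z). f x \<in> U} \<subseteq> {Src, Tgt} \<union> glob_class ` topspace (cylinder Z)"
      by (auto elim!: pts_globe_cases)
    ultimately show "openin (und (globe Z)) {x \<in> pts (globe Z). f x \<in> U}"
      unfolding openin_globe globe_open_def by simp
  qed
qed

text \<open>Delta-generation passes to quotients: a probe-open set of the globe has a probe-open
  preimage in the cylinder, and such a set is open there because the cylinder is a
  coreflection.\<close>

lemma delta_generated_globe: "delta_generated (und (globe Z))"
  unfolding delta_generated_def openin_globe
proof (intro allI impI)
  fix U assume U: "probe_open (und (globe Z)) U"
  have "continuous_map (cylinder Z) (und (globe Z)) (\<lambda>x. glob_class x)"
    using continuous_map_globe[of Z "und (globe Z)" "\<lambda>x. x"] by (simp add: o_def)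
  from probe_open_preimage[OF this U]
  have "openin (cylinder Z) {x \<in> topspace (cylinder Z). glob_class x \<in> U}"
    using delta_generated_deltafy by (auto simp: cylinder_def delta_generated_def)
  moreover have "U \<subseteq> {Src, Tgt} \<union> glob_class ` topspace (cylinder Z)"
    using U by (auto simp: probe_open_def elim!: pts_globe_cases dest!: subsetD)
  ultimately show "globe_open Z U" by (simp add: globe_open_def)
qed

section \<open>Reparametrisations, morphisms, and morphisms out of globes\<close>

lemma id_Rep_plus [simp]: "(\<lambda>t. t) \<in> Rep_plus"
  by (auto simp: Rep_plus_def mono_on_def)

lemma Rep_plus_in: "\<phi> \<in> Rep_plus \<Longrightarrow> 0 \<le> t \<Longrightarrow> t \<le> 1 \<Longrightarrow> 0 \<le> \<phi> t \<and> \<phi> t \<le> 1"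
  by (force simp: Rep_plus_def)

lemma Rep_plus_ends:
  assumes "\<phi> \<in> Rep_plus"
  shows "\<phi> 0 = 0" "\<phi> 1 = 1"
proof -
  have m: "mono_on {0..1} \<phi>" and im: "\<phi> ` {0..1} = {0..1}" using assms by (auto simp: Rep_plus_def)
  have "0 \<in> \<phi> ` {0..1}" "1 \<in> \<phi> ` {0..1}" using im by simp_all
  then obtain a b where a: "a \<in> {0..1}" "\<phi> a = 0" and b: "b \<in> {0..1}" "\<phi> b = 1"
    by (metis imageE)
  have "\<phi> 0 \<le> 0" using mono_onD[OF m, of 0 a] a by simp
  moreover have "\<phi> 1 \<ge> 1" using mono_onD[OF m, of b 1] b by simp
  ultimately show "\<phi> 0 = 0" "\<phi> 1 = 1"
    using Rep_plus_in[OF assms, of 0] Rep_plus_in[OF assms, of 1] by auto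
qed

lemma md_mapD:
  assumes "md_map A B f"
  shows "continuous_map (und A) (und B) f" "a \<in> states A \<Longrightarrow> f a \<in> states B"
    "x \<in> epaths A \<Longrightarrow> compose {0..1} f x \<in> epaths B" "a \<in> pts A \<Longrightarrow> f a \<in> pts B"
  using assms continuous_map_image_subset_topspace[of "und A" "und B" f] by (auto simp: md_map_def)

lemma mdspaceD:
  assumes "mdspace T A"
  shows "in_Top T (und A)" "a \<in> states A \<Longrightarrow> a \<in> pts A" "x \<in> epaths A \<Longrightarrow> x \<in> paths_in (und A)"
    "x \<in> epaths A \<Longrightarrow> \<phi> \<in> Rep_plus \<Longrightarrow> compose {0..1} x \<phi> \<in> epaths A"
    "x \<in> epaths A \<Longrightarrow> y \<in> epaths A \<Longrightarrow> x 1 = y 0 \<Longrightarrow> norm_comp x y \<in> epaths A"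
    "x \<in> epaths A \<Longrightarrow> x 0 \<in> states A" "x \<in> epaths A \<Longrightarrow> x 1 \<in> states A"
    "x \<in> epaths A \<Longrightarrow> 0 \<le> s \<Longrightarrow> s \<le> 1 \<Longrightarrow> x s \<in> pts A"
    "delta_generated (und A)"
proof -
  show g: "x \<in> epaths A \<Longrightarrow> x \<in> paths_in (und A)"
    using assms by (auto simp: mdspace_def)
  show "x \<in> pts A" if "x \<in> states A" for x using assms that by (auto simp: mdspace_def)
  show "delta_generated (und A)" using assms by (cases T) (auto simp: mdspace_def)
  assume "x \<in> epaths A" "0 \<le> s" "s \<le> 1"
  with g show "x s \<in> pts A"
    using continuous_map_image_subset_topspace[of "top_of_set {0..1}" "und A" x]
    by (auto simp: paths_in_def pathin_def image_subset_iff)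
qed (use assms in \<open>auto simp: mdspace_def\<close>)

lemma md_map_compose:
  assumes "md_map A B f" "md_map B C g"
  shows "md_map A C (\<lambda>x. g (f x))"
proof -
  have "compose {0..1} (\<lambda>x. g (f x)) x = compose {0..1} g (compose {0..1} f x)" for x
    by (auto simp: compose_def)
  moreover have "continuous_map (und A) (und C) (\<lambda>x. g (f x))"
    using continuous_map_compose[OF md_mapD(1)[OF assms(1)] md_mapD(1)[OF assms(2)]] by (simp add: o_def)
  ultimately show ?thesis
    using md_mapD(2,3)[OF assms(1)] md_mapD(2,3)[OF assms(2)]
    unfolding md_map_def image_subset_iff by metis
qed

lemma globe_epath: "z \<in> topspace Z \<Longrightarrow> \<phi> \<in> Rep_plus \<Longrightarrow> (\<lambda>t\<in>{0..1}. glob_class (z, \<phi> t)) \<in> epaths (globe Z)"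
  by (auto simp: globe_def)

text \<open>Read off from the explicit form of the execution paths, so that
  \<open>md_map_carried_by\<close> applies to a globe without a proof that it is an
  \<open>mdspace\<close>.\<close>

lemma globe_epath_pts:
  assumes "x \<in> epaths (globe Z)" "0 \<le> s" "s \<le> 1"
  shows "x s \<in> pts (globe Z)"
proof -
  obtain z \<phi> where "x = (\<lambda>t\<in>{0..1}. glob_class (z, \<phi> t))" "z \<in> topspace Z" "\<phi> \<in> Rep_plus"
    using assms(1) by (auto simp: globe_def)
  with assms(2,3) Rep_plus_in show ?thesis by (auto intro: glob_class_in_pts)
qed

lemma globe_map_pathD:
  assumes "md_map (globe Z) E h" "z \<in> topspace Z" "\<phi> \<in> Rep_plus"
  shows "(\<lambda>t\<in>{0..1}. h (glob_class (z, \<phi> t))) \<in> epaths E"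
proof -
  have "compose {0..1} h (\<lambda>t\<in>{0..1}. glob_class (z, \<phi> t)) \<in> epaths E"
    using md_mapD(3)[OF assms(1) globe_epath[OF assms(2,3)]] .
  moreover have "compose {0..1} h (\<lambda>t\<in>{0..1}. glob_class (z, \<phi> t)) = (\<lambda>t\<in>{0..1}. h (glob_class (z, \<phi> t)))"
    by (auto simp: compose_def)
  ultimately show ?thesis by simp
qed

lemma globe_map_pathI:
  assumes "continuous_map (und (globe Z)) (und E) h" "h Src \<in> states E" "h Tgt \<in> states E"
    "\<And>z \<phi>. z \<in> topspace Z \<Longrightarrow> \<phi> \<in> Rep_plus \<Longrightarrow> (\<lambda>t\<in>{0..1}. h (glob_class (z, \<phi> t))) \<in> epaths E"
  shows "md_map (globe Z) E h"
proof -
  have "compose {0..1} h (\<lambda>t\<in>{0..1}. glob_class (z, \<phi> t)) = (\<lambda>t\<in>{0..1}. h (glob_class (z, \<phi> t)))" for z \<phi>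
    by (auto simp: compose_def)
  moreover have "x \<in> epaths (globe Z) \<Longrightarrow>
      \<exists>z \<phi>. x = (\<lambda>t\<in>{0..1}. glob_class (z, \<phi> t)) \<and> z \<in> topspace Z \<and> \<phi> \<in> Rep_plus" for x
    by (auto simp: globe_def)
  ultimately have "compose {0..1} h x \<in> epaths E" if "x \<in> epaths (globe Z)" for x
    using that assms(4) by metis
  with assms(1-3) show ?thesis by (simp add: md_map_def)
qed

text \<open>Only the paths with identity reparametrisation have to be tested: the other execution
  paths of the globe are their composites with elements of \<open>Rep_plus\<close>, and
  \<open>epaths E\<close> is closed under these.\<close>

lemma glob_fun_md_map:
  assumes E: "mdspace T E" and H: "continuous_map (cylinder Z) (und E) H"
    and ends: "\<And>z. z \<in> topspace Z \<Longrightarrow> H (z, 0) = a" "\<And>z. z \<in> topspace Z \<Longrightarrow> H (z, 1) = b"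
    and ab: "a \<in> states E" "b \<in> states E"
    and p: "\<And>z. z \<in> topspace Z \<Longrightarrow> (\<lambda>t\<in>{0..1}. H (z, t)) \<in> epaths E"
  shows "md_map (globe Z) E (glob_fun a b H)"
proof (rule globe_map_pathI)
  have "continuous_map (cylinder Z) (und E) (glob_fun a b H \<circ> glob_class)"
    by (rule continuous_map_eq[OF H]) (auto simp: glob_fun_class ends)
  with ab mdspaceD(2)[OF E] show "continuous_map (und (globe Z)) (und E) (glob_fun a b H)"
    unfolding continuous_map_globe by (simp add: glob_fun_def)
  show "glob_fun a b H Src \<in> states E" "glob_fun a b H Tgt \<in> states E"
    using ab by (simp_all add: glob_fun_def)
  fix z \<phi> assume z: "z \<in> topspace Z" and \<phi>: "\<phi> \<in> Rep_plus"
  have "compose {0..1} (\<lambda>t\<in>{0..1}. H (z, t)) \<phi> \<in> epaths E"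
    using mdspaceD(4)[OF E p[OF z] \<phi>] .
  moreover have "compose {0..1} (\<lambda>t\<in>{0..1}. H (z, t)) \<phi> = (\<lambda>t\<in>{0..1}. glob_fun a b H (glob_class (z, \<phi> t)))"
    using Rep_plus_in[OF \<phi>] by (auto simp: compose_def glob_fun_class ends[OF z])
  ultimately show "(\<lambda>t\<in>{0..1}. glob_fun a b H (glob_class (z, \<phi> t))) \<in> epaths E" by simp
qed

section \<open>Test objects on arbitrary types\<close>

text \<open>The universal properties in \<open>cellular\<close> only concern test objects on the type \<open>'a \<times> 'i \<times> real\<close>.
  For a test object \<open>E\<close> on another type, the part of \<open>E\<close> lying over the image \<open>S\<close> of a cocone is small
  enough to be moved to that type along an injection \<open>e\<close>.\<close>

definition carried_by :: "'e mdspace \<Rightarrow> 'e set \<Rightarrow> ('e \<Rightarrow> 't) \<Rightarrow> 't mdspace" where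
  "carried_by E S e = \<lparr>und = deltafy (pullback_topology (e ` S) (inv_into S e) (und E)),
     states = e ` (S \<inter> states E), epaths = {compose {0..1} e x | x. x \<in> epaths E \<and> x ` {0..1} \<subseteq> S}\<rparr>"

context
  fixes T and E :: "'e mdspace" and S and e :: "'e \<Rightarrow> 't"
  assumes E: "mdspace T E" and S: "S \<subseteq> pts E" and e: "inj_on e S"
begin

lemma inv_e: "x \<in> S \<Longrightarrow> inv_into S e (e x) = x"
  using e by simp

lemma pts_carried_by: "pts (carried_by E S e) = e ` S"
  using S by (auto simp: carried_by_def topspace_pullback_topology inv_e)

text \<open>The pullback topology tests a map after composition with \<open>inv_into S e\<close>,
  and the coreflection on top of it is invisible to a Delta-generated source.\<close>

lemma continuous_carried_by:
  assumes "delta_generated X" "continuous_map X (und E) g" "g ` topspace X \<subseteq> S"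
  shows "continuous_map X (und (carried_by E S e)) (e \<circ> g)"
  unfolding carried_by_def
proof (simp, rule continuous_map_into_deltafy[OF assms(1)], rule continuous_map_pullback')
  show "continuous_map X (und E) (inv_into S e \<circ> (e \<circ> g))"
    by (rule continuous_map_eq[OF assms(2)]) (use assms(3) in \<open>auto simp: inv_e image_subset_iff\<close>)
  show "topspace X \<subseteq> (e \<circ> g) -` e ` S"
    using assms(3) by auto
qed

lemma continuous_from_carried_by: "continuous_map (und (carried_by E S e)) (und E) (inv_into S e)"
  unfolding carried_by_def
  by (simp, rule continuous_map_from_deltafy, rule continuous_map_pullback[of _ _ "\<lambda>x. x", unfolded o_def id_def])
    simp

lemma md_map_from_carried_by: "md_map (carried_by E S e) E (inv_into S e)"
proof -
  have "compose {0..1} (inv_into S e) (compose {0..1} e x) = x" if "x \<in> epaths E" "x ` {0..1} \<subseteq> S" for x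
  proof -
    have "x \<in> extensional {0..1}" using mdspaceD(3)[OF E that(1)] by (simp add: paths_in_def)
    then show ?thesis
      using that(2) by (auto simp: compose_def inv_e fun_eq_iff image_subset_iff extensional_def)
  qed
  then show ?thesis
    using continuous_from_carried_by by (auto simp: md_map_def carried_by_def inv_e)
qed

text \<open>The conditions on \<open>A\<close> are listed separately, in place of
  \<open>mdspace T A\<close>, so that globes are covered as well.\<close>

lemma md_map_carried_by:
  assumes "delta_generated (und A)" "md_map A E g" "g ` pts A \<subseteq> S" "states A \<subseteq> pts A"
    "\<And>x s. x \<in> epaths A \<Longrightarrow> 0 \<le> s \<Longrightarrow> s \<le> 1 \<Longrightarrow> x s \<in> pts A"
  shows "md_map A (carried_by E S e) (\<lambda>x. e (g x))"
proof -
  have "continuous_map (und A) (und (carried_by E S e)) (\<lambda>x. e (g x))"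
    using continuous_carried_by[OF assms(1) md_mapD(1)[OF assms(2)] assms(3)] by (simp add: o_def)
  moreover have "(\<lambda>x. e (g x)) ` states A \<subseteq> states (carried_by E S e)"
    using assms(3,4) md_mapD(2)[OF assms(2)] by (auto simp: carried_by_def intro!: imageI)
  moreover have "compose {0..1} (\<lambda>x. e (g x)) x \<in> epaths (carried_by E S e)" if x: "x \<in> epaths A" for x
  proof -
    have "compose {0..1} (\<lambda>x. e (g x)) x = compose {0..1} e (compose {0..1} g x)"
      by (auto simp: compose_def)
    moreover have "compose {0..1} g x ` {0..1} \<subseteq> S"
      using assms(3,5) x by (auto simp: compose_def image_subset_iff)
    ultimately show ?thesis
      using md_mapD(3)[OF assms(2) x] by (auto simp: carried_by_def)
  qed
  ultimately show ?thesis by (simp add: md_map_def)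
qed

lemma mdspace_carried_by: "mdspace T (carried_by E S e)"
proof -
  let ?F = "carried_by E S e"
  have dg: "delta_generated (und ?F)" by (simp add: carried_by_def delta_generated_deltafy)
  have ptsF: "inv_into S e y \<in> S" "e (inv_into S e y) = y" if "y \<in> pts ?F" for y
    using that by (auto simp: pts_carried_by inv_e)
  have pathI: "pathin (und ?F) (\<lambda>t. e (x t))" if "pathin (und E) x" "x ` {0..1} \<subseteq> S" for x
    using continuous_carried_by[OF delta_generated_unit_interval, of x] that
    by (simp add: pathin_def o_def)
  have "in_Top T (und ?F)"
  proof (cases T)
    case Delta_Generated then show ?thesis using dg by simp
  next
    case Delta_Hausdorff
    \<comment> \<open>\<open>inv_into S e\<close> is continuous and injective on the new points, so
      the image of \<open>g\<close> is the preimage of a path image in \<open>E\<close>, which is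
      closed there.\<close>
    have "closedin (und ?F) (g ` {0..1})" if g: "pathin (und ?F) g" for g
    proof -
      have gF: "g ` {0..1} \<subseteq> e ` S"
        using continuous_map_image_subset_topspace[OF g[unfolded pathin_def]] pts_carried_by by simp
      have "pathin (und E) (inv_into S e \<circ> g)"
        using continuous_map_compose[OF g[unfolded pathin_def] continuous_from_carried_by]
        by (simp add: pathin_def)
      then have "closedin (und E) ((inv_into S e \<circ> g) ` {0..1})"
        using mdspaceD(1)[OF E] Delta_Hausdorff by (auto simp: delta_Hausdorff_def)
      from closedin_continuous_map_preimage[OF continuous_from_carried_by this]
      have "closedin (und ?F) {y \<in> pts ?F. inv_into S e y \<in> (inv_into S e \<circ> g) ` {0..1}}" .
      moreover have "{y \<in> pts ?F. inv_into S e y \<in> (inv_into S e \<circ> g) ` {0..1}} = g ` {0..1}"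
      proof (intro equalityI subsetI)
        fix y assume "y \<in> {y \<in> pts ?F. inv_into S e y \<in> (inv_into S e \<circ> g) ` {0..1}}"
        then obtain t where t: "y \<in> pts ?F" "t \<in> {0..1}" "inv_into S e y = inv_into S e (g t)" by auto
        then have "g t \<in> pts ?F" using gF pts_carried_by by auto
        then show "y \<in> g ` {0..1}" using t ptsF(2) by (metis imageI)
      qed (use gF pts_carried_by in auto)
      ultimately show ?thesis by simp
    qed
    then show ?thesis using dg Delta_Hausdorff by (simp add: delta_Hausdorff_def)
  qed
  moreover have "states ?F \<subseteq> pts ?F"
    by (auto simp: pts_carried_by) (auto simp: carried_by_def)
  moreover have "y \<in> paths_in (und ?F) \<and> y 0 \<in> states ?F \<and> y 1 \<in> states ?F \<and>
     (\<forall>\<phi>\<in>Rep_plus. compose {0..1} y \<phi> \<in> epaths ?F)" if y: "y \<in> epaths ?F" for y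
  proof -
    obtain x where x: "y = compose {0..1} e x" "x \<in> epaths E" "x ` {0..1} \<subseteq> S"
      using y by (auto simp: carried_by_def)
    have "pathin (und E) x" using mdspaceD(3)[OF E x(2)] by (simp add: paths_in_def)
    from pathI[OF this x(3)] have "pathin (und ?F) y"
      unfolding pathin_def x(1) by (rule continuous_map_eq) (simp add: compose_def)
    then have "y \<in> paths_in (und ?F)" by (simp add: paths_in_def x(1) compose_extensional)
    moreover have "y 0 \<in> states ?F" "y 1 \<in> states ?F"
      using x(3) mdspaceD(6,7)[OF E x(2)]
      by (auto simp: x(1) carried_by_def compose_def intro!: imageI)
    moreover have "compose {0..1} y \<phi> \<in> epaths ?F" if \<phi>: "\<phi> \<in> Rep_plus" for \<phi>
    proof -
      have "compose {0..1} y \<phi> = compose {0..1} e (compose {0..1} x \<phi>)"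
        using Rep_plus_in[OF \<phi>] by (auto simp: x(1) compose_def)
      moreover have "compose {0..1} x \<phi> ` {0..1} \<subseteq> S"
        using Rep_plus_in[OF \<phi>] x(3) by (auto simp: compose_def image_subset_iff)
      ultimately show ?thesis
        using mdspaceD(4)[OF E x(2) \<phi>] by (auto simp: carried_by_def)
    qed
    ultimately show ?thesis by blast
  qed
  moreover have "norm_comp y y' \<in> epaths ?F" if y: "y \<in> epaths ?F" "y' \<in> epaths ?F" "y 1 = y' 0" for y y'
  proof -
    obtain x where x: "y = compose {0..1} e x" "x \<in> epaths E" "x ` {0..1} \<subseteq> S"
      using y by (auto simp: carried_by_def)
    obtain x' where x': "y' = compose {0..1} e x'" "x' \<in> epaths E" "x' ` {0..1} \<subseteq> S"
      using y by (auto simp: carried_by_def)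
    \<comment> \<open>Injectivity of \<open>e\<close> matters here: paths that meet after transport
      already meet in \<open>E\<close>, so their concatenation is transported from \<open>E\<close>
      too.\<close>
    have "e (x 1) = e (x' 0)" using y(3) by (simp add: x x' compose_def)
    moreover have "x 1 \<in> S" "x' 0 \<in> S" using x(3) x'(3) by auto
    ultimately have "x 1 = x' 0" using e by (meson inj_onD)
    with x x' have "norm_comp x x' \<in> epaths E" using mdspaceD(5)[OF E] by blast
    moreover have "norm_comp x x' ` {0..1} \<subseteq> S"
      using x(3) x'(3) by (auto simp: norm_comp_def image_subset_iff)
    moreover have "norm_comp y y' = compose {0..1} e (norm_comp x x')"
      by (auto simp: norm_comp_def x x' compose_def)
    ultimately show ?thesis by (auto simp: carried_by_def)
  qed
  ultimately show ?thesis unfolding mdspace_def by blast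
qed

end

section \<open>Cellular towers\<close>

text \<open>A sequence of reals is coded by the set of pairs \<open>(k, m)\<close> with
  \<open>m\<close> in the set of naturals coding its term of index \<open>k\<close>. A middle point
  becomes a sequence headed by the tag 2, then its time, then \<open>z\<close>; the states become
  the constant sequences 0 and 1. In this way points of a cell fit into the last factor of the test
  type.\<close>

lemma inj_globe_pt_real: "\<exists>c :: (nat \<Rightarrow> real) globe_pt \<Rightarrow> real. inj c"
proof -
  obtain \<gamma> :: "nat set \<Rightarrow> real" where \<gamma>: "inj \<gamma>"
    using nat_sets_eqpoll_reals by (metis bij_betw_imp_inj_on eqpoll_def)
  obtain \<beta> :: "real \<Rightarrow> nat set" where \<beta>: "inj \<beta>"
    using nat_sets_eqpoll_reals eqpoll_sym by (metis bij_betw_imp_inj_on eqpoll_def)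
  define code where "code = (\<lambda>x::nat \<Rightarrow> real. {q. snd (prod_decode q) \<in> \<beta> (x (fst (prod_decode q)))})"
  have code: "inj code"
  proof (rule injI, rule ext)
    fix x y k assume eq: "code x = code y"
    have "m \<in> \<beta> (x k) \<longleftrightarrow> prod_encode (k, m) \<in> code x" for x m by (simp add: code_def)
    then have "\<beta> (x k) = \<beta> (y k)" using eq by blast
    then show "x k = y k" using \<beta> by (simp add: inj_eq)
  qed
  define d where "d = case_globe_pt (\<lambda>k::nat. 0::real) (\<lambda>k. 1)
    (\<lambda>z t k. if k = 0 then 2 else if k = 1 then t else z (k - 2))"
  have "inj d"
  proof (rule injI)
    fix x y assume "d x = d y"
    then have eq: "d x k = d y k" for k by simp
    have "z = z'" if "d (Mid z t) = d (Mid z' t')" for z t z' t'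
      using fun_cong[OF that, of "_ + 2"] by (auto simp: d_def fun_eq_iff)
    with eq[of 0] eq[of 1] \<open>d x = d y\<close> show "x = y"
      by (cases x; cases y) (auto simp: d_def)
  qed
  then have "inj (\<lambda>p. \<gamma> (code (d p)))"
    using \<gamma> code by (simp add: inj_def)
  then show ?thesis by blast
qed

lemma is_pushout_univ:
  fixes E :: "'t mdspace"
  assumes "is_pushout TYPE('t) T A B X Y i u j v" "mdspace T E" "md_map X E g" "md_map B E h"
    "\<forall>a\<in>pts A. g (u a) = h (i a)"
  shows "\<exists>k. md_map Y E k \<and> (\<forall>a\<in>pts X. k (j a) = g a) \<and> (\<forall>b\<in>pts B. k (v b) = h b) \<and>
    (\<forall>k'. md_map Y E k' \<and> (\<forall>a\<in>pts X. k' (j a) = g a) \<and> (\<forall>b\<in>pts B. k' (v b) = h b)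
      \<longrightarrow> (\<forall>y\<in>pts Y. k' y = k y))"
  by (rule assms(1)[unfolded is_pushout_def, THEN conjunct2, THEN conjunct2, THEN conjunct2,
        THEN conjunct2, THEN conjunct2, THEN conjunct2, THEN spec, THEN spec, THEN spec, THEN mp])
    (intro conjI assms(2-))

lemma is_chain_colimit_univ:
  fixes E :: "'t mdspace"
  assumes "is_chain_colimit TYPE('t) T I X t Y c"
    "mdspace T E \<and> (\<forall>i\<in>I. md_map (X i) E (g i)) \<and>
      (\<forall>i\<in>I. \<forall>j\<in>I. i \<le> j \<longrightarrow> (\<forall>a\<in>pts (X i). g j (t i j a) = g i a))"
  shows "\<exists>k. md_map Y E k \<and> (\<forall>i\<in>I. \<forall>a\<in>pts (X i). k (c i a) = g i a) \<and>
    (\<forall>k'. md_map Y E k' \<and> (\<forall>i\<in>I. \<forall>a\<in>pts (X i). k' (c i a) = g i a)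
      \<longrightarrow> (\<forall>y\<in>pts Y. k' y = k y))"
  by (rule assms(1)[unfolded is_chain_colimit_def, THEN conjunct2, THEN conjunct2, THEN conjunct2,
        THEN spec, THEN spec, THEN mp])
    (rule assms(2))

text \<open>The witnesses hidden in \<open>cellular\<close>, namely the dimension, attaching map and
  characteristic map of the cell between consecutive stages, become functions of these stages, so
  that several statements can refer to the same cells.\<close>

locale cell_tower =
  fixes T :: top_cat and \<mu> :: "'i::wellorder" and X :: "'i \<Rightarrow> 'a mdspace" and t :: "'i \<Rightarrow> 'i \<Rightarrow> 'a \<Rightarrow> 'a"
    and dim :: "'i \<Rightarrow> 'i \<Rightarrow> nat" and att :: "'i \<Rightarrow> 'i \<Rightarrow> (nat \<Rightarrow> real) globe_pt \<Rightarrow> 'a"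
    and chr :: "'i \<Rightarrow> 'i \<Rightarrow> (nat \<Rightarrow> real) globe_pt \<Rightarrow> 'a"
  assumes tower: "is_tower T \<mu> X t"
    and least: "i \<le> \<mu> \<Longrightarrow> is_least i \<Longrightarrow> \<exists>S. X i = discrete_md S"
    and pushout: "j \<le> \<mu> \<Longrightarrow> is_succ i j \<Longrightarrow> is_pushout TYPE('a \<times> 'i \<times> real) T
      (globe (disc_bd (dim i j))) (globe (disc (dim i j))) (X i) (X j) (\<lambda>x. x) (att i j) (t i j) (chr i j)"
    and chain: "l \<le> \<mu> \<Longrightarrow> is_limit l \<Longrightarrow>
      is_chain_colimit TYPE('a \<times> 'i \<times> real) T {..<l} X t (X l) (\<lambda>i. t i l)"

lemma cellular_cell_tower:
  fixes Q :: "'a mdspace" and I :: "'i::wellorder itself"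
  assumes "cellular I T Q"
  obtains \<mu> :: 'i and X t dim att chr where "cell_tower T \<mu> X t dim att chr" "X \<mu> = Q"
proof -
  obtain \<mu> :: 'i and X t where 1: "is_tower T \<mu> X t" "X \<mu> = Q"
    "\<forall>i\<le>\<mu>. is_least i \<longrightarrow> (\<exists>S. X i = discrete_md S)"
    "\<forall>l\<le>\<mu>. is_limit l \<longrightarrow> is_chain_colimit TYPE('a \<times> 'i \<times> real) T {..<l} X t (X l) (\<lambda>i. t i l)"
    and 2: "\<forall>i j. j \<le> \<mu> \<and> is_succ i j \<longrightarrow> (\<exists>n u v. is_pushout TYPE('a \<times> 'i \<times> real) T
              (globe (disc_bd n)) (globe (disc n)) (X i) (X j) (\<lambda>x. x) u (t i j) v)"
    using assms unfolding cellular_def by blast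
  from 2 obtain dim att chr where "\<And>i j. j \<le> \<mu> \<Longrightarrow> is_succ i j \<Longrightarrow> is_pushout TYPE('a \<times> 'i \<times> real) T
      (globe (disc_bd (dim i j))) (globe (disc (dim i j))) (X i) (X j) (\<lambda>x. x) (att i j) (t i j) (chr i j)"
    by metis
  with 1 have "cell_tower T \<mu> X t dim att chr" by unfold_locales auto
  with 1 that show thesis by blast
qed

context cell_tower
begin

lemma mdX: "i \<le> \<mu> \<Longrightarrow> mdspace T (X i)"
  using tower by (simp add: is_tower_def)

lemma t_map: "i \<le> j \<Longrightarrow> j \<le> \<mu> \<Longrightarrow> md_map (X i) (X j) (t i j)"
  using tower by (simp add: is_tower_def)

lemma t_id: "i \<le> \<mu> \<Longrightarrow> a \<in> pts (X i) \<Longrightarrow> t i i a = a"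
  using tower by (simp add: is_tower_def)

lemma t_comp: "i \<le> j \<Longrightarrow> j \<le> k \<Longrightarrow> k \<le> \<mu> \<Longrightarrow> a \<in> pts (X i) \<Longrightarrow> t j k (t i j a) = t i k a"
  using tower unfolding is_tower_def by blast

lemma att_map: "j \<le> \<mu> \<Longrightarrow> is_succ i j \<Longrightarrow> md_map (globe (disc_bd (dim i j))) (X i) (att i j)"
  using pushout[of j i] by (simp add: is_pushout_def)

lemma chr_map: "j \<le> \<mu> \<Longrightarrow> is_succ i j \<Longrightarrow> md_map (globe (disc (dim i j))) (X j) (chr i j)"
  using pushout[of j i] by (simp add: is_pushout_def)

lemma chr_boundary: "j \<le> \<mu> \<Longrightarrow> is_succ i j \<Longrightarrow> a \<in> pts (globe (disc_bd (dim i j))) \<Longrightarrow>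
    t i j (att i j a) = chr i j a"
  using pushout[of j i] by (simp add: is_pushout_def)

section \<open>Universal properties of the stages against arbitrary test objects\<close>

lemma carried_map:
  assumes "mdspace T A" "mdspace T E" "S \<subseteq> pts E" "inj_on e S" "md_map A E g" "g ` pts A \<subseteq> S"
  shows "md_map A (carried_by E S e) (\<lambda>x. e (g x))"
proof (rule md_map_carried_by[OF assms(2-4) mdspaceD(9)[OF assms(1)] assms(5,6)])
  show "states A \<subseteq> pts A" using mdspaceD(2)[OF assms(1)] by blast
qed (rule mdspaceD(8)[OF assms(1)])

text \<open>\<open>E\<close> may be too large for the test type, but a mediating map only has to see
  the union \<open>S\<close> of the two images. The pushout is tested against
  \<open>carried_by E S e\<close>, and the result is moved back by
  \<open>inv_into S e\<close>.\<close>

lemma glue: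
  fixes E :: "'e mdspace"
  assumes j: "j \<le> \<mu>" "is_succ i j" and E: "mdspace T E"
    and g: "md_map (X i) E g" and h: "md_map (globe (disc (dim i j))) E h"
    and gh: "\<And>a. a \<in> pts (globe (disc_bd (dim i j))) \<Longrightarrow> g (att i j a) = h a"
  shows "\<exists>k. md_map (X j) E k \<and> (\<forall>a\<in>pts (X i). k (t i j a) = g a) \<and>
    (\<forall>b\<in>pts (globe (disc (dim i j))). k (chr i j b) = h b)"
proof -
  define D where "D = globe (disc (dim i j))"
  define S where "S = g ` pts (X i) \<union> h ` pts D"
  have i: "i \<le> \<mu>" using j by (auto simp: is_succ_def)
  have S: "S \<subseteq> pts E" using md_mapD(4)[OF g] md_mapD(4)[OF h] by (auto simp: S_def D_def)
  obtain c :: "(nat \<Rightarrow> real) globe_pt \<Rightarrow> real" where c: "inj c" using inj_globe_pt_real by blast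
  \<comment> \<open>The stage is the tag: a point coming from \<open>X i\<close> is coded by a
    preimage and \<open>i\<close>, any other point by the real code of a preimage in the globe and
    \<open>j\<close>.\<close>
  define e where "e = (\<lambda>x. if x \<in> g ` pts (X i) then (inv_into (pts (X i)) g x, i, 0)
    else (undefined, j, c (inv_into (pts D) h x)))"
  have inj: "inj_on e S"
  proof (rule inj_onI)
    fix x y assume xy: "x \<in> S" "y \<in> S" "e x = e y"
    have "i \<noteq> j" using j by (auto simp: is_succ_def)
    with xy(3) consider "x \<in> g ` pts (X i)" "y \<in> g ` pts (X i)" "inv_into (pts (X i)) g x = inv_into (pts (X i)) g y"
      | "x \<in> h ` pts D" "y \<in> h ` pts D" "c (inv_into (pts D) h x) = c (inv_into (pts D) h y)"
      using xy(1,2) by (auto simp: e_def S_def split: if_splits)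
    then show "x = y"
      by cases (use c in \<open>auto simp: inj_eq dest: inv_into_injective\<close>)
  qed
  let ?F = "carried_by E S e"
  have F: "mdspace T ?F" using mdspace_carried_by[OF E S inj] .
  have g': "md_map (X i) ?F (\<lambda>x. e (g x))"
    by (rule carried_map[OF mdX[OF i] E S inj g]) (auto simp: S_def)
  have h': "md_map D ?F (\<lambda>x. e (h x))"
    unfolding D_def
  proof (rule md_map_carried_by[OF E S inj delta_generated_globe h])
    show "h ` pts (globe (disc (dim i j))) \<subseteq> S" by (auto simp: S_def D_def)
    show "states (globe (disc (dim i j))) \<subseteq> pts (globe (disc (dim i j)))" by (auto simp: pts_globe)
  qed (rule globe_epath_pts)
  have "\<exists>k. md_map (X j) ?F k \<and> (\<forall>a\<in>pts (X i). k (t i j a) = e (g a)) \<and>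
      (\<forall>b\<in>pts D. k (chr i j b) = e (h b))"
    using is_pushout_univ[OF pushout[OF j] F g' h'[unfolded D_def]] gh unfolding D_def by auto
  then obtain k where k: "md_map (X j) ?F k" "\<And>a. a \<in> pts (X i) \<Longrightarrow> k (t i j a) = e (g a)"
      "\<And>b. b \<in> pts D \<Longrightarrow> k (chr i j b) = e (h b)"
    by blast
  have "md_map (X j) E (\<lambda>x. inv_into S e (k x))"
    by (rule md_map_compose[OF k(1) md_map_from_carried_by[OF E S inj]])
  moreover have "inv_into S e (k (t i j a)) = g a" if "a \<in> pts (X i)" for a
    using that inj by (auto simp: k(2) S_def)
  moreover have "inv_into S e (k (chr i j b)) = h b" if "b \<in> pts D" for b
    using that inj by (auto simp: k(3) S_def)
  ultimately show ?thesis unfolding D_def by blast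
qed

text \<open>For uniqueness, two competing maps must be moved into one common test object. A point of
  their joint image is coded by a preimage, and the last component tells under which map.\<close>

lemma inj_two_copies: "\<exists>e::'e \<Rightarrow> 'a \<times> 'i \<times> real. inj_on e (f ` A \<union> g ` A)"
  for f g :: "'a \<Rightarrow> 'e"
proof -
  define e where "e = (\<lambda>x. if x \<in> f ` A then (inv_into A f x, undefined::'i, 0::real) else (inv_into A g x, undefined, 1))"
  have "inj_on e (f ` A \<union> g ` A)"
    by (rule inj_onI) (auto simp: e_def split: if_splits dest: inv_into_injective)
  then show ?thesis by blast
qed

lemma glue_unique:
  fixes E :: "'e mdspace"
  assumes j: "j \<le> \<mu>" "is_succ i j" and E: "mdspace T E"
    and k: "md_map (X j) E k" "md_map (X j) E k'"
    and eq: "\<And>a. a \<in> pts (X i) \<Longrightarrow> k' (t i j a) = k (t i j a)"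
      "\<And>b. b \<in> pts (globe (disc (dim i j))) \<Longrightarrow> k' (chr i j b) = k (chr i j b)"
    and y: "y \<in> pts (X j)"
  shows "k' y = k y"
proof -
  obtain e :: "'e \<Rightarrow> 'a \<times> 'i \<times> real" where inj: "inj_on e (k ` pts (X j) \<union> k' ` pts (X j))"
    using inj_two_copies by blast
  let ?S = "k ` pts (X j) \<union> k' ` pts (X j)"
  let ?D = "globe (disc (dim i j))"
  have S: "?S \<subseteq> pts E" using md_mapD(4)[OF k(1)] md_mapD(4)[OF k(2)] by auto
  let ?F = "carried_by E ?S e"
  have F: "mdspace T ?F" using mdspace_carried_by[OF E S inj] .
  have K: "md_map (X j) ?F (\<lambda>x. e (k x))" "md_map (X j) ?F (\<lambda>x. e (k' x))"
    by (rule carried_map[OF mdX[OF j(1)] E S inj]; use k in auto)+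
  have ij: "i \<le> j" "i \<le> \<mu>" using j by (auto simp: is_succ_def)
  have g: "md_map (X i) ?F (\<lambda>x. e (k (t i j x)))"
    using md_map_compose[OF t_map[OF ij(1) j(1)] K(1) ] .
  have hmap: "md_map ?D ?F (\<lambda>x. e (k (chr i j x)))"
    using md_map_compose[OF chr_map[OF j] K(1)] .
  have "\<forall>a\<in>pts (globe (disc_bd (dim i j))). e (k (t i j (att i j a))) = e (k (chr i j a))"
    using chr_boundary[OF j] by simp
  then obtain m where m: "\<And>k'. md_map (X j) ?F k' \<Longrightarrow> (\<forall>a\<in>pts (X i). k' (t i j a) = e (k (t i j a))) \<Longrightarrow>
      (\<forall>b\<in>pts ?D. k' (chr i j b) = e (k (chr i j b))) \<Longrightarrow> (\<forall>y\<in>pts (X j). k' y = m y)"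
    using is_pushout_univ[OF pushout[OF j] F g hmap] by metis
  have "e (k y) = m y" "e (k' y) = m y"
    using m[OF K(1)] m[OF K(2)] eq y by auto
  then have "e (k' y) = e (k y)" by simp
  with inj y show ?thesis by (auto dest: inj_onD)
qed

lemma colim:
  fixes E :: "'e mdspace"
  assumes l: "l \<le> \<mu>" "is_limit l" and E: "mdspace T E"
    and g: "\<And>i. i < l \<Longrightarrow> md_map (X i) E (g i)"
    and gt: "\<And>i j a. i \<le> j \<Longrightarrow> j < l \<Longrightarrow> a \<in> pts (X i) \<Longrightarrow> g j (t i j a) = g i a"
  shows "\<exists>k. md_map (X l) E k \<and> (\<forall>i<l. \<forall>a\<in>pts (X i). k (t i l a) = g i a)"
proof -
  define S where "S = (\<Union>i\<in>{..<l}. g i ` pts (X i))"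
  have S: "S \<subseteq> pts E" using md_mapD(4)[OF g] by (auto simp: S_def)
  \<comment> \<open>Each point of the joint image remembers a preimage and the stage where it lives;
    applying \<open>g\<close> at that stage recovers the point, so this pair determines it.\<close>
  define r where "r = (\<lambda>x. SOME p. snd p < l \<and> fst p \<in> pts (X (snd p)) \<and> g (snd p) (fst p) = x)"
  have r: "snd (r x) < l \<and> fst (r x) \<in> pts (X (snd (r x))) \<and> g (snd (r x)) (fst (r x)) = x"
    if "x \<in> S" for x
    unfolding r_def by (rule someI_ex) (use that in \<open>auto simp: S_def\<close>)
  define e where "e = (\<lambda>x. (fst (r x), snd (r x), 0::real))"
  have inj: "inj_on e S"
    by (rule inj_onI) (metis r e_def prod.inject)
  let ?F = "carried_by E S e"
  have F: "mdspace T ?F" using mdspace_carried_by[OF E S inj] .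
  have lt: "i \<le> \<mu>" if "i < l" for i using that l by auto
  have g': "md_map (X i) ?F (\<lambda>x. e (g i x))" if "i < l" for i
    by (rule carried_map[OF mdX[OF lt[OF that]] E S inj g[OF that]]) (use that in \<open>auto simp: S_def\<close>)
  have cocone: "mdspace T ?F \<and> (\<forall>i\<in>{..<l}. md_map (X i) ?F ((\<lambda>i x. e (g i x)) i)) \<and>
    (\<forall>i\<in>{..<l}. \<forall>j\<in>{..<l}. i \<le> j \<longrightarrow> (\<forall>a\<in>pts (X i). (\<lambda>i x. e (g i x)) j (t i j a) = (\<lambda>i x. e (g i x)) i a))"
    using F g' gt by auto
  obtain k where k: "md_map (X l) ?F k" "\<forall>i\<in>{..<l}. \<forall>a\<in>pts (X i). k (t i l a) = e (g i a)"
    using is_chain_colimit_univ[OF chain[OF l] cocone] by metis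
  have "md_map (X l) E (\<lambda>x. inv_into S e (k x))"
    by (rule md_map_compose[OF k(1) md_map_from_carried_by[OF E S inj]])
  moreover have "inv_into S e (k (t i l a)) = g i a" if "i < l" "a \<in> pts (X i)" for i a
  proof -
    have "g i a \<in> S" using that by (auto simp: S_def)
    then show ?thesis using k(2) that inj by simp
  qed
  ultimately show ?thesis by blast
qed

lemma colim_unique:
  fixes E :: "'e mdspace"
  assumes l: "l \<le> \<mu>" "is_limit l" and E: "mdspace T E"
    and k: "md_map (X l) E k" "md_map (X l) E k'"
    and eq: "\<And>i a. i < l \<Longrightarrow> a \<in> pts (X i) \<Longrightarrow> k' (t i l a) = k (t i l a)"
    and y: "y \<in> pts (X l)"
  shows "k' y = k y"
proof -
  obtain e :: "'e \<Rightarrow> 'a \<times> 'i \<times> real" where inj: "inj_on e (k ` pts (X l) \<union> k' ` pts (X l))"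
    using inj_two_copies by blast
  let ?S = "k ` pts (X l) \<union> k' ` pts (X l)"
  have S: "?S \<subseteq> pts E" using md_mapD(4)[OF k(1)] md_mapD(4)[OF k(2)] by auto
  let ?F = "carried_by E ?S e"
  have F: "mdspace T ?F" using mdspace_carried_by[OF E S inj] .
  have K: "md_map (X l) ?F (\<lambda>x. e (k x))" "md_map (X l) ?F (\<lambda>x. e (k' x))"
    by (rule carried_map[OF mdX[OF l(1)] E S inj]; use k in auto)+
  have il: "i \<le> l" "i \<le> \<mu>" if "i < l" for i using that l(1) by auto
  have g: "md_map (X i) ?F (\<lambda>x. e (k (t i l x)))" if "i < l" for i
    using md_map_compose[OF t_map[OF il(1)[OF that] l(1)] K(1)] .
  have cocone: "mdspace T ?F \<and> (\<forall>i\<in>{..<l}. md_map (X i) ?F ((\<lambda>i x. e (k (t i l x))) i)) \<and>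
    (\<forall>i\<in>{..<l}. \<forall>j\<in>{..<l}. i \<le> j \<longrightarrow> (\<forall>a\<in>pts (X i).
      (\<lambda>i x. e (k (t i l x))) j (t i j a) = (\<lambda>i x. e (k (t i l x))) i a))"
    using F g t_comp l(1) by auto
  obtain m where m: "\<And>k'. md_map (X l) ?F k' \<Longrightarrow>
      (\<forall>i\<in>{..<l}. \<forall>a\<in>pts (X i). k' (t i l a) = e (k (t i l a))) \<Longrightarrow> (\<forall>y\<in>pts (X l). k' y = m y)"
    using is_chain_colimit_univ[OF chain[OF l] cocone] by metis
  have "e (k y) = m y" "e (k' y) = m y"
    using m[OF K(1)] m[OF K(2)] eq y by auto
  then have "e (k' y) = e (k y)" by simp
  with inj y show ?thesis by (auto dest: inj_onD)
qed

section \<open>Transfinite extension of morphisms along a tower\<close>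

lemma succ_le: "is_succ i j \<Longrightarrow> k < j \<Longrightarrow> k \<le> i"
  for i j k :: "'x::linorder"
  unfolding is_succ_def by (metis leD leI)

lemma succ_unique: "is_succ i j \<Longrightarrow> is_succ i' j \<Longrightarrow> i = i'"
  for i j i' :: "'x::linorder"
  using succ_le[of i j i'] succ_le[of i' j i] by (simp add: is_succ_def)

text \<open>Up to \<open>i0\<close> the map is forced to be a restriction of \<open>g0\<close>;
  after that a filling is glued on at each successor, and the earlier maps form a cocone at each
  limit. \<open>G\<close> records a property of the fillings selected on the way, which the bare
  existence of \<open>f\<close> would lose.\<close>

lemma tower_extension:
  fixes E :: "'e mdspace"
  assumes E: "mdspace T E" and i0: "i0 \<le> \<mu>" and g0: "md_map (X i0) E g0"
    and fill: "\<And>i j g. is_succ i j \<Longrightarrow> j \<le> \<mu> \<Longrightarrow> i0 \<le> i \<Longrightarrow> md_map (X i) E g \<Longrightarrow>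
      \<exists>h. md_map (globe (disc (dim i j))) E h \<and>
        (\<forall>a\<in>pts (globe (disc_bd (dim i j))). g (att i j a) = h a) \<and> G i j h"
  shows "\<exists>f. md_map (X \<mu>) E f \<and> (\<forall>a\<in>pts (X i0). f (t i0 \<mu> a) = g0 a) \<and>
    (\<forall>i j. is_succ i j \<longrightarrow> j \<le> \<mu> \<longrightarrow> i0 \<le> i \<longrightarrow>
      (\<exists>h. G i j h \<and> (\<forall>b\<in>pts (globe (disc (dim i j))). f (t j \<mu> (chr i j b)) = h b)))"
proof -
  define P where "P = (\<lambda>F j f. j \<le> \<mu> \<longrightarrow> md_map (X j) E f \<and>
    (\<forall>i<j. \<forall>a\<in>pts (X i). f (t i j a) = F i a) \<and> (j \<le> i0 \<longrightarrow> (\<forall>a\<in>pts (X j). f a = g0 (t j i0 a))) \<and>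
    (\<forall>i. is_succ i j \<longrightarrow> i0 \<le> i \<longrightarrow>
      (\<exists>h. G i j h \<and> (\<forall>b\<in>pts (globe (disc (dim i j))). f (chr i j b) = h b))))"
  \<comment> \<open>The choice at stage \<open>j\<close> has to extend the choices at all earlier
    stages, hence well-founded dependent choice. \<open>P\<close> evaluates \<open>F\<close> only
    below \<open>j\<close>, and stages beyond \<open>\<mu>\<close> satisfy it vacuously.\<close>
  have "\<exists>F. \<forall>j. P F j (F j)"
  proof (rule dependent_wf_choice)
    show "wf {(x, y::'i). x < y}" by (rule wf)
    show "P f x r = P g x r" if "\<And>z. (z, x) \<in> {(x, y). x < y} \<Longrightarrow> f z = g z" for f g x r
      using that by (simp add: P_def)
    fix j F assume "\<And>i. (i, j) \<in> {(x, y). x < y} \<Longrightarrow> P F i (F i)"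
    then have IH: "P F i (F i)" if "i < j" for i using that by simp
    show "\<exists>f. P F j f"
    proof (cases "j \<le> \<mu>")
      case False then show ?thesis by (simp add: P_def)
    next
      case j: True
      have IHD: "md_map (X i) E (F i)" "k < i \<Longrightarrow> a \<in> pts (X k) \<Longrightarrow> F i (t k i a) = F k a"
        "i \<le> i0 \<Longrightarrow> a \<in> pts (X i) \<Longrightarrow> F i a = g0 (t i i0 a)" if "i < j" for i k a
        using IH[OF that] that j by (auto simp: P_def)
      have compat: "F i (t k i a) = F k a" if "k \<le> i" "i < j" "a \<in> pts (X k)" for i k a
        using IHD(2)[of i k a] that t_id[of k a] j by (cases "k = i") auto
      show ?thesis
      proof (cases "j \<le> i0")
        case True
        have "md_map (X j) E (\<lambda>a. g0 (t j i0 a))"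
          using md_map_compose[OF t_map[OF True i0] g0] .
        moreover have "g0 (t j i0 (t i j a)) = F i a" if "i < j" "a \<in> pts (X i)" for i a
          using that True i0 IHD(3)[of i a] t_comp[of i j i0 a] by simp
        moreover have "\<not> i0 \<le> i" if "is_succ i j" for i
          using that True by (auto simp: is_succ_def)
        ultimately show ?thesis unfolding P_def by blast
      next
        case False
        then have ij0: "i0 < j" by simp
        show ?thesis
        proof (cases "\<exists>i. is_succ i j")
          case True
          then obtain i where i: "is_succ i j" by blast
          have ij: "i < j" "i0 \<le> i" using i ij0 succ_le by (auto simp: is_succ_def)
          obtain h where h: "md_map (globe (disc (dim i j))) E h"
            "\<forall>a\<in>pts (globe (disc_bd (dim i j))). F i (att i j a) = h a" "G i j h"
            using fill[OF i j ij(2) IHD(1)[OF ij(1)]] by blast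
          obtain k where k: "md_map (X j) E k" "\<forall>a\<in>pts (X i). k (t i j a) = F i a"
            "\<forall>b\<in>pts (globe (disc (dim i j))). k (chr i j b) = h b"
            using glue[OF j i E IHD(1)[OF ij(1)] h(1)] h(2) by blast
          \<comment> \<open>Gluing controls \<open>k\<close> on stage \<open>i\<close> only; lower
            stages follow because their maps to \<open>X j\<close> factor through
            \<open>X i\<close>.\<close>
          have "k (t i' j a) = F i' a" if "i' < j" "a \<in> pts (X i')" for i' a
          proof -
            have i': "i' \<le> i" using succ_le[OF i that(1)] .
            have "t i' i a \<in> pts (X i)" using md_mapD(4)[OF t_map[OF i'] that(2)] ij j by auto
            then have "k (t i j (t i' i a)) = F i (t i' i a)" using k(2) by blast
            then show ?thesis
              using t_comp[OF i' less_imp_le[OF ij(1)] j that(2)] compat[OF i' ij(1) that(2)] by simp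
          qed
          moreover have "\<exists>h. G i' j h \<and> (\<forall>b\<in>pts (globe (disc (dim i' j))). k (chr i' j b) = h b)"
            if "is_succ i' j" for i'
            using succ_unique[OF i that] h(3) k(3) by blast
          ultimately show ?thesis using k(1) False unfolding P_def by blast
        next
          case nsucc: False
          then have l: "is_limit j" using ij0 by (auto simp: is_limit_def is_least_def not_le)
          obtain k where "md_map (X j) E k" "\<forall>i<j. \<forall>a\<in>pts (X i). k (t i j a) = F i a"
            using colim[OF j l E IHD(1) compat] by blast
          then show ?thesis using nsucc False unfolding P_def by blast
        qed
      qed
    qed
  qed
  then obtain F where F: "\<And>j. P F j (F j)" by blast
  have FD: "md_map (X i) E (F i)" "k < i \<Longrightarrow> a \<in> pts (X k) \<Longrightarrow> F i (t k i a) = F k a"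
    "i \<le> i0 \<Longrightarrow> a \<in> pts (X i) \<Longrightarrow> F i a = g0 (t i i0 a)"
    "is_succ k i \<Longrightarrow> i0 \<le> k \<Longrightarrow> \<exists>h. G k i h \<and> (\<forall>b\<in>pts (globe (disc (dim k i))). F i (chr k i b) = h b)"
    if "i \<le> \<mu>" for i k a
    using F[of i] that by (auto simp: P_def)
  have F\<mu>: "F \<mu> (t k \<mu> a) = F k a" if "k \<le> \<mu>" "a \<in> pts (X k)" for k a
    using FD(2)[of \<mu> k a] that t_id[of k a] by (cases "k = \<mu>") auto
  show ?thesis
  proof (intro exI[of _ "F \<mu>"] conjI ballI allI impI)
    show "md_map (X \<mu>) E (F \<mu>)" using FD(1) by simp
    show "F \<mu> (t i0 \<mu> a) = g0 a" if "a \<in> pts (X i0)" for a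
      using F\<mu>[OF i0 that] FD(3)[OF i0 order_refl that] t_id[OF i0 that] by simp
    fix i j assume ij: "is_succ i j" "j \<le> \<mu>" "i0 \<le> i"
    then obtain h where h: "G i j h" "\<forall>b\<in>pts (globe (disc (dim i j))). F j (chr i j b) = h b"
      using FD(4)[of j i] by blast
    have "F \<mu> (t j \<mu> (chr i j b)) = h b" if "b \<in> pts (globe (disc (dim i j)))" for b
      using F\<mu>[OF ij(2) md_mapD(4)[OF chr_map[OF ij(2,1)] that]] h(2) that by simp
    with h(1) show "\<exists>h. G i j h \<and> (\<forall>b\<in>pts (globe (disc (dim i j))). F \<mu> (t j \<mu> (chr i j b)) = h b)"
      by blast
  qed
qed

text \<open>Shrinking the set of execution paths of the colimit to \<open>R\<close> gives another test object, and
  the identity factors through it.\<close>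

lemma epaths_subset:
  assumes R: "R \<subseteq> epaths (X \<mu>)" "\<And>x \<phi>. x \<in> R \<Longrightarrow> \<phi> \<in> Rep_plus \<Longrightarrow> compose {0..1} x \<phi> \<in> R"
      "\<And>x y. x \<in> R \<Longrightarrow> y \<in> R \<Longrightarrow> x 1 = y 0 \<Longrightarrow> norm_comp x y \<in> R"
    and cells: "\<And>i j z. is_succ i j \<Longrightarrow> j \<le> \<mu> \<Longrightarrow> z \<in> disc_set (dim i j) \<Longrightarrow> z \<notin> sphere_set (dim i j) \<Longrightarrow>
      (\<lambda>s\<in>{0..1}. t j \<mu> (chr i j (glob_class (z, s)))) \<in> R"
  shows "epaths (X \<mu>) \<subseteq> R"
proof -
  let ?Q = "X \<mu>"
  define E where "E = ?Q\<lparr>epaths := R\<rparr>"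
  have Q: "mdspace T ?Q" using mdX by simp
  have E: "mdspace T E" using Q R unfolding mdspace_def E_def by auto
  have EQ: "md_map A ?Q g" if "md_map A E g" for A :: "'x mdspace" and g
    using that R(1) by (auto simp: md_map_def E_def)
  have QE: "md_map A E g" if "md_map A ?Q g" "\<And>x. x \<in> epaths A \<Longrightarrow> compose {0..1} g x \<in> R"
    for A :: "'x mdspace" and g
    using that by (auto simp: md_map_def E_def)
  have ER: "compose {0..1} g x \<in> R" if "md_map A E g" "x \<in> epaths A" for A :: "'x mdspace" and g x
    using that by (auto simp: md_map_def E_def)
  have paths: "compose {0..1} g x = compose {0..1} g' x" if "i \<le> \<mu>" "x \<in> epaths (X i)"
    "\<And>a. a \<in> pts (X i) \<Longrightarrow> g a = g' a" for i x and g g' :: "'a \<Rightarrow> 'a"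
    using mdspaceD(8)[OF mdX[OF that(1)] that(2)] that(3) by (auto simp: compose_def)
  \<comment> \<open>\<open>E\<close> and \<open>X \<mu>\<close> share space and states, so the only
    question is where execution paths go. At stage \<open>\<mu>\<close> this is the claim, as
    \<open>t \<mu> \<mu>\<close> is the identity on points.\<close>
  have "j \<le> \<mu> \<Longrightarrow> md_map (X j) E (t j \<mu>)" for j
  proof (induction j rule: less_induct)
    case (less j)
    have tj: "md_map (X j) ?Q (t j \<mu>)" using t_map[OF less.prems order_refl] .
    consider "is_least j" | i where "is_succ i j" | "is_limit j" unfolding is_limit_def by blast
    then show ?case
    proof cases
      case 1
      then have "epaths (X j) = {}" using least[OF less.prems] by (auto simp: discrete_md_def)
      then show ?thesis by (intro QE[OF tj]) simp
    next
      case (2 i)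
      then have ij: "i < j" "i \<le> j" "i \<le> \<mu>" using less.prems by (auto simp: is_succ_def)
      let ?D = "globe (disc (dim i j))"
      have IH: "md_map (X i) E (t i \<mu>)" using less.IH ij by simp
      have h: "md_map ?D E (\<lambda>b. t j \<mu> (chr i j b))"
      proof (rule globe_map_pathI)
        have "continuous_map (und ?D) (und ?Q) (\<lambda>b. t j \<mu> (chr i j b))"
          using continuous_map_compose[OF md_mapD(1)[OF chr_map[OF less.prems 2]] md_mapD(1)[OF tj]]
          by (simp add: o_def)
        then show "continuous_map (und ?D) (und E) (\<lambda>b. t j \<mu> (chr i j b))"
          by (simp add: E_def)
        have "t j \<mu> (chr i j b) \<in> states E" if "b \<in> {Src, Tgt}" for b
          using md_mapD(2)[OF tj md_mapD(2)[OF chr_map[OF less.prems 2], of b]] that by (simp add: E_def)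
        then show "t j \<mu> (chr i j Src) \<in> states E" "t j \<mu> (chr i j Tgt) \<in> states E" by simp_all
        fix z \<phi> assume "z \<in> topspace (disc (dim i j))" and \<phi>: "\<phi> \<in> Rep_plus"
        then have z: "z \<in> disc_set (dim i j)" by simp
        have "(\<lambda>s\<in>{0..1}. t j \<mu> (chr i j (glob_class (z, \<phi> s)))) \<in> R"
        proof (cases "z \<in> sphere_set (dim i j)")
          case False
          from R(2)[OF cells[OF 2 less.prems z False] \<phi>]
          have "compose {0..1} (\<lambda>s\<in>{0..1}. t j \<mu> (chr i j (glob_class (z, s)))) \<phi> \<in> R" .
          moreover have "compose {0..1} (\<lambda>s\<in>{0..1}. t j \<mu> (chr i j (glob_class (z, s)))) \<phi> =
              (\<lambda>s\<in>{0..1}. t j \<mu> (chr i j (glob_class (z, \<phi> s))))"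
            using Rep_plus_in[OF \<phi>] by (auto simp: compose_def)
          ultimately show ?thesis by simp
        next
          \<comment> \<open>Through the attaching map, a boundary path comes from an execution path
            of the earlier stage, so the induction hypothesis takes the place of
            \<open>cells\<close>.\<close>
          case True
          have "(\<lambda>s\<in>{0..1}. att i j (glob_class (z, \<phi> s))) \<in> epaths (X i)"
            using globe_map_pathD[OF att_map[OF less.prems 2] _ \<phi>] True by simp
          from ER[OF IH this]
          have "compose {0..1} (t i \<mu>) (\<lambda>s\<in>{0..1}. att i j (glob_class (z, \<phi> s))) \<in> R" .
          moreover have "t i \<mu> (att i j b) = t j \<mu> (chr i j b)"
            if b: "b \<in> pts (globe (disc_bd (dim i j)))" for b
            using t_comp[OF ij(2) less.prems order_refl md_mapD(4)[OF att_map[OF less.prems 2] b]]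
              chr_boundary[OF less.prems 2 b] by simp
          then have "compose {0..1} (t i \<mu>) (\<lambda>s\<in>{0..1}. att i j (glob_class (z, \<phi> s))) =
             (\<lambda>s\<in>{0..1}. t j \<mu> (chr i j (glob_class (z, \<phi> s))))"
            using Rep_plus_in[OF \<phi>] True
            by (auto simp: compose_def glob_class_in_pts fun_eq_iff)
          ultimately show ?thesis by simp
        qed
        then show "(\<lambda>s\<in>{0..1}. t j \<mu> (chr i j (glob_class (z, \<phi> s)))) \<in> epaths E"
          by (simp add: E_def)
      qed
      have "t i \<mu> (att i j b) = t j \<mu> (chr i j b)" if b: "b \<in> pts (globe (disc_bd (dim i j)))" for b
        using t_comp[OF ij(2) less.prems order_refl md_mapD(4)[OF att_map[OF less.prems 2] b]]
          chr_boundary[OF less.prems 2 b] by simp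
      from glue[OF less.prems 2 E IH h this] obtain k where k: "md_map (X j) E k"
        "\<forall>a\<in>pts (X i). k (t i j a) = t i \<mu> a" "\<forall>b\<in>pts ?D. k (chr i j b) = t j \<mu> (chr i j b)"
        by blast
      \<comment> \<open>\<open>k\<close> is also a morphism into \<open>X \<mu>\<close>, and it
        agrees with \<open>t j \<mu>\<close> on both pieces of the pushout. By uniqueness the two
        coincide, and \<open>t j \<mu>\<close> inherits from \<open>k\<close> that execution paths
        land in \<open>R\<close>.\<close>
      have "t j \<mu> y = k y" if "y \<in> pts (X j)" for y
      proof (rule glue_unique[OF less.prems 2 Q EQ[OF k(1)] tj _ _ that])
        show "t j \<mu> (t i j a) = k (t i j a)" if "a \<in> pts (X i)" for a
          using k(2) that t_comp[OF ij(2) less.prems order_refl that] by simp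
      qed (use k(3) in auto)
      then show ?thesis
        using QE[OF tj] paths[OF less.prems] ER[OF k(1)] by metis
    next
      case 3
      have lt: "i \<le> j" "i \<le> \<mu>" if "i < j" for i using that less.prems by auto
      have "\<exists>k. md_map (X j) E k \<and> (\<forall>i<j. \<forall>a\<in>pts (X i). k (t i j a) = t i \<mu> a)"
        by (rule colim[OF less.prems 3 E]) (use less.IH lt t_comp in auto)
      then obtain k where k: "md_map (X j) E k" "\<forall>i<j. \<forall>a\<in>pts (X i). k (t i j a) = t i \<mu> a" by blast
      have "t j \<mu> y = k y" if "y \<in> pts (X j)" for y
      proof (rule colim_unique[OF less.prems 3 Q EQ[OF k(1)] tj _ that])
        show "t j \<mu> (t i j a) = k (t i j a)" if "i < j" "a \<in> pts (X i)" for i a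
          using k(2) that t_comp[OF lt(1)[OF that(1)] less.prems order_refl that(2)] by simp
      qed
      then show ?thesis
        using QE[OF tj] paths[OF less.prems] ER[OF k(1)] by metis
    qed
  qed
  then have "md_map ?Q E (t \<mu> \<mu>)" by simp
  show ?thesis
  proof
    fix x assume x: "x \<in> epaths ?Q"
    have "x \<in> extensional {0..1}" using mdspaceD(3)[OF Q x] by (simp add: paths_in_def)
    then have "compose {0..1} (t \<mu> \<mu>) x = x"
      using t_id[OF order_refl mdspaceD(8)[OF Q x]] by (auto simp: compose_def extensional_def fun_eq_iff)
    with ER[OF \<open>md_map ?Q E (t \<mu> \<mu>)\<close> x] show "x \<in> R" by simp
  qed
qed

end

section \<open>Real functions on cellular objects\<close>

lemma Rep_plusI:
  assumes "continuous_on {0..1} \<phi>" "mono_on {0..1} \<phi>" "\<phi> 0 = 0" "\<phi> 1 = 1"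
  shows "\<phi> \<in> Rep_plus"
proof -
  have "\<phi> ` {0..1} = {0..1}"
  proof (intro equalityI subsetI)
    fix y assume "y \<in> \<phi> ` {0..1}"
    then obtain t where t: "t \<in> {0..1}" "y = \<phi> t" by blast
    then show "y \<in> {0..1}"
      using mono_onD[OF assms(2), of 0 t] mono_onD[OF assms(2), of t 1] assms(3,4) by simp
  next
    fix y :: real assume "y \<in> {0..1}"
    then obtain t where "0 \<le> t" "t \<le> 1" "\<phi> t = y"
      using IVT'[of \<phi> 0 y 1] assms by auto
    then show "y \<in> \<phi> ` {0..1}" by force
  qed
  with assms show ?thesis by (simp add: Rep_plus_def)
qed

lemma Rep_plus_mono: "\<phi> \<in> Rep_plus \<Longrightarrow> 0 \<le> s \<Longrightarrow> s \<le> t \<Longrightarrow> t \<le> 1 \<Longrightarrow> \<phi> s \<le> \<phi> t"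
  by (auto simp: Rep_plus_def mono_on_def)

lemma Rep_plus_subset_nondecr: "\<phi> \<in> Rep_plus \<Longrightarrow> \<phi> \<in> nondecr"
  by (auto simp: Rep_plus_def nondecr_def)

lemma Rep_plus_comp:
  assumes "\<phi> \<in> Rep_plus" "\<psi> \<in> Rep_plus"
  shows "(\<lambda>t. \<phi> (\<psi> t)) \<in> Rep_plus"
proof (rule Rep_plusI)
  show "continuous_on {0..1} (\<lambda>t. \<phi> (\<psi> t))"
    by (rule continuous_on_compose2[of "{0..1}" \<phi>]) (use assms in \<open>auto simp: Rep_plus_def\<close>)
  show "mono_on {0..1} (\<lambda>t. \<phi> (\<psi> t))"
    using Rep_plus_in[OF assms(2)] Rep_plus_mono[OF assms(1)] Rep_plus_mono[OF assms(2)]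
    by (auto simp: mono_on_def)
qed (simp_all add: Rep_plus_ends assms)

text \<open>Since \<open>\<phi>\<close> ends at 1 and \<open>\<psi>\<close> starts at 0,
  \<open>\<theta>\<close> fixes time 1/2 and reparametrises each half of the concatenation by
  itself.\<close>

lemma Rep_plus_juxtapose:
  assumes \<phi>: "\<phi> \<in> Rep_plus" and \<psi>: "\<psi> \<in> Rep_plus"
  defines "\<theta> \<equiv> (\<lambda>t. if t \<le> 1/2 then \<phi> (2 * t) / 2 else (1 + \<psi> (2 * t - 1)) / 2)"
  shows "\<theta> \<in> Rep_plus"
    and "c 1 = d 0 \<Longrightarrow> norm_comp (compose {0..1} c \<phi>) (compose {0..1} d \<psi>) = compose {0..1} (norm_comp c d) \<theta>"
proof -
  have "continuous_on ({0..1/2} \<union> {1/2..1}) \<theta>"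
    unfolding \<theta>_def
  proof (rule continuous_on_cases)
    show "continuous_on {0..1/2} (\<lambda>t. \<phi> (2 * t) / 2)"
    proof (intro continuous_on_divide continuous_on_const)
      show "continuous_on {0..1/2} (\<lambda>t. \<phi> (2 * t))"
        by (rule continuous_on_compose2[of "{0..1}" \<phi>])
          (use \<phi> in \<open>auto simp: Rep_plus_def intro!: continuous_intros\<close>)
    qed simp
    show "continuous_on {1/2..1} (\<lambda>t. (1 + \<psi> (2 * t - 1)) / 2)"
    proof (intro continuous_on_divide continuous_on_add continuous_on_const)
      show "continuous_on {1/2..1} (\<lambda>t. \<psi> (2 * t - 1))"
        by (rule continuous_on_compose2[of "{0..1}" \<psi>])
          (use \<psi> in \<open>auto simp: Rep_plus_def intro!: continuous_intros\<close>)
    qed simp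
    show "\<forall>t. t \<in> {0..1/2} \<and> \<not> t \<le> 1/2 \<or> t \<in> {1/2..1} \<and> t \<le> 1/2 \<longrightarrow> \<phi> (2 * t) / 2 = (1 + \<psi> (2 * t - 1)) / 2"
    proof (intro allI impI)
      fix t :: real assume "t \<in> {0..1/2} \<and> \<not> t \<le> 1/2 \<or> t \<in> {1/2..1} \<and> t \<le> 1/2"
      then have "2 * t = 1" by auto
      then show "\<phi> (2 * t) / 2 = (1 + \<psi> (2 * t - 1)) / 2"
        by (simp add: Rep_plus_ends[OF \<phi>] Rep_plus_ends[OF \<psi>])
    qed
  qed auto
  moreover have "{0..1/2} \<union> {1/2..1} = {0..1::real}" by auto
  ultimately have "continuous_on {0..1} \<theta>" by simp
  moreover have "mono_on {0..1} \<theta>"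
  proof (rule mono_onI)
    fix s t :: real assume st: "s \<in> {0..1}" "t \<in> {0..1}" "s \<le> t"
    consider "t \<le> 1/2" | "s \<le> 1/2" "1/2 < t" | "1/2 < s" by linarith
    then show "\<theta> s \<le> \<theta> t"
    proof cases
      case 1 then show ?thesis using st Rep_plus_mono[OF \<phi>, of "2 * s" "2 * t"] by (simp add: \<theta>_def)
    next
      case 2 then show ?thesis
        using st Rep_plus_in[OF \<phi>, of "2 * s"] Rep_plus_in[OF \<psi>, of "2 * t - 1"] by (simp add: \<theta>_def)
    next
      case 3 then show ?thesis
        using st Rep_plus_mono[OF \<psi>, of "2 * s - 1" "2 * t - 1"] by (simp add: \<theta>_def)
    qed
  qed
  moreover have "\<theta> 0 = 0" "\<theta> 1 = 1"
    using Rep_plus_ends[OF \<phi>] Rep_plus_ends[OF \<psi>] by (simp_all add: \<theta>_def)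
  ultimately show \<theta>: "\<theta> \<in> Rep_plus" by (rule Rep_plusI)
  assume cd: "c 1 = d 0"
  show "norm_comp (compose {0..1} c \<phi>) (compose {0..1} d \<psi>) = compose {0..1} (norm_comp c d) \<theta>"
  proof
    fix t :: real
    consider "t \<notin> {0..1}" | "0 \<le> t" "t \<le> 1/2" | "1/2 < t" "t \<le> 1" by force
    then show "norm_comp (compose {0..1} c \<phi>) (compose {0..1} d \<psi>) t = compose {0..1} (norm_comp c d) \<theta> t"
    proof cases
      case 1 then show ?thesis unfolding norm_comp_def compose_def restrict_def by presburger
    next
      case 2
      then have "0 \<le> \<phi> (2 * t)" "\<phi> (2 * t) \<le> 1" using Rep_plus_in[OF \<phi>, of "2 * t"] by auto
      with 2 show ?thesis by (simp add: norm_comp_def compose_def \<theta>_def)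
    next
      case 3
      then have p: "0 \<le> \<psi> (2 * t - 1)" "\<psi> (2 * t - 1) \<le> 1" using Rep_plus_in[OF \<psi>, of "2 * t - 1"] by auto
      show ?thesis
      proof (cases "\<psi> (2 * t - 1) = 0")
        \<comment> \<open>Here \<open>\<theta> t = 1/2\<close>, where \<open>norm_comp\<close> uses
          its left branch: the value is \<open>c 1\<close>, which equals \<open>d 0\<close>.\<close>
        case True
        with 3 cd show ?thesis by (simp add: norm_comp_def compose_def \<theta>_def)
      next
        case False
        with p have "0 < \<psi> (2 * t - 1)" by simp
        with 3 p have "2 * \<theta> t - 1 = \<psi> (2 * t - 1)" "\<not> \<theta> t \<le> 1/2" "\<theta> t \<le> 1" "0 \<le> \<theta> t"
          by (simp_all add: \<theta>_def field_simps)
        with 3 p show ?thesis by (simp add: norm_comp_def compose_def)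
      qed
    qed
  qed
qed

text \<open>Every point is a state and every path is an execution path, so a morphism into this
  object is just a continuous function to the unit interval. The colimit properties of a tower
  thereby produce real functions.\<close>

definition interval_md :: "real mdspace" where
  "interval_md = \<lparr>und = top_of_set {0..1}, states = {0..1}, epaths = paths_in (top_of_set {0..1})\<rparr>"

lemma mdspace_interval: "mdspace T interval_md"
proof -
  have "delta_Hausdorff (top_of_set {0..1::real})"
    unfolding delta_Hausdorff_def
  proof (intro allI impI)
    fix g assume "pathin (top_of_set {0..1::real}) g"
    then have g: "continuous_on {0..1} g" "g ` {0..1} \<subseteq> {0..1}" by (auto simp: pathin_def)
    then have "closed (g ` {0..1})" by (intro compact_imp_closed compact_continuous_image) auto
    with g(2) show "closedin (top_of_set {0..1}) (g ` {0..1})" by (auto simp: closedin_closed)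
  qed
  then have "in_Top T (top_of_set {0..1::real})"
    using delta_generated_unit_interval by (cases T) auto
  moreover have "x t \<in> {0..1}" if "x \<in> paths_in (top_of_set {0..1::real})" "t \<in> {0..1}" for x t
    using that by (auto simp: paths_in_def pathin_def)
  ultimately show ?thesis
    using compose_in_paths[OF _ Rep_plus_subset_nondecr] norm_comp_in_paths
    by (auto simp: mdspace_def interval_md_def)
qed

lemma closed_disc_set: "closed (disc_set n)" and closed_sphere_set: "closed (sphere_set n)"
proof -
  have "closed {x::nat \<Rightarrow> real. \<forall>i\<ge>n. x i = 0}"
    by (intro closed_Collect_all closed_Collect_imp closed_Collect_eq continuous_intros
        continuous_on_product_coordinates) auto
  moreover have "continuous_on UNIV (\<lambda>x::nat \<Rightarrow> real. \<Sum>i<n. (x i)\<^sup>2)"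
    by (intro continuous_intros continuous_on_product_coordinates)
  then have "closed {x::nat \<Rightarrow> real. (\<Sum>i<n. (x i)\<^sup>2) \<le> 1}" "closed {x::nat \<Rightarrow> real. (\<Sum>i<n. (x i)\<^sup>2) = 1}"
    by (intro closed_Collect_le closed_Collect_eq; simp)+
  ultimately show "closed (disc_set n)" "closed (sphere_set n)"
    unfolding disc_set_def sphere_set_def by (simp_all add: closed_Collect_conj)
qed

text \<open>Tietze's theorem on the closed set \<open>?S\<close>. Besides the cylinder over the
  sphere it contains both end discs, on which the function must be constant with the values at the
  two states. In dimension 0 only the ends remain.\<close>

lemma interval_fill:
  assumes w: "md_map (globe (disc_bd n)) interval_md w"
  shows "\<exists>h. md_map (globe (disc n)) interval_md h \<and> (\<forall>a\<in>pts (globe (disc_bd n)). w a = h a)"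
proof -
  define f where "f = w \<circ> glob_class"
  let ?S = "sphere_set n \<times> {0..1} \<union> (disc_set n \<times> {0} \<union> disc_set n \<times> {1::real})"
  have "continuous_map (cylinder (disc_bd n)) (top_of_set {0..1::real}) f"
    using md_mapD(1)[OF w] by (simp add: continuous_map_globe interval_md_def f_def)
  then have f: "continuous_on (sphere_set n \<times> {0..1}) f" "f \<in> sphere_set n \<times> {0..1} \<rightarrow> {0..1}"
    by (auto simp: cylinder_disc_bd)
  have w01: "w Src \<in> {0..1}" "w Tgt \<in> {0..1}"
    using md_mapD(2)[OF w] by (auto simp: interval_md_def)
  have f01: "f (z, 0) = w Src" "f (z, 1) = w Tgt" for z by (simp_all add: f_def glob_class_def)
  have "continuous_on (disc_set n \<times> {0}) f"
    by (rule continuous_on_eq[of _ "\<lambda>_. w Src"]) (auto simp: f01)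
  moreover have "continuous_on (disc_set n \<times> {1}) f"
    by (rule continuous_on_eq[of _ "\<lambda>_. w Tgt"]) (auto simp: f01)
  ultimately have "continuous_on ?S f"
    using f(1) by (intro continuous_on_closed_Un closed_Un closed_Times closed_disc_set closed_sphere_set) auto
  moreover have "closedin (top_of_set (disc_set n \<times> {0..1})) ?S"
  proof -
    have "closed ?S" by (intro closed_Un closed_Times closed_disc_set closed_sphere_set) auto
    then show ?thesis using sphere_subset_disc by (intro closed_subset) auto
  qed
  moreover have "f x \<in> cbox 0 1" if "x \<in> ?S" for x
    using that f(2) w01 by (auto simp: f01)
  ultimately obtain g where g: "continuous_on (disc_set n \<times> {0..1}) g" "\<And>x. x \<in> ?S \<Longrightarrow> g x = f x"
    "\<And>x. x \<in> disc_set n \<times> {0..1} \<Longrightarrow> g x \<in> cbox 0 1"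
    using Tietze_closed_interval_1[of ?S f "disc_set n \<times> {0..1}" 0 1] by auto
  have gc: "continuous_map (cylinder (disc n)) (und interval_md) g"
    using g(1,3) by (auto simp: cylinder_disc interval_md_def)
  have "md_map (globe (disc n)) interval_md (glob_fun (w Src) (w Tgt) g)"
  proof (rule glob_fun_md_map[OF mdspace_interval gc])
    show "w Src \<in> states interval_md" "w Tgt \<in> states interval_md"
      using w01 by (simp_all add: interval_md_def)
    fix z assume z: "z \<in> topspace (disc n)"
    then show "g (z, 0) = w Src" "g (z, 1) = w Tgt" using g(2) by (simp_all add: f01)
    have "continuous_on {0..1} (\<lambda>t. g (z, t))"
      using z by (intro continuous_on_compose2[OF g(1)]) (auto intro!: continuous_intros)
    then have "continuous_on {0..1} (\<lambda>t\<in>{0..1}. g (z, t))"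
      by (rule continuous_on_eq) simp
    then show "(\<lambda>t\<in>{0..1}. g (z, t)) \<in> epaths interval_md"
      using g(3) z by (auto simp: interval_md_def paths_in_def pathin_def)
  qed
  moreover have "w a = glob_fun (w Src) (w Tgt) g a" if "a \<in> pts (globe (disc_bd n))" for a
    using that
  proof (cases rule: pts_globe_cases)
    case (3 z t)
    then have z: "z \<in> sphere_set n" "z \<in> disc_set n" using sphere_subset_disc by auto
    then have "g (z, 0) = w Src" "g (z, 1) = w Tgt" using g(2) by (simp_all add: f01)
    then show ?thesis using 3 z g(2) by (simp add: glob_fun_class f_def)
  qed (simp_all add: glob_fun_def)
  ultimately show ?thesis by blast
qed

text \<open>Motion has to be visible to real functions and not merely to points: the
  reparametrisations depending continuously on the disc parameter are built from such
  functions.\<close>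

definition nostop :: "'a topology \<Rightarrow> (real \<Rightarrow> 'a) \<Rightarrow> bool" where
  "nostop Y c \<longleftrightarrow> (\<forall>a b. 0 \<le> a \<and> a < b \<and> b \<le> 1 \<longrightarrow>
     (\<exists>g. continuous_map Y (top_of_set {0..1::real}) g \<and> \<not> (\<lambda>s. g (c s)) constant_on {a..b}))"

lemma nostopE:
  assumes "nostop Y c" "0 \<le> a" "a < b" "b \<le> 1"
  obtains g where "continuous_map Y (top_of_set {0..1::real}) g" "\<not> (\<lambda>s. g (c s)) constant_on {a..b}"
proof -
  have "\<exists>g. continuous_map Y (top_of_set {0..1::real}) g \<and> \<not> (\<lambda>s. g (c s)) constant_on {a..b}"
    using assms by (simp add: nostop_def)
  then show thesis using that by (elim exE conjE)
qed

lemma norm_comp_nostop: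
  assumes "nostop Y c" "nostop Y d" "c 1 = d 0"
  shows "nostop Y (norm_comp c d)"
  unfolding nostop_def
proof (intro allI impI)
  fix a b :: real assume ab: "0 \<le> a \<and> a < b \<and> b \<le> 1"
  show "\<exists>g. continuous_map Y (top_of_set {0..1::real}) g \<and> \<not> (\<lambda>s. g (norm_comp c d s)) constant_on {a..b}"
  proof (cases "a < 1/2")
    case True
    \<comment> \<open>The interval is truncated to the first half; a function that varies on the
      smaller interval varies on the larger one.\<close>
    define b' where "b' = min b (1/2)"
    have b': "a < b'" "b' \<le> 1/2" "b' \<le> b" using ab True by (auto simp: b'_def)
    obtain g where g: "continuous_map Y (top_of_set {0..1::real}) g" "\<not> (\<lambda>s. g (c s)) constant_on {2 * a..2 * b'}"
      by (rule nostopE[OF assms(1), of "2 * a" "2 * b'"]) (use ab b' in auto)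
    have "\<not> (\<lambda>s. g (norm_comp c d s)) constant_on {a..b}"
    proof
      assume "(\<lambda>s. g (norm_comp c d s)) constant_on {a..b}"
      then obtain y where y: "\<And>s. s \<in> {a..b} \<Longrightarrow> g (norm_comp c d s) = y" by (auto simp: constant_on_def)
      have "g (c s) = y" if "s \<in> {2 * a..2 * b'}" for s
        using y[of "s / 2"] that b' ab by (simp add: norm_comp_def)
      then show False using g(2) by (auto simp: constant_on_def)
    qed
    with g(1) show ?thesis by (intro exI[of _ g] conjI)
  next
    case False
    obtain g where g: "continuous_map Y (top_of_set {0..1::real}) g" "\<not> (\<lambda>s. g (d s)) constant_on {2 * a - 1..2 * b - 1}"
      by (rule nostopE[OF assms(2), of "2 * a - 1" "2 * b - 1"]) (use ab False in auto)
    have "\<not> (\<lambda>s. g (norm_comp c d s)) constant_on {a..b}"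
    proof
      assume "(\<lambda>s. g (norm_comp c d s)) constant_on {a..b}"
      then obtain y where y: "\<And>s. s \<in> {a..b} \<Longrightarrow> g (norm_comp c d s) = y" by (auto simp: constant_on_def)
      have "g (d s) = y" if "s \<in> {2 * a - 1..2 * b - 1}" for s
      proof (cases "s = 0")
        \<comment> \<open>This is time 1/2 of the concatenation, where \<open>norm_comp\<close>
          takes the value \<open>c 1 = d 0\<close> from its left branch.\<close>
        case True
        then show ?thesis using y[of "1/2"] that ab False assms(3) by (simp add: norm_comp_def)
      next
        case s0: False
        then show ?thesis using y[of "(s + 1) / 2"] that ab False by (simp add: norm_comp_def field_simps)
      qed
      then show False using g(2) by (auto simp: constant_on_def)
    qed
    with g(1) show ?thesis by (intro exI[of _ g] conjI)
  qed
qed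

section \<open>Execution paths of a cellular object and the functions detecting their stops\<close>

context cell_tower
begin

text \<open>Provides a function on the whole object that sees the motion along a given cell: over an
  interior point of the disc it is a nonzero multiple of \<open>s * (1 - s)\<close>, which is
  constant on no nondegenerate interval.\<close>

lemma cell_function:
  assumes ij: "is_succ i j" "j \<le> \<mu>"
  shows "\<exists>f. continuous_map (und (X \<mu>)) (top_of_set {0..1::real}) f \<and>
    (\<forall>z\<in>disc_set (dim i j). \<forall>s\<in>{0..1}. f (t j \<mu> (chr i j (glob_class (z, s)))) =
      (1 - (\<Sum>l<dim i j. (z l)\<^sup>2)) * (s * (1 - s)))"
proof -
  let ?n = "dim i j"
  \<comment> \<open>\<open>B\<close> vanishes on the boundary of the globe, so it glues with 0 on the previous stages.\<close>
  define B where "B = (\<lambda>(z, s). (1 - (\<Sum>l<?n. (z l)\<^sup>2)) * (s * (1 - s :: real)))"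
  have B: "B (z, s) \<in> {0..1}" if "z \<in> disc_set ?n" "s \<in> {0..1}" for z s
  proof -
    have "0 \<le> (\<Sum>l<?n. (z l)\<^sup>2)" "(\<Sum>l<?n. (z l)\<^sup>2) \<le> 1"
      using that by (auto simp: disc_set_def sum_nonneg)
    then show ?thesis using that by (auto simp: B_def intro!: mult_nonneg_nonneg mult_le_one)
  qed
  have Bc: "continuous_on S B" for S
    unfolding B_def case_prod_beta
    by (intro continuous_intros continuous_on_coord[OF continuous_on_fst])
  have h: "md_map (globe (disc ?n)) interval_md (glob_fun 0 0 B)"
  proof (rule glob_fun_md_map[OF mdspace_interval])
    show "continuous_map (cylinder (disc ?n)) (und interval_md) B"
      using B Bc by (auto simp: cylinder_disc interval_md_def)
    show "0 \<in> states interval_md" "0 \<in> states interval_md" by (simp_all add: interval_md_def)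
    fix z assume z: "z \<in> topspace (disc ?n)"
    show "B (z, 0) = 0" "B (z, 1) = 0" by (simp_all add: B_def)
    have "continuous_on {0..1} (\<lambda>s. B (z, s))"
      by (intro continuous_on_compose2[OF Bc[of UNIV]]) (auto intro!: continuous_intros)
    then have "continuous_on {0..1} (\<lambda>s\<in>{0..1}. B (z, s))"
      by (rule continuous_on_eq) simp
    then show "(\<lambda>s\<in>{0..1}. B (z, s)) \<in> epaths interval_md"
      using B z by (auto simp: interval_md_def paths_in_def pathin_def)
  qed
  have hc: "glob_fun 0 0 B (glob_class (z, s)) = B (z, s)" for z s
    by (rule glob_fun_class) (simp_all add: B_def)
  have g: "md_map (X i) interval_md (\<lambda>_. 0)"
  proof -
    have "compose {0..1} (\<lambda>_::'a. 0::real) x = const_path 0" for x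
      by (simp add: compose_def const_path_def)
    moreover have "const_path 0 \<in> paths_in (top_of_set {0..1::real})"
      by (rule const_path_in_paths) simp
    ultimately show ?thesis by (simp add: md_map_def interval_md_def image_subset_iff)
  qed
  have "0 = glob_fun 0 0 B a" if "a \<in> pts (globe (disc_bd ?n))" for a
    using that
  proof (cases rule: pts_globe_cases)
    case (3 z s)
    then show ?thesis by (simp add: hc) (simp add: B_def sphere_set_def)
  qed (simp_all add: glob_fun_def)
  from glue[OF ij(2,1) mdspace_interval g h this]
  obtain k where k: "md_map (X j) interval_md k"
    "\<forall>b\<in>pts (globe (disc ?n)). k (chr i j b) = glob_fun 0 0 B b" by blast
  \<comment> \<open>Beyond stage \<open>j\<close>, each cell only asks to extend a function from the
    boundary of its globe, which \<open>interval_fill\<close> supplies.\<close>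
  have "\<exists>f. md_map (X \<mu>) interval_md f \<and> (\<forall>a\<in>pts (X j). f (t j \<mu> a) = k a) \<and>
      (\<forall>i j'. is_succ i j' \<longrightarrow> j' \<le> \<mu> \<longrightarrow> j \<le> i \<longrightarrow>
      (\<exists>h. True \<and> (\<forall>b\<in>pts (globe (disc (dim i j'))). f (t j' \<mu> (chr i j' b)) = h b)))"
  proof (rule tower_extension[OF mdspace_interval ij(2) k(1)])
    fix i j' g assume "is_succ i j'" "j' \<le> \<mu>" "md_map (X i) interval_md g"
    then show "\<exists>h. md_map (globe (disc (dim i j'))) interval_md h \<and>
          (\<forall>a\<in>pts (globe (disc_bd (dim i j'))). g (att i j' a) = h a) \<and> True"
      using interval_fill[OF md_map_compose[OF att_map]] by blast
  qed
  then obtain f where f: "md_map (X \<mu>) interval_md f" "\<forall>a\<in>pts (X j). f (t j \<mu> a) = k a" by blast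
  have "f (t j \<mu> (chr i j (glob_class (z, s)))) = B (z, s)" if "z \<in> disc_set ?n" "s \<in> {0..1}" for z s
  proof -
    have p: "glob_class (z, s) \<in> pts (globe (disc ?n))"
      using that by (intro glob_class_in_pts) auto
    show ?thesis
      using f(2) k(2) p md_mapD(4)[OF chr_map[OF ij(2,1)] p] by (simp add: hc)
  qed
  with md_mapD(1)[OF f(1)] show ?thesis
    by (intro exI[of _ f]) (simp add: interval_md_def B_def)
qed

text \<open>Reparametrised stop-free paths are stable under both operations on execution paths and
  include the cell paths over interior points, so \<open>epaths_subset\<close> applies. Restricting
  to interior points is essential: over the boundary, the attaching map may prescribe paths with
  stops.\<close>

lemma epaths_factor:
  assumes "x \<in> epaths (X \<mu>)"
  shows "\<exists>c \<phi>. c \<in> epaths (X \<mu>) \<and> nostop (und (X \<mu>)) c \<and> \<phi> \<in> Rep_plus \<and> x = compose {0..1} c \<phi>"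
proof -
  define R where "R = {compose {0..1} c \<phi> | c \<phi>. c \<in> epaths (X \<mu>) \<and> nostop (und (X \<mu>)) c \<and> \<phi> \<in> Rep_plus}"
  have Q: "mdspace T (X \<mu>)" using mdX by simp
  have "epaths (X \<mu>) \<subseteq> R"
  proof (rule epaths_subset)
    show "R \<subseteq> epaths (X \<mu>)" using mdspaceD(4)[OF Q] by (auto simp: R_def)
    show "compose {0..1} x \<psi> \<in> R" if x: "x \<in> R" and \<psi>: "\<psi> \<in> Rep_plus" for x \<psi>
    proof -
      obtain c \<phi> where c: "x = compose {0..1} c \<phi>" "c \<in> epaths (X \<mu>)" "nostop (und (X \<mu>)) c" "\<phi> \<in> Rep_plus"
        using x by (auto simp: R_def)
      have "compose {0..1} x \<psi> = compose {0..1} c (\<lambda>t. \<phi> (\<psi> t))"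
        using Rep_plus_in[OF \<psi>] by (auto simp: c(1) compose_def)
      with c(2,3) Rep_plus_comp[OF c(4) \<psi>] show ?thesis by (auto simp: R_def)
    qed
    show "norm_comp x y \<in> R" if x: "x \<in> R" and y: "y \<in> R" and xy: "x 1 = y 0" for x y
    proof -
      obtain c \<phi> where c: "x = compose {0..1} c \<phi>" "c \<in> epaths (X \<mu>)" "nostop (und (X \<mu>)) c" "\<phi> \<in> Rep_plus"
        using x by (auto simp: R_def)
      obtain d \<psi> where d: "y = compose {0..1} d \<psi>" "d \<in> epaths (X \<mu>)" "nostop (und (X \<mu>)) d" "\<psi> \<in> Rep_plus"
        using y by (auto simp: R_def)
      have cd: "c 1 = d 0"
        using xy Rep_plus_ends[OF c(4)] Rep_plus_ends[OF d(4)] by (simp add: c(1) d(1) compose_def)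
      have "norm_comp c d \<in> epaths (X \<mu>)" using mdspaceD(5)[OF Q c(2) d(2) cd] .
      moreover have "nostop (und (X \<mu>)) (norm_comp c d)" using norm_comp_nostop[OF c(3) d(3) cd] .
      ultimately show ?thesis
        using Rep_plus_juxtapose[OF c(4) d(4)] cd unfolding R_def c(1) d(1) by blast
    qed
    fix i j z assume ij: "is_succ i j" "j \<le> \<mu>" and z: "z \<in> disc_set (dim i j)" "z \<notin> sphere_set (dim i j)"
    define c where "c = (\<lambda>s\<in>{0..1::real}. t j \<mu> (chr i j (glob_class (z, s))))"
    have "c \<in> epaths (X \<mu>)"
      using globe_map_pathD[OF md_map_compose[OF chr_map[OF ij(2,1)] t_map[OF ij(2) order_refl]], of z "\<lambda>s. s"] z
      by (simp add: c_def)
    moreover have "nostop (und (X \<mu>)) c"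
      unfolding nostop_def
    proof (intro allI impI)
      fix a b :: real assume ab: "0 \<le> a \<and> a < b \<and> b \<le> 1"
      obtain f where f: "continuous_map (und (X \<mu>)) (top_of_set {0..1::real}) f"
        "\<forall>z\<in>disc_set (dim i j). \<forall>s\<in>{0..1}. f (t j \<mu> (chr i j (glob_class (z, s)))) =
          (1 - (\<Sum>l<dim i j. (z l)\<^sup>2)) * (s * (1 - s))"
        using cell_function[OF ij] by blast
      define q where "q = 1 - (\<Sum>l<dim i j. (z l)\<^sup>2)"
      have q: "q \<noteq> 0" using z by (auto simp: q_def disc_set_def sphere_set_def)
      have fc: "f (c s) = q * (s * (1 - s))" if "s \<in> {0..1}" for s
        using f(2) z that by (simp add: c_def q_def)
      have "\<not> (\<lambda>s. f (c s)) constant_on {a..b}"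
      proof
        assume "(\<lambda>s. f (c s)) constant_on {a..b}"
        then obtain y where y: "\<And>s. s \<in> {a..b} \<Longrightarrow> f (c s) = y" by (auto simp: constant_on_def)
        \<comment> \<open>\<open>s * (1 - s)\<close> takes each value at most twice, so it cannot
          agree at the three points \<open>a\<close>, \<open>m\<close>, \<open>b\<close>.\<close>
        define m where "m = (a + b) / 2"
        have m: "a < m" "m < b" using ab by (auto simp: m_def)
        have "q * (a * (1 - a)) = q * (m * (1 - m))" "q * (b * (1 - b)) = q * (m * (1 - m))"
          using y[of a] y[of b] y[of m] ab m by (simp_all add: fc)
        then have "a * (1 - a) = m * (1 - m)" "b * (1 - b) = m * (1 - m)" using q by simp_all
        then have "(m - a) * (1 - (a + m)) = 0" "(b - m) * (1 - (b + m)) = 0"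
          by (simp_all add: algebra_simps)
        then show False using m by simp
      qed
      with f(1) show "\<exists>g. continuous_map (und (X \<mu>)) (top_of_set {0..1::real}) g \<and> \<not> (\<lambda>s. g (c s)) constant_on {a..b}"
        by (intro exI[of _ f] conjI)
    qed
    moreover have "c = compose {0..1} c (\<lambda>s. s)" by (auto simp: compose_def c_def)
    ultimately have "c \<in> R" using id_Rep_plus unfolding R_def by blast
    then show "(\<lambda>s\<in>{0..1}. t j \<mu> (chr i j (glob_class (z, s)))) \<in> R" by (simp add: c_def)
  qed
  with assms have "x \<in> R" by blast
  then show ?thesis unfolding R_def by blast
qed

end

section \<open>Regularisation of families of paths\<close>

text \<open>Uniform continuity on the compact product makes the functions \<open>F (x, -)\<close> at
  nearby \<open>x\<close> uniformly close, and uniform closeness passes to suprema.\<close>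

lemma continuous_on_SUP_interval:
  fixes F :: "'x::metric_space \<times> real \<Rightarrow> real"
  assumes "compact A" "continuous_on (A \<times> {0..1}) F"
  shows "continuous_on A (\<lambda>x. SUP s\<in>{0..1}. F (x, s))"
proof -
  have bdd: "bdd_above ((\<lambda>s. F (x, s)) ` {0..1})" if "x \<in> A" for x
  proof -
    have "continuous_on {0..1} (\<lambda>s. F (x, s))"
      by (rule continuous_on_compose2[OF assms(2)]) (use that in \<open>auto intro!: continuous_intros\<close>)
    then have "compact ((\<lambda>s. F (x, s)) ` {0..1})" by (intro compact_continuous_image) auto
    then show ?thesis by (intro bounded_imp_bdd_above compact_imp_bounded)
  qed
  have uc: "uniformly_continuous_on (A \<times> {0..1}) F"
    using assms by (intro compact_uniformly_continuous compact_Times) auto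
  have le: "(SUP s\<in>{0..1}. F (x, s)) \<le> (SUP s\<in>{0..1}. F (y, s)) + e"
    if "y \<in> A" "\<And>s. s \<in> {0..1} \<Longrightarrow> F (x, s) \<le> F (y, s) + e" for x y e
  proof (rule cSUP_least)
    fix s :: real assume s: "s \<in> {0..1}"
    have "F (y, s) \<le> (SUP s\<in>{0..1}. F (y, s))"
      by (rule cSUP_upper[OF s bdd[OF that(1)]])
    with that(2)[OF s] show "F (x, s) \<le> (SUP s\<in>{0..1}. F (y, s)) + e" by linarith
  qed simp
  show ?thesis
    unfolding continuous_on_iff
  proof (intro ballI allI impI)
    fix x and e :: real assume x: "x \<in> A" and "0 < e"
    then obtain d where d: "d > 0" "\<And>p q. p \<in> A \<times> {0..1} \<Longrightarrow> q \<in> A \<times> {0..1} \<Longrightarrow> dist q p < d \<Longrightarrow> dist (F q) (F p) < e / 2"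
      using uc half_gt_zero[OF \<open>0 < e\<close>] unfolding uniformly_continuous_on_def by metis
    have "dist (SUP s\<in>{0..1}. F (y, s)) (SUP s\<in>{0..1}. F (x, s)) < e" if y: "y \<in> A" "dist y x < d" for y
    proof -
      have "\<bar>F (y, s) - F (x, s)\<bar> < e / 2" if "s \<in> {0..1}" for s
        using d(2)[of "(x, s)" "(y, s)"] that x y by (simp add: dist_Pair_Pair dist_real_def)
      then have b: "F (y, s) \<le> F (x, s) + e / 2" "F (x, s) \<le> F (y, s) + e / 2" if "s \<in> {0..1}" for s
        using that by (smt (verit))+
      have "\<bar>(SUP s\<in>{0..1}. F (y, s)) - (SUP s\<in>{0..1}. F (x, s))\<bar> \<le> e / 2"
        using le[OF x b(1)] le[OF y(1) b(2)] by linarith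
      with \<open>0 < e\<close> show ?thesis by (simp add: dist_real_def)
    qed
    with d(1) show "\<exists>d>0. \<forall>y\<in>A. dist y x < d \<longrightarrow>
        dist (SUP s\<in>{0..1}. F (y, s)) (SUP s\<in>{0..1}. F (x, s)) < e"
      by blast
  qed
qed

text \<open>A continuous surjection from a compact space onto a Hausdorff space is a quotient
  map.\<close>

lemma continuous_map_descend:
  fixes q :: "'k::topological_space \<Rightarrow> 'l::metric_space"
  assumes "compact K" "continuous_on K q" "q ` K = L" "continuous_map (top_of_set K) Y (\<lambda>x. f (q x))"
  shows "continuous_map (top_of_set L) Y f"
proof -
  have "quotient_map (top_of_set K) (top_of_set L) q"
    using assms(1-3) by (intro continuous_imp_quotient_map)
      (auto simp: compact_space_subtopology Hausdorff_space_subtopology)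
  then show ?thesis
    using continuous_compose_quotient_map[of "top_of_set K" "top_of_set L" q Y f] assms(4) by (simp add: o_def)
qed

text \<open>The oscillation of \<open>g \<circ> H(z,-)\<close> on \<open>[a,t]\<close> is a continuous nondecreasing function of \<open>t\<close> that
  is constant on every stop of \<open>H(z,-)\<close> and strictly increases after \<open>a\<close> as soon as \<open>g \<circ> H(z,-)\<close> moves.\<close>

lemma oscillation_function:
  fixes G :: "'z::metric_space \<times> real \<Rightarrow> real"
  assumes D: "compact D" and G: "continuous_on (D \<times> {0..1}) G" "G \<in> D \<times> {0..1} \<rightarrow> {0..1}"
    and a: "0 \<le> a" "a \<le> 1"
  defines "m \<equiv> (\<lambda>x. SUP s\<in>{0..1}. \<bar>G (fst x, max a (min s (snd x))) - G (fst x, a)\<bar>)"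
  shows "continuous_on (D \<times> {0..1}) m"
    and "\<And>x. x \<in> D \<times> {0..1} \<Longrightarrow> 0 \<le> m x \<and> m x \<le> 1"
    and "\<And>z s t. z \<in> D \<Longrightarrow> 0 \<le> s \<Longrightarrow> s \<le> t \<Longrightarrow> t \<le> 1 \<Longrightarrow> m (z, s) \<le> m (z, t)"
    and "\<And>z p q. z \<in> D \<Longrightarrow> 0 \<le> p \<Longrightarrow> p \<le> q \<Longrightarrow> q \<le> 1 \<Longrightarrow> (\<lambda>s. G (z, s)) constant_on {p..q} \<Longrightarrow> m (z, p) = m (z, q)"
    and "\<And>z b. z \<in> D \<Longrightarrow> a < b \<Longrightarrow> b \<le> 1 \<Longrightarrow> \<not> (\<lambda>s. G (z, s)) constant_on {a..b} \<Longrightarrow> m (z, a) < m (z, b)"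
proof -
  \<comment> \<open>As \<open>s\<close> runs through \<open>[0,1]\<close>, the clamped time
    \<open>max a (min s t)\<close> runs through \<open>[a,t]\<close>, or stays at \<open>a\<close>
    if \<open>t < a\<close>. The supremum is thus over a fixed interval, as
    \<open>continuous_on_SUP_interval\<close> requires.\<close>
  define f where "f = (\<lambda>x s. \<bar>G (fst x, max a (min s (snd x))) - G (fst x, a)\<bar>)"
  have m: "m x = (SUP s\<in>{0..1}. f x s)" for x by (simp add: m_def f_def)
  have f01: "0 \<le> f x s \<and> f x s \<le> 1" if "x \<in> D \<times> {0..1}" "s \<in> {0..1}" for x s
  proof -
    have "(fst x, max a (min s (snd x))) \<in> D \<times> {0..1}" "(fst x, a) \<in> D \<times> {0..1}"
      using that a by (auto simp: mem_Times_iff)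
    then have "G (fst x, max a (min s (snd x))) \<in> {0..1}" "G (fst x, a) \<in> {0..1}"
      using G(2) by blast+
    then show ?thesis by (auto simp: f_def)
  qed
  have bdd: "bdd_above (f x ` {0..1})" if "x \<in> D \<times> {0..1}" for x
    using f01[OF that] by (intro bdd_aboveI[of _ 1]) auto
  have up: "f x s \<le> m x" if "x \<in> D \<times> {0..1}" "s \<in> {0..1}" for x s
    unfolding m by (rule cSUP_upper[OF that(2) bdd[OF that(1)]])
  have least: "m x \<le> c" if "\<And>s. s \<in> {0..1} \<Longrightarrow> f x s \<le> c" for x c
    unfolding m by (rule cSUP_least) (use that in auto)
  show "continuous_on (D \<times> {0..1}) m"
    unfolding m_def
  proof (rule continuous_on_SUP_interval[of "D \<times> {0..1}" "\<lambda>(x, s). \<bar>G (fst x, max a (min s (snd x))) - G (fst x, a)\<bar>", simplified])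
    show "compact (D \<times> {0..1::real})" using D by (intro compact_Times) auto
    show "continuous_on ((D \<times> {0..1}) \<times> {0..1})
        (\<lambda>(x, s). \<bar>G (fst x, max a (min s (snd x))) - G (fst x, a)\<bar>)"
      unfolding case_prod_beta
    proof (intro continuous_on_rabs continuous_on_diff)
      show "continuous_on ((D \<times> {0..1}) \<times> {0..1}) (\<lambda>p. G (fst (fst p), max a (min (snd p) (snd (fst p)))))"
        by (rule continuous_on_compose2[OF G(1)]) (use a in \<open>auto intro!: continuous_intros\<close>)
      show "continuous_on ((D \<times> {0..1}) \<times> {0..1}) (\<lambda>p. G (fst (fst p), a))"
        by (rule continuous_on_compose2[OF G(1)]) (use a in \<open>auto intro!: continuous_intros\<close>)
    qed
  qed
  show "0 \<le> m x \<and> m x \<le> 1" if "x \<in> D \<times> {0..1}" for x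
    using up[OF that, of 0] f01[OF that, of 0] least[of x 1] f01[OF that] by force
  show mono: "m (z, s) \<le> m (z, t)" if "z \<in> D" "0 \<le> s" "s \<le> t" "t \<le> 1" for z s t
  proof (rule least)
    fix r :: real assume r: "r \<in> {0..1}"
    have "f (z, s) r = f (z, t) (min r s)" using that by (simp add: f_def min_def)
    also have "\<dots> \<le> m (z, t)" by (rule up) (use that r in auto)
    finally show "f (z, s) r \<le> m (z, t)" .
  qed
  show "m (z, p) = m (z, q)"
    if z: "z \<in> D" and pq: "0 \<le> p" "p \<le> q" "q \<le> 1" and const: "(\<lambda>s. G (z, s)) constant_on {p..q}" for z p q
  proof (rule antisym[OF mono[OF z pq]], rule least)
    fix r :: real assume r: "r \<in> {0..1}"
    obtain y where y: "\<And>s. s \<in> {p..q} \<Longrightarrow> G (z, s) = y" using const by (auto simp: constant_on_def)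
    have zp: "(z, p) \<in> D \<times> {0..1}" using z pq by auto
    \<comment> \<open>If the stop \<open>[p,q]\<close> ends before \<open>a\<close> or contains
      \<open>a\<close> after \<open>p\<close>, the deviation from time \<open>a\<close> is 0.
      Otherwise the value at the clamped time is attained by time \<open>p\<close> already: at the
      same time if that is at most \<open>p\<close>, at \<open>p\<close> itself if it lies in the
      stop.\<close>
    consider "a > q" | "p < a" "a \<le> q" | "a \<le> p" "min r q \<le> p" | "a \<le> p" "p < min r q" by linarith
    then show "f (z, q) r \<le> m (z, p)"
    proof cases
      case 1
      then have "f (z, q) r = 0" by (simp add: f_def max_def min_def)
      then show ?thesis using up[OF zp r] f01[OF zp r] by linarith
    next
      case 2
      then have "G (z, max a (min r q)) = y" "G (z, a) = y"
        using pq by (auto intro!: y simp: max_def min_def)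
      then have "f (z, q) r = 0" by (simp add: f_def)
      then show ?thesis using up[OF zp r] f01[OF zp r] by linarith
    next
      case 3
      then have "f (z, q) r = f (z, p) r" using pq by (auto simp: f_def min_def)
      then show ?thesis using up[OF zp r] by simp
    next
      case 4
      then have "G (z, max a (min r q)) = y" "G (z, max a (min 1 p)) = y"
        using pq by (auto intro!: y simp: max_def min_def)
      then have "f (z, q) r = f (z, p) 1" by (simp add: f_def)
      then show ?thesis using up[OF zp, of 1] by simp
    qed
  qed
  show "m (z, a) < m (z, b)"
    if z: "z \<in> D" and b: "a < b" "b \<le> 1" and nconst: "\<not> (\<lambda>s. G (z, s)) constant_on {a..b}" for z b
  proof -
    obtain s where s: "s \<in> {a..b}" "G (z, s) \<noteq> G (z, a)" using nconst unfolding constant_on_def by metis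
    have "m (z, a) \<le> 0" by (rule least) (auto simp: f_def max_def min_def)
    moreover have "0 < f (z, b) s" using s b by (simp add: f_def)
    moreover have "f (z, b) s \<le> m (z, b)" by (rule up) (use z b s a in auto)
    ultimately show ?thesis by linarith
  qed
qed

text \<open>One oscillation function handles a triple \<open>(z, a, b)\<close>; a weighted sum of
  countably many handles all of them. The sum is constant exactly on stops: there every term is
  constant, and on any other interval some term increases while none decreases.\<close>

lemma stop_parametrisation:
  fixes H :: "'z::{metric_space, second_countable_topology} \<times> real \<Rightarrow> 'e"
  assumes D: "compact D" "D \<noteq> {}" and H: "continuous_map (top_of_set (D \<times> {0..1})) Y H"
    and det: "\<And>z a b. z \<in> D \<Longrightarrow> 0 \<le> a \<Longrightarrow> a < b \<Longrightarrow> b \<le> 1 \<Longrightarrow> \<not> (\<lambda>s. H (z, s)) constant_on {a..b} \<Longrightarrow>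
      \<exists>g. continuous_map Y (top_of_set {0..1::real}) g \<and> \<not> (\<lambda>s. g (H (z, s))) constant_on {a..b}"
    and nconst: "\<And>z. z \<in> D \<Longrightarrow> \<not> (\<lambda>s. H (z, s)) constant_on {0..1}"
  shows "\<exists>\<tau>. continuous_on (D \<times> {0..1}) \<tau> \<and> (\<forall>z\<in>D. (\<lambda>s. \<tau> (z, s)) \<in> Rep_plus \<and>
    (\<forall>a b. 0 \<le> a \<longrightarrow> a \<le> b \<longrightarrow> b \<le> 1 \<longrightarrow> (\<tau> (z, a) = \<tau> (z, b) \<longleftrightarrow> (\<lambda>s. H (z, s)) constant_on {a..b})))"
proof -
  let ?K = "D \<times> {0..1::real}"
  \<comment> \<open>The properties of oscillation functions that pass to weighted sums. The bound by
    1 lets the weights \<open>(1/2) ^ k\<close> dominate the series.\<close>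
  define \<Phi> where "\<Phi> = {m :: 'z \<times> real \<Rightarrow> real. continuous_on ?K m \<and> (\<forall>x\<in>?K. 0 \<le> m x \<and> m x \<le> 1) \<and>
    (\<forall>z\<in>D. \<forall>s t. 0 \<le> s \<longrightarrow> s \<le> t \<longrightarrow> t \<le> 1 \<longrightarrow> m (z, s) \<le> m (z, t)) \<and>
    (\<forall>z\<in>D. \<forall>a b. 0 \<le> a \<longrightarrow> a \<le> b \<longrightarrow> b \<le> 1 \<longrightarrow> (\<lambda>s. H (z, s)) constant_on {a..b} \<longrightarrow> m (z, a) = m (z, b))}"
  have ex: "\<exists>m\<in>\<Phi>. m (z, a) < m (z, b)"
    if z: "z \<in> D" and ab: "0 \<le> a" "a < b" "b \<le> 1" and nc: "\<not> (\<lambda>s. H (z, s)) constant_on {a..b}" for z a b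
  proof -
    obtain g where g: "continuous_map Y (top_of_set {0..1::real}) g" "\<not> (\<lambda>s. g (H (z, s))) constant_on {a..b}"
      using det[OF z ab nc] by (elim exE conjE)
    define G where "G = (\<lambda>x. g (H x))"
    have "continuous_map (top_of_set ?K) (top_of_set {0..1}) G"
      using continuous_map_compose[OF H g(1)] by (simp add: o_def G_def)
    then have G: "continuous_on ?K G" "G \<in> ?K \<rightarrow> {0..1}" by auto
    have a: "0 \<le> a" "a \<le> 1" using ab by auto
    note osc = oscillation_function[OF D(1) G a]
    let ?m = "\<lambda>x. SUP s\<in>{0..1}. \<bar>G (fst x, max a (min s (snd x))) - G (fst x, a)\<bar>"
    have "(\<lambda>s. G (z, s)) constant_on {p..q}" if "(\<lambda>s. H (z, s)) constant_on {p..q}" for z p q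
      using that by (auto simp: constant_on_def G_def)
    then have "?m \<in> \<Phi>"
      unfolding \<Phi>_def using osc(1-4) by blast
    moreover have "?m (z, a) < ?m (z, b)"
      using osc(5)[OF z ab(2,3)] g(2) by (simp add: G_def)
    ultimately show ?thesis by (intro bexI[of _ ?m])
  qed
  \<comment> \<open>The triples \<open>(z, a, b)\<close> at which a given \<open>m\<close> increases
    form an open set \<open>V m\<close>. These sets contain all triples for which
    \<open>H(z,-)\<close> moves between \<open>a\<close> and \<open>b\<close>, and second
    countability extracts a countable subfamily with the same union.\<close>
  define U where "U = D \<times> {0..1::real} \<times> {0..1::real}"
  define V where "V = (\<lambda>m :: 'z \<times> real \<Rightarrow> real. {x \<in> U. m (fst x, fst (snd x)) < m (fst x, snd (snd x))})"
  have "openin (top_of_set U) (V m)" if "m \<in> \<Phi>" for m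
  proof -
    have m: "continuous_on ?K m" using that by (simp add: \<Phi>_def)
    have "continuous_on U (\<lambda>x. m (fst x, snd (snd x)) - m (fst x, fst (snd x)))"
    proof (intro continuous_on_diff)
      show "continuous_on U (\<lambda>x. m (fst x, snd (snd x)))" "continuous_on U (\<lambda>x. m (fst x, fst (snd x)))"
        by (rule continuous_on_compose2[OF m]; auto simp: U_def intro!: continuous_intros)+
    qed
    from continuous_openin_preimage_gen[OF this, of "{0<..}"]
    have "openin (top_of_set U) (U \<inter> (\<lambda>x. m (fst x, snd (snd x)) - m (fst x, fst (snd x))) -` {0<..})" by simp
    moreover have "U \<inter> (\<lambda>x. m (fst x, snd (snd x)) - m (fst x, fst (snd x))) -` {0<..} = V m"
      by (auto simp: V_def)
    ultimately show ?thesis by simp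
  qed
  then have "\<And>S. S \<in> V ` \<Phi> \<Longrightarrow> openin (top_of_set U) S" by blast
  then obtain \<F> where \<F>: "\<F> \<subseteq> V ` \<Phi>" "countable \<F>" "\<Union>\<F> = \<Union>(V ` \<Phi>)"
    by (rule Lindelof_openin)
  obtain \<Psi> where \<Psi>: "countable \<Psi>" "\<Psi> \<subseteq> \<Phi>" "\<F> = V ` \<Psi>"
    using countable_subset_image[THEN iffD1, OF conjI[OF \<F>(2,1)]] by (elim exE conjE)
  have ex\<Psi>: "\<exists>m\<in>\<Psi>. m (z, a) < m (z, b)"
    if zab: "z \<in> D" "0 \<le> a" "a < b" "b \<le> 1" "\<not> (\<lambda>s. H (z, s)) constant_on {a..b}" for z a b
  proof -
    obtain m where "m \<in> \<Phi>" "m (z, a) < m (z, b)" using ex[OF zab] by blast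
    then have "(z, a, b) \<in> \<Union>(V ` \<Phi>)" using zab by (auto simp: V_def U_def)
    then have "(z, a, b) \<in> \<Union>(V ` \<Psi>)" using \<F>(3) \<Psi>(3) by simp
    then show ?thesis by (auto simp: V_def)
  qed
  have "\<Psi> \<noteq> {}" using ex\<Psi>[of _ 0 1] D(2) nconst by fastforce
  define M where "M = from_nat_into \<Psi>"
  have rM: "range M = \<Psi>" using range_from_nat_into[OF \<open>\<Psi> \<noteq> {}\<close> \<Psi>(1)] by (simp add: M_def)
  then have M\<Phi>: "M k \<in> \<Phi>" for k using \<Psi>(2) by blast
  have M01: "0 \<le> M k x" "M k x \<le> 1" if "x \<in> ?K" for k x using M\<Phi>[of k] that by (auto simp: \<Phi>_def)
  have summ: "summable (\<lambda>k. (1/2::real) ^ k)" by simp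
  have bound: "norm ((1/2) ^ k * M k x) \<le> (1/2) ^ k" if "x \<in> ?K" for k x
    using M01[OF that, of k] by (simp add: mult_le_cancel_left1 abs_mult)
  define S where "S = (\<lambda>x. suminf (\<lambda>k. (1/2) ^ k * M k x))"
  have sumM: "summable (\<lambda>k. (1/2) ^ k * M k x)" if "x \<in> ?K" for x
    by (rule summable_comparison_test'[OF summ, of 0]) (use bound[OF that] in auto)
  have Sc: "continuous_on ?K S"
  proof (rule uniform_limit_theorem)
    show "uniform_limit ?K (\<lambda>n x. \<Sum>k<n. (1/2) ^ k * M k x) S sequentially"
      unfolding S_def by (rule Weierstrass_m_test[OF bound summ])
    have "continuous_on ?K (M k)" for k using M\<Phi>[of k] by (simp add: \<Phi>_def)
    then show "\<forall>\<^sub>F n in sequentially. continuous_on ?K (\<lambda>x. \<Sum>k<n. (1/2) ^ k * M k x)"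
      by (intro always_eventually allI continuous_intros)
  qed simp
  have Smono: "S (z, s) \<le> S (z, t)" if "z \<in> D" "0 \<le> s" "s \<le> t" "t \<le> 1" for z s t
    unfolding S_def
  proof (rule suminf_le)
    fix k
    have "M k (z, s) \<le> M k (z, t)" using M\<Phi>[of k] that by (simp add: \<Phi>_def)
    then show "(1/2) ^ k * M k (z, s) \<le> (1/2) ^ k * M k (z, t)" by (intro mult_left_mono) auto
  qed (use that in \<open>auto intro!: sumM\<close>)
  have Sconst: "S (z, a) = S (z, b) \<longleftrightarrow> (\<lambda>s. H (z, s)) constant_on {a..b}"
    if z: "z \<in> D" and ab: "0 \<le> a" "a \<le> b" "b \<le> 1" for z a b
  proof
    assume c: "(\<lambda>s. H (z, s)) constant_on {a..b}"
    have "M k (z, a) = M k (z, b)" for k using M\<Phi>[of k] z ab c by (simp add: \<Phi>_def)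
    then show "S (z, a) = S (z, b)" by (simp add: S_def)
  next
    assume eq: "S (z, a) = S (z, b)"
    show "(\<lambda>s. H (z, s)) constant_on {a..b}"
    proof (rule ccontr)
      assume nc: "\<not> (\<lambda>s. H (z, s)) constant_on {a..b}"
      then have "a \<noteq> b" by (auto simp: constant_on_def)
      with ab have "a < b" by simp
      from ex\<Psi>[OF z ab(1) this ab(3) nc] rM obtain i where i: "M i (z, a) < M i (z, b)" by blast
      have sa: "summable (\<lambda>k. (1/2) ^ k * M k (z, a))" "summable (\<lambda>k. (1/2) ^ k * M k (z, b))"
        using z ab by (auto intro!: sumM)
      have "0 < suminf (\<lambda>k. (1/2) ^ k * M k (z, b) - (1/2) ^ k * M k (z, a))"
      proof (rule suminf_pos2[of _ i])
        show "summable (\<lambda>k. (1/2) ^ k * M k (z, b) - (1/2) ^ k * M k (z, a))"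
          using sa by (intro summable_diff)
        have "M k (z, a) \<le> M k (z, b)" for k using M\<Phi>[of k] z ab by (simp add: \<Phi>_def)
        then show "0 \<le> (1/2) ^ k * M k (z, b) - (1/2) ^ k * M k (z, a)" for k by simp
        show "0 < (1/2) ^ i * M i (z, b) - (1/2) ^ i * M i (z, a)" using i by simp
      qed
      also have "\<dots> = S (z, b) - S (z, a)"
        unfolding S_def using sa by (simp add: suminf_diff)
      finally show False using eq by simp
    qed
  qed
  \<comment> \<open>Affine normalisation to the end values 0 and 1 for each \<open>z\<close>; the
    denominator is positive because no path \<open>H(z,-)\<close> is constant.\<close>
  define \<tau> where "\<tau> = (\<lambda>x. (S x - S (fst x, 0)) / (S (fst x, 1) - S (fst x, 0)))"
  have S01: "S (z, 0) < S (z, 1)" if "z \<in> D" for z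
    using Smono[OF that, of 0 1] Sconst[OF that, of 0 1] nconst[OF that] by simp
  have \<tau>c: "continuous_on ?K \<tau>"
    unfolding \<tau>_def
  proof (intro continuous_on_divide continuous_on_diff Sc ballI)
    show "continuous_on ?K (\<lambda>x. S (fst x, 0))" "continuous_on ?K (\<lambda>x. S (fst x, 0))"
      "continuous_on ?K (\<lambda>x. S (fst x, 1))"
      by (rule continuous_on_compose2[OF Sc]; auto intro!: continuous_intros)+
    show "S (fst x, 1) - S (fst x, 0) \<noteq> 0" if "x \<in> ?K" for x
      using S01[of "fst x"] that by (auto simp: mem_Times_iff)
  qed
  have "(\<lambda>s. \<tau> (z, s)) \<in> Rep_plus" if z: "z \<in> D" for z
  proof (rule Rep_plusI)
    show "continuous_on {0..1} (\<lambda>s. \<tau> (z, s))"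
      by (rule continuous_on_compose2[OF \<tau>c]) (use z in \<open>auto intro!: continuous_intros\<close>)
    show "mono_on {0..1} (\<lambda>s. \<tau> (z, s))"
      using Smono[OF z] S01[OF z] by (auto simp: mono_on_def \<tau>_def intro!: divide_right_mono)
  qed (use S01[OF z] in \<open>simp_all add: \<tau>_def\<close>)
  moreover have "\<tau> (z, a) = \<tau> (z, b) \<longleftrightarrow> (\<lambda>s. H (z, s)) constant_on {a..b}"
    if "z \<in> D" "0 \<le> a" "a \<le> b" "b \<le> 1" for z a b
    using Sconst[OF that] S01[OF that(1)] by (simp add: \<tau>_def)
  ultimately show ?thesis using \<tau>c by (intro exI[of _ \<tau>]) blast
qed

section \<open>Repairing a filling of a globe over a disc\<close>

lemma compact_disc_set: "compact (disc_set n)"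
proof -
  have "compactin (powertop_real UNIV) (PiE UNIV (\<lambda>_. {-1..1::real}))"
    by (subst compactin_PiE) auto
  then have "compact (PiE UNIV (\<lambda>_::nat. {-1..1::real}))"
    by (simp add: euclidean_product_topology)
  moreover have "disc_set n \<subseteq> PiE UNIV (\<lambda>_. {-1..1})"
  proof (rule subsetI, rule PiE_I)
    fix z k assume z: "z \<in> disc_set n"
    show "z k \<in> {-1..1}"
    proof (cases "k < n")
      case True
      then have "(z k)\<^sup>2 \<le> (\<Sum>i<n. (z i)\<^sup>2)" by (intro member_le_sum) auto
      also have "\<dots> \<le> 1" using z by (simp add: disc_set_def)
      finally show ?thesis by (simp add: abs_square_le_1 abs_le_iff)
    qed (use z in \<open>simp add: disc_set_def\<close>)
  qed simp
  ultimately show ?thesis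
    using compact_Int_closed[OF _ closed_disc_set] by (metis inf.absorb2)
qed

lemma Rep_plus_interval:
  assumes "\<phi> \<in> Rep_plus" "0 \<le> a" "a \<le> b" "b \<le> 1" "u \<in> {\<phi> a..\<phi> b}"
  obtains s where "s \<in> {a..b}" "\<phi> s = u"
proof -
  have "continuous_on {a..b} \<phi>"
    using assms(1-4) by (auto simp: Rep_plus_def intro: continuous_on_subset)
  then show thesis using IVT'[of \<phi> a u b] assms that by auto
qed

text \<open>The pointwise factorisations \<open>c z\<close>, \<open>\<phi> z\<close> tell where
  \<open>H(z,-)\<close> stops and that its motion is detected by real functions, which is what
  \<open>stop_parametrisation\<close> needs. They also show that the repaired paths are execution
  paths, being reparametrisations of \<open>c z\<close>.\<close>

lemma regular_filling:
  assumes Q: "mdspace T Q" and l: "md_map (globe (disc n)) Q l"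
    and fac: "\<And>x. x \<in> epaths Q \<Longrightarrow>
      \<exists>c \<phi>. c \<in> epaths Q \<and> nostop (und Q) c \<and> \<phi> \<in> Rep_plus \<and> x = compose {0..1} c \<phi>"
  shows "\<exists>l'. md_map (globe (disc n)) Q l' \<and> (\<forall>a\<in>pts (globe (disc_bd n)). l a = l' a) \<and>
    (\<forall>z\<in>disc_set n. z \<notin> sphere_set n \<longrightarrow> (\<forall>a b. 0 \<le> a \<longrightarrow> a < b \<longrightarrow> b \<le> 1 \<longrightarrow>
       \<not> (\<lambda>s. l' (glob_class (z, s))) constant_on {a..b}))"
proof -
  let ?D = "disc_set n" and ?Y = "und Q"
  let ?K = "?D \<times> {0..1::real}"
  define H where "H = (\<lambda>x. l (glob_class x))"
  have Hc: "continuous_map (top_of_set ?K) ?Y H"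
    using md_mapD(1)[OF l] by (simp add: continuous_map_globe cylinder_disc H_def o_def)
  have "(\<lambda>s\<in>{0..1}. H (z, s)) \<in> epaths Q" if "z \<in> ?D" for z
    using globe_map_pathD[OF l _ id_Rep_plus, of z] that by (simp add: H_def)
  then have "\<exists>c \<phi>. c \<in> epaths Q \<and> nostop ?Y c \<and> \<phi> \<in> Rep_plus \<and> (\<lambda>s\<in>{0..1}. H (z, s)) = compose {0..1} c \<phi>"
    if "z \<in> ?D" for z using fac that by blast
  then obtain c \<phi> where c: "c z \<in> epaths Q" "nostop ?Y (c z)" and \<phi>: "\<phi> z \<in> Rep_plus"
    and eq: "(\<lambda>s\<in>{0..1}. H (z, s)) = compose {0..1} (c z) (\<phi> z)" if "z \<in> ?D" for z
    by metis
  have Hc\<phi>: "H (z, s) = c z (\<phi> z s)" if "z \<in> ?D" "0 \<le> s" "s \<le> 1" for z s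
    using fun_cong[OF eq[OF that(1)], of s] that by (simp add: compose_def)
  have const\<phi>: "(\<lambda>s. H (z, s)) constant_on {a..b}"
    if z: "z \<in> ?D" and ab: "0 \<le> a" "a \<le> b" "b \<le> 1" and eq: "\<phi> z a = \<phi> z b" for z a b
  proof -
    have "H (z, s) = H (z, a)" if s: "s \<in> {a..b}" for s
    proof -
      have "\<phi> z a \<le> \<phi> z s" "\<phi> z s \<le> \<phi> z b"
        using s ab by (auto intro!: Rep_plus_mono[OF \<phi>[OF z]])
      then show ?thesis using s ab eq Hc\<phi>[OF z] by auto
    qed
    then show ?thesis unfolding constant_on_def by blast
  qed
  have det: "\<exists>g. continuous_map ?Y (top_of_set {0..1::real}) g \<and> \<not> (\<lambda>s. g (H (z, s))) constant_on {a..b}"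
    if z: "z \<in> ?D" and ab: "0 \<le> a" "a \<le> b" "b \<le> 1" and ne: "\<phi> z a \<noteq> \<phi> z b" for z a b
  proof -
    have lt: "\<phi> z a < \<phi> z b" using Rep_plus_mono[OF \<phi>[OF z] ab] ne by simp
    have a01: "0 \<le> \<phi> z a" "\<phi> z b \<le> 1"
      using Rep_plus_in[OF \<phi>[OF z], of a] Rep_plus_in[OF \<phi>[OF z], of b] ab by auto
    obtain g where g: "continuous_map ?Y (top_of_set {0..1::real}) g" "\<not> (\<lambda>s. g (c z s)) constant_on {\<phi> z a..\<phi> z b}"
      by (rule nostopE[OF c(2)[OF z] a01(1) lt a01(2)])
    have "\<not> (\<lambda>s. g (H (z, s))) constant_on {a..b}"
    proof
      assume "(\<lambda>s. g (H (z, s))) constant_on {a..b}"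
      then obtain y where y: "\<And>s. s \<in> {a..b} \<Longrightarrow> g (H (z, s)) = y" by (auto simp: constant_on_def)
      have "g (c z u) = y" if u: "u \<in> {\<phi> z a..\<phi> z b}" for u
      proof -
        obtain s where "s \<in> {a..b}" "\<phi> z s = u" by (rule Rep_plus_interval[OF \<phi>[OF z] ab u])
        then show ?thesis using y[of s] Hc\<phi>[OF z, of s] ab by simp
      qed
      with g(2) show False by (auto simp: constant_on_def)
    qed
    with g(1) show ?thesis by (intro exI[of _ g] conjI)
  qed
  have const\<phi>_iff: "(\<lambda>s. H (z, s)) constant_on {a..b} \<longleftrightarrow> \<phi> z a = \<phi> z b"
    if z: "z \<in> ?D" and ab: "0 \<le> a" "a \<le> b" "b \<le> 1" for z a b
  proof
    assume "(\<lambda>s. H (z, s)) constant_on {a..b}"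
    then have "(\<lambda>s. g (H (z, s))) constant_on {a..b}" for g :: "_ \<Rightarrow> real"
      by (auto simp: constant_on_def)
    with det[OF z ab] show "\<phi> z a = \<phi> z b" by blast
  qed (rule const\<phi>[OF that])
  have "(\<lambda>_. 0) \<in> ?D" by (simp add: disc_set_def)
  then have "?D \<noteq> {}" by blast
  have "\<exists>\<tau>. continuous_on ?K \<tau> \<and> (\<forall>z\<in>?D. (\<lambda>s. \<tau> (z, s)) \<in> Rep_plus \<and>
    (\<forall>a b. 0 \<le> a \<longrightarrow> a \<le> b \<longrightarrow> b \<le> 1 \<longrightarrow> (\<tau> (z, a) = \<tau> (z, b) \<longleftrightarrow> (\<lambda>s. H (z, s)) constant_on {a..b})))"
  proof (rule stop_parametrisation[OF compact_disc_set \<open>?D \<noteq> {}\<close> Hc])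
    fix z a b assume z: "z \<in> ?D" and ab: "0 \<le> a" "a < b" "b \<le> (1::real)"
      and "\<not> (\<lambda>s. H (z, s)) constant_on {a..b}"
    then have "\<phi> z a \<noteq> \<phi> z b" using const\<phi>_iff[OF z, of a b] by simp
    then show "\<exists>g. continuous_map ?Y (top_of_set {0..1::real}) g \<and> \<not> (\<lambda>s. g (H (z, s))) constant_on {a..b}"
      using det[OF z, of a b] ab by simp
  next
    show "\<not> (\<lambda>s. H (z, s)) constant_on {0..1}" if "z \<in> ?D" for z
      using const\<phi>_iff[OF that, of 0 1] Rep_plus_ends[OF \<phi>[OF that]] by simp
  qed
  then obtain \<tau> where \<tau>c: "continuous_on ?K \<tau>" and \<tau>: "\<And>z. z \<in> ?D \<Longrightarrow> (\<lambda>s. \<tau> (z, s)) \<in> Rep_plus"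
    and \<tau>H: "\<And>z a b. z \<in> ?D \<Longrightarrow> 0 \<le> a \<Longrightarrow> a \<le> b \<Longrightarrow> b \<le> 1 \<Longrightarrow>
      \<tau> (z, a) = \<tau> (z, b) \<longleftrightarrow> (\<lambda>s. H (z, s)) constant_on {a..b}"
    by blast
  have \<tau>\<phi>: "\<tau> (z, a) = \<tau> (z, b) \<longleftrightarrow> \<phi> z a = \<phi> z b"
    if "z \<in> ?D" "0 \<le> a" "a \<le> 1" "0 \<le> b" "b \<le> 1" for z a b
  proof (cases "a \<le> b")
    case True
    then show ?thesis using \<tau>H[of z a b] const\<phi>_iff[of z a b] that by simp
  next
    case False
    then have "\<tau> (z, b) = \<tau> (z, a) \<longleftrightarrow> \<phi> z b = \<phi> z a"
      using \<tau>H[of z b a] const\<phi>_iff[of z b a] that by simp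
    then show ?thesis by metis
  qed
  \<comment> \<open>An arbitrary section of \<open>\<tau>(z,-)\<close>, in general not continuous.
    The choice is harmless: times with equal \<open>\<tau>\<close> have equal \<open>\<phi>\<close>,
    hence equal \<open>H\<close>.\<close>
  define tinv where "tinv = (\<lambda>z u. SOME s. 0 \<le> s \<and> s \<le> 1 \<and> \<tau> (z, s) = u)"
  have tinv: "0 \<le> tinv z u" "tinv z u \<le> 1" "\<tau> (z, tinv z u) = u" if "z \<in> ?D" "0 \<le> u" "u \<le> 1" for z u
  proof -
    have "u \<in> (\<lambda>s. \<tau> (z, s)) ` {0..1}" using \<tau>[OF that(1)] that by (simp add: Rep_plus_def)
    then have "\<exists>s. 0 \<le> s \<and> s \<le> 1 \<and> \<tau> (z, s) = u" by auto
    from someI_ex[OF this] show "0 \<le> tinv z u" "tinv z u \<le> 1" "\<tau> (z, tinv z u) = u"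
      by (simp_all add: tinv_def)
  qed
  define Hr where "Hr = (\<lambda>(z, u). H (z, tinv z u))"
  have \<tau>in: "0 \<le> \<tau> (z, s)" "\<tau> (z, s) \<le> 1" if "z \<in> ?D" "0 \<le> s" "s \<le> 1" for z s
    using Rep_plus_in[OF \<tau>[OF that(1)] that(2,3)] by auto
  have tinv\<phi>: "\<phi> z (tinv z (\<tau> (z, s))) = \<phi> z s" if "z \<in> ?D" "0 \<le> s" "s \<le> 1" for z s
    using tinv[OF that(1) \<tau>in[OF that]] \<tau>\<phi> that by blast
  have Hr: "Hr (z, \<tau> (z, s)) = H (z, s)" if "z \<in> ?D" "0 \<le> s" "s \<le> 1" for z s
    using tinv[OF that(1) \<tau>in[OF that]] tinv\<phi>[OF that] that by (simp add: Hr_def Hc\<phi>)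
  have Hrc: "continuous_map (top_of_set ?K) ?Y Hr"
  proof (rule continuous_map_descend[where q="\<lambda>x. (fst x, \<tau> x)"])
    show "compact ?K" by (intro compact_Times compact_disc_set) auto
    show "continuous_on ?K (\<lambda>x. (fst x, \<tau> x))" by (intro continuous_intros \<tau>c)
    show "(\<lambda>x. (fst x, \<tau> x)) ` ?K = ?K"
    proof (intro equalityI subsetI)
      fix p assume "p \<in> ?K"
      then obtain z u where p: "p = (z, u)" "z \<in> ?D" "0 \<le> u" "u \<le> 1" by auto
      then have "p = (\<lambda>x. (fst x, \<tau> x)) (z, tinv z u)" "(z, tinv z u) \<in> ?K" using tinv[OF p(2-4)] by auto
      then show "p \<in> (\<lambda>x. (fst x, \<tau> x)) ` ?K" by blast
    qed (use \<tau>in in auto)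
    show "continuous_map (top_of_set ?K) ?Y (\<lambda>x. Hr (fst x, \<tau> x))"
      by (rule continuous_map_eq[OF Hc]) (auto simp: Hr)
  qed
  have Hrp: "(\<lambda>u\<in>{0..1}. Hr (z, u)) \<in> epaths Q" if z: "z \<in> ?D" for z
  proof -
    \<comment> \<open>\<open>\<phi> z\<close> is constant on the fibres of
      \<open>\<tau>(z,-)\<close> and so descends to a reparametrisation \<open>\<psi>\<close>; then
      \<open>Hr(z,-)\<close> is the execution path \<open>c z\<close> composed with
      \<open>\<psi>\<close>.\<close>
    define \<psi> where "\<psi> = (\<lambda>u. \<phi> z (tinv z u))"
    have "\<psi> \<in> Rep_plus"
    proof (rule Rep_plusI)
      have "continuous_map (top_of_set {0..1}) euclideanreal \<psi>"
      proof (rule continuous_map_descend[where q="\<lambda>s. \<tau> (z, s)"])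
        show "continuous_on {0..1} (\<lambda>s. \<tau> (z, s))" "(\<lambda>s. \<tau> (z, s)) ` {0..1} = {0..1}"
          using \<tau>[OF z] by (simp_all add: Rep_plus_def)
        have "continuous_map (top_of_set {0..1}) euclideanreal (\<phi> z)"
          using \<phi>[OF z] by (simp add: Rep_plus_def)
        then show "continuous_map (top_of_set {0..1}) euclideanreal (\<lambda>s. \<psi> (\<tau> (z, s)))"
          by (rule continuous_map_eq) (simp add: \<psi>_def tinv\<phi>[OF z])
      qed simp
      then show "continuous_on {0..1} \<psi>" by simp
      show "mono_on {0..1} \<psi>"
      proof (rule mono_onI)
        fix u v :: real assume uv: "u \<in> {0..1}" "v \<in> {0..1}" "u \<le> v"
        note iu = tinv[OF z, of u] and iv = tinv[OF z, of v]
        show "\<psi> u \<le> \<psi> v"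
        proof (cases "tinv z u \<le> tinv z v")
          case True
          then show ?thesis unfolding \<psi>_def using iu iv uv by (intro Rep_plus_mono[OF \<phi>[OF z]]) auto
        next
          case False
          then have "v \<le> u" using Rep_plus_mono[OF \<tau>[OF z], of "tinv z v" "tinv z u"] iu iv uv by simp
          then show ?thesis using uv by simp
        qed
      qed
      show "\<psi> 0 = 0" using tinv\<phi>[OF z, of 0] Rep_plus_ends[OF \<tau>[OF z]] Rep_plus_ends[OF \<phi>[OF z]] by (simp add: \<psi>_def)
      show "\<psi> 1 = 1" using tinv\<phi>[OF z, of 1] Rep_plus_ends[OF \<tau>[OF z]] Rep_plus_ends[OF \<phi>[OF z]] by (simp add: \<psi>_def)
    qed
    then have "compose {0..1} (c z) \<psi> \<in> epaths Q" using mdspaceD(4)[OF Q c(1)[OF z]] by blast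
    moreover have "compose {0..1} (c z) \<psi> = (\<lambda>u\<in>{0..1}. Hr (z, u))"
      using tinv[OF z] Hc\<phi>[OF z] by (auto simp: compose_def Hr_def \<psi>_def)
    ultimately show ?thesis by simp
  qed
  define r where "r = (\<lambda>z::nat \<Rightarrow> real. \<Sum>k<n. (z k)\<^sup>2)"
  have r01: "0 \<le> r z" "r z \<le> 1" if "z \<in> ?D" for z
    using that by (simp_all add: r_def disc_set_def sum_nonneg)
  define \<rho> where "\<rho> = (\<lambda>x. (1 - r (fst x)) * snd x + r (fst x) * \<tau> x)"
  have rc: "continuous_on S r" for S
    unfolding r_def by (rule continuous_on_subset[of UNIV]) (auto intro!: continuous_intros continuous_on_product_coordinates)
  have \<rho>c: "continuous_on ?K \<rho>"
    unfolding \<rho>_def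
    by (intro continuous_intros \<tau>c continuous_on_compose2[OF rc[of UNIV]]) auto
  have \<rho>: "(\<lambda>s. \<rho> (z, s)) \<in> Rep_plus" if z: "z \<in> ?D" for z
  proof (rule Rep_plusI)
    show "continuous_on {0..1} (\<lambda>s. \<rho> (z, s))"
      by (rule continuous_on_compose2[OF \<rho>c]) (use z in \<open>auto intro!: continuous_intros\<close>)
    show "mono_on {0..1} (\<lambda>s. \<rho> (z, s))"
      unfolding \<rho>_def using r01[OF z] Rep_plus_mono[OF \<tau>[OF z]]
      by (auto simp: mono_on_def intro!: add_mono mult_left_mono)
  qed (use Rep_plus_ends[OF \<tau>[OF z]] in \<open>simp_all add: \<rho>_def\<close>)
  define H' where "H' = (\<lambda>x. Hr (fst x, \<rho> x))"
  have Hends: "H (z, 0) = l Src" "H (z, 1) = l Tgt" for z by (simp_all add: H_def glob_class_def)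
  have H'ends: "H' (z, 0) = l Src" "H' (z, 1) = l Tgt" if z: "z \<in> ?D" for z
    using Hr[OF z, of 0] Hr[OF z, of 1] Rep_plus_ends[OF \<rho>[OF z]] Rep_plus_ends[OF \<tau>[OF z]]
    by (simp_all add: H'_def Hends)
  let ?l = "glob_fun (l Src) (l Tgt) H'"
  have lH': "?l (glob_class (z, s)) = H' (z, s)" if "z \<in> ?D" for z s
    by (rule glob_fun_class) (use H'ends[OF that] in auto)
  have "md_map (globe (disc n)) Q ?l"
  proof (rule glob_fun_md_map[OF Q])
    have "continuous_map (top_of_set ?K) (top_of_set ?K) (\<lambda>x. (fst x, \<rho> x))"
    proof -
      have "continuous_on ?K (\<lambda>x. (fst x, \<rho> x))" by (intro continuous_on_Pair continuous_on_fst continuous_on_id \<rho>c)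
      then show ?thesis using Rep_plus_in[OF \<rho>] by auto
    qed
    from continuous_map_compose[OF this Hrc] show "continuous_map (cylinder (disc n)) ?Y H'"
      by (simp add: cylinder_disc H'_def o_def)
    show "l Src \<in> states Q" "l Tgt \<in> states Q" using md_mapD(2)[OF l] by auto
    fix z assume "z \<in> topspace (disc n)"
    then have z: "z \<in> ?D" by simp
    show "H' (z, 0) = l Src" "H' (z, 1) = l Tgt" using H'ends[OF z] by auto
    have "compose {0..1} (\<lambda>u\<in>{0..1}. Hr (z, u)) (\<lambda>s. \<rho> (z, s)) \<in> epaths Q"
      using mdspaceD(4)[OF Q Hrp[OF z] \<rho>[OF z]] .
    moreover have "compose {0..1} (\<lambda>u\<in>{0..1}. Hr (z, u)) (\<lambda>s. \<rho> (z, s)) = (\<lambda>s\<in>{0..1}. H' (z, s))"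
      using Rep_plus_in[OF \<rho>[OF z]] by (auto simp: compose_def H'_def)
    ultimately show "(\<lambda>s\<in>{0..1}. H' (z, s)) \<in> epaths Q" by simp
  qed
  moreover have "l a = ?l a" if "a \<in> pts (globe (disc_bd n))" for a
    using that
  proof (cases rule: pts_globe_cases)
    case (3 z s)
    then have z: "z \<in> sphere_set n" "z \<in> ?D" using sphere_subset_disc by auto
    then have "r z = 1" by (simp add: r_def sphere_set_def)
    then have "H' (z, s) = l a" using 3 Hr[OF z(2), of s] by (simp add: H'_def \<rho>_def H_def)
    then show ?thesis using 3 lH'[OF z(2)] by simp
  qed (simp_all add: glob_fun_def)
  moreover have "\<not> (\<lambda>s. ?l (glob_class (z, s))) constant_on {a..b}"
    if z: "z \<in> ?D" "z \<notin> sphere_set n" and ab: "0 \<le> a" "a < b" "b \<le> 1" for z a b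
  proof
    assume "(\<lambda>s. ?l (glob_class (z, s))) constant_on {a..b}"
    then obtain y where y: "\<And>s. s \<in> {a..b} \<Longrightarrow> H' (z, s) = y"
      using z by (auto simp: constant_on_def lH')
    have "r z < 1" using z r01[OF z(1)] by (auto simp: r_def sphere_set_def disc_set_def order.order_iff_strict)
    then have "(1 - r z) * a < (1 - r z) * b" using ab by simp
    moreover have "r z * \<tau> (z, a) \<le> r z * \<tau> (z, b)"
      using r01[OF z(1)] Rep_plus_mono[OF \<tau>[OF z(1)], of a b] ab by (intro mult_left_mono) auto
    ultimately have lt: "\<rho> (z, a) < \<rho> (z, b)" by (simp add: \<rho>_def)
    have \<rho>01: "0 \<le> \<rho> (z, a)" "\<rho> (z, a) \<le> 1" "0 \<le> \<rho> (z, b)" "\<rho> (z, b) \<le> 1"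
      using Rep_plus_in[OF \<rho>[OF z(1)], of a] Rep_plus_in[OF \<rho>[OF z(1)], of b] ab by auto
    \<comment> \<open>If the new path were constant on \<open>[a,b]\<close>, then
      \<open>H(z,-)\<close> would be constant on \<open>[a',b']\<close>, since there
      \<open>\<tau>\<close> takes only values that \<open>\<rho>\<close> takes on
      \<open>[a,b]\<close>. But \<open>\<tau>\<close> is constant on stops and differs at
      \<open>a'\<close> and \<open>b'\<close>.\<close>
    define a' b' where "a' = tinv z (\<rho> (z, a))" and "b' = tinv z (\<rho> (z, b))"
    note a' = tinv[OF z(1) \<rho>01(1,2), folded a'_def] and b' = tinv[OF z(1) \<rho>01(3,4), folded b'_def]
    have "a' < b'"
      using lt a' b' Rep_plus_mono[OF \<tau>[OF z(1)], of b' a'] by force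
    have "H (z, s) = y" if s: "s \<in> {a'..b'}" for s
    proof -
      have "\<tau> (z, s) \<in> {\<rho> (z, a)..\<rho> (z, b)}"
        using Rep_plus_mono[OF \<tau>[OF z(1)], of a' s] Rep_plus_mono[OF \<tau>[OF z(1)], of s b'] s a' b' by auto
      then obtain v where v: "v \<in> {a..b}" "\<rho> (z, v) = \<tau> (z, s)"
        using Rep_plus_interval[OF \<rho>[OF z(1)] ab(1) less_imp_le[OF ab(2)] ab(3)] by metis
      have "H (z, s) = H' (z, v)" using Hr[OF z(1), of s] v s a' b' by (simp add: H'_def)
      then show ?thesis using y[OF v(1)] by simp
    qed
    then have "(\<lambda>s. H (z, s)) constant_on {a'..b'}" by (auto simp: constant_on_def)
    then have "\<tau> (z, a') = \<tau> (z, b')" using \<tau>H[OF z(1), of a' b'] a' b' \<open>a' < b'\<close> by simp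
    then show False using a' b' lt by simp
  qed
  ultimately show ?thesis by blast
qed

section \<open>Regularity\<close>

text \<open>Regularity speaks of whole paths, which is not stable: a nondecreasing reparametrisation
  may run through a part of a path only. Quantifying over all subintervals gives a property
  preserved by both operations that generate directed paths.\<close>

definition reflects_stops :: "('a \<Rightarrow> 'b) \<Rightarrow> (real \<Rightarrow> 'a) \<Rightarrow> bool" where
  "reflects_stops f x \<longleftrightarrow> (\<forall>a b. 0 \<le> a \<longrightarrow> a \<le> b \<longrightarrow> b \<le> 1 \<longrightarrow>
     (\<lambda>s. f (x s)) constant_on {a..b} \<longrightarrow> x constant_on {a..b})"

text \<open>By the intermediate value theorem \<open>\<phi>\<close> maps \<open>[a,b]\<close> onto
  \<open>[\<phi> a, \<phi> b]\<close>, so constancy can be carried to that interval and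
  back.\<close>

lemma reflects_stops_compose:
  assumes x: "reflects_stops f x" and \<phi>: "\<phi> \<in> nondecr"
  shows "reflects_stops f (compose {0..1} x \<phi>)"
  unfolding reflects_stops_def
proof (intro allI impI)
  fix a b :: real assume ab: "0 \<le> a" "a \<le> b" "b \<le> 1"
    and "(\<lambda>s. f (compose {0..1} x \<phi> s)) constant_on {a..b}"
  then obtain y where y: "\<And>s. s \<in> {a..b} \<Longrightarrow> f (x (\<phi> s)) = y"
    by (auto simp: constant_on_def compose_def)
  have mono: "\<phi> s \<le> \<phi> t" if "0 \<le> s" "s \<le> t" "t \<le> 1" for s t
    using \<phi> that by (auto simp: nondecr_def mono_on_def)
  have \<phi>01: "0 \<le> \<phi> s" "\<phi> s \<le> 1" if "0 \<le> s" "s \<le> 1" for s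
    using \<phi> that by (auto simp: nondecr_def image_subset_iff)
  have "f (x u) = y" if u: "u \<in> {\<phi> a..\<phi> b}" for u
  proof -
    have "continuous_on {a..b} \<phi>"
      using \<phi> ab by (auto simp: nondecr_def intro: continuous_on_subset)
    then obtain s where "a \<le> s" "s \<le> b" "\<phi> s = u"
      using IVT'[of \<phi> a u b] ab u by auto
    then show ?thesis using y[of s] by simp
  qed
  then have "(\<lambda>u. f (x u)) constant_on {\<phi> a..\<phi> b}" unfolding constant_on_def by blast
  moreover have "0 \<le> \<phi> a" "\<phi> a \<le> \<phi> b" "\<phi> b \<le> 1" using ab \<phi>01 mono by auto
  ultimately have "x constant_on {\<phi> a..\<phi> b}" using x by (simp add: reflects_stops_def)
  then obtain y' where "\<And>u. u \<in> {\<phi> a..\<phi> b} \<Longrightarrow> x u = y'" by (auto simp: constant_on_def)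
  moreover have "\<phi> s \<in> {\<phi> a..\<phi> b}" if "s \<in> {a..b}" for s using that ab mono by auto
  ultimately have "compose {0..1} x \<phi> s = y'" if "s \<in> {a..b}" for s
    using that ab by (simp add: compose_def)
  then show "compose {0..1} x \<phi> constant_on {a..b}" unfolding constant_on_def by blast
qed

text \<open>An interval across 1/2 is cut there; the constants found on the two parts agree, both
  being the value at 1/2.\<close>

lemma reflects_stops_norm_comp:
  assumes x: "reflects_stops f x" and y: "reflects_stops f y" and xy: "x 1 = y 0"
  shows "reflects_stops f (norm_comp x y)"
  unfolding reflects_stops_def
proof (intro allI impI)
  fix a b :: real assume ab: "0 \<le> a" "a \<le> b" "b \<le> 1"
    and "(\<lambda>s. f (norm_comp x y s)) constant_on {a..b}"
  then obtain w where w: "\<And>s. s \<in> {a..b} \<Longrightarrow> f (norm_comp x y s) = w"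
    by (auto simp: constant_on_def)
  have left: "norm_comp x y s = x (2 * s)" if "0 \<le> s" "s \<le> 1/2" for s
    using that by (simp add: norm_comp_def)
  have right: "norm_comp x y s = y (2 * s - 1)" if "1/2 \<le> s" "s \<le> 1" for s
  proof (cases "s = 1/2")
    case True
    then have s: "2 * s = 1" "2 * s - 1 = 0" "0 \<le> s" "s \<le> 1/2" by simp_all
    have "x (2 * s) = y (2 * s - 1)" unfolding s(2) unfolding s(1) by (rule xy)
    then show ?thesis using left[OF s(3,4)] by simp
  qed (use that in \<open>auto simp: norm_comp_def\<close>)
  have L: "\<exists>v. \<forall>s\<in>{a..c}. norm_comp x y s = v" if c: "a \<le> c" "c \<le> b" "c \<le> 1/2" for c
  proof -
    have "f (x u) = w" if "u \<in> {2 * a..2 * c}" for u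
      using w[of "u / 2"] left[of "u / 2"] that ab c by auto
    then have "(\<lambda>s. f (x s)) constant_on {2 * a..2 * c}" unfolding constant_on_def by blast
    then have "x constant_on {2 * a..2 * c}" using x ab c by (simp add: reflects_stops_def)
    then obtain v where v: "\<And>u. u \<in> {2 * a..2 * c} \<Longrightarrow> x u = v" by (auto simp: constant_on_def)
    have "norm_comp x y s = v" if "s \<in> {a..c}" for s
      using left[of s] v[of "2 * s"] that ab c by simp
    then show ?thesis by blast
  qed
  have R: "\<exists>v. \<forall>s\<in>{c..b}. norm_comp x y s = v" if c: "a \<le> c" "c \<le> b" "1/2 \<le> c" for c
  proof -
    have "f (y u) = w" if "u \<in> {2 * c - 1..2 * b - 1}" for u
    proof -
      have "1/2 \<le> (u + 1) / 2" "(u + 1) / 2 \<le> 1" "(u + 1) / 2 \<in> {a..b}" using that ab c by auto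
      then show ?thesis using w[of "(u + 1) / 2"] right[of "(u + 1) / 2"] by (simp add: field_simps)
    qed
    then have "(\<lambda>s. f (y s)) constant_on {2 * c - 1..2 * b - 1}" unfolding constant_on_def by blast
    then have "y constant_on {2 * c - 1..2 * b - 1}"
      using y[unfolded reflects_stops_def, rule_format, of "2 * c - 1" "2 * b - 1"] ab c by simp
    then obtain v where v: "\<And>u. u \<in> {2 * c - 1..2 * b - 1} \<Longrightarrow> y u = v" by (auto simp: constant_on_def)
    have "norm_comp x y s = v" if "s \<in> {c..b}" for s
      using right[of s] v[of "2 * s - 1"] that ab c by simp
    then show ?thesis by blast
  qed
  consider "b \<le> 1/2" | "1/2 \<le> a" | "a < 1/2" "1/2 < b" by linarith
  then show "norm_comp x y constant_on {a..b}"
  proof cases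
    case 1 then show ?thesis using L[of b] ab by (auto simp: constant_on_def)
  next
    case 2 then show ?thesis using R[of a] ab by (auto simp: constant_on_def)
  next
    case 3
    obtain v where v: "\<And>s. s \<in> {a..1/2} \<Longrightarrow> norm_comp x y s = v" using L[of "1/2"] 3 by auto
    obtain v' where v': "\<And>s. s \<in> {1/2..b} \<Longrightarrow> norm_comp x y s = v'" using R[of "1/2"] 3 by auto
    have "v = v'" using v[of "1/2"] v'[of "1/2"] 3 by simp
    then have "norm_comp x y s = v" if "s \<in> {a..b}" for s
      using v[of s] v'[of s] that by (cases "s \<le> 1/2") auto
    then show ?thesis unfolding constant_on_def by blast
  qed
qed

section \<open>From execution paths to directed paths, and the regular morphism\<close>

lemma generated_dpaths_reflect_stops:
  assumes "\<And>x. x \<in> epaths A \<Longrightarrow> reflects_stops f x" "x \<in> generated_dpaths A"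
  shows "reflects_stops f x"
  using assms(2)
proof induction
  case (gen_const a)
  then show ?case by (auto simp: reflects_stops_def constant_on_def const_path_def)
qed (use assms(1) reflects_stops_compose reflects_stops_norm_comp in auto)

lemma directed_map_Sp:
  assumes A: "mdspace T A" and f: "md_map A B f"
  shows "directed_map (Sp A) (Sp B) f"
proof -
  have "x \<in> generated_dpaths A \<Longrightarrow> (\<forall>s\<in>{0..1}. x s \<in> pts A) \<and> compose {0..1} f x \<in> generated_dpaths B" for x
  proof (induction rule: generated_dpaths.induct)
    case (gen_exec x)
    then show ?case
      using md_mapD(3)[OF f] mdspaceD(8)[OF A] by (auto intro: generated_dpaths.gen_exec)
  next
    case (gen_const a)
    have "compose {0..1} f (const_path a) = const_path (f a)"
      by (auto simp: compose_def const_path_def)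
    moreover have "const_path (f a) \<in> generated_dpaths B"
      using gen_const md_mapD(4)[OF f] by (intro generated_dpaths.gen_const)
    moreover have "\<forall>s\<in>{0..1}. const_path a s \<in> pts A"
      using gen_const by (simp add: const_path_def)
    ultimately show ?case by simp
  next
    case (gen_reparam x \<phi>)
    have \<phi>: "\<phi> s \<in> {0..1}" if "s \<in> {0..1}" for s
      using gen_reparam(2) that by (auto simp: nondecr_def image_subset_iff)
    have "compose {0..1} f (compose {0..1} x \<phi>) = compose {0..1} (compose {0..1} f x) \<phi>"
      using \<phi> by (auto simp: compose_def)
    moreover have "compose {0..1} (compose {0..1} f x) \<phi> \<in> generated_dpaths B"
      using gen_reparam by (auto intro: generated_dpaths.gen_reparam)
    moreover have "\<forall>s\<in>{0..1}. compose {0..1} x \<phi> s \<in> pts A"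
      using gen_reparam(3) \<phi> by (simp add: compose_def)
    ultimately show ?case by simp
  next
    case (gen_concat x y)
    have "compose {0..1} f (norm_comp x y) = norm_comp (compose {0..1} f x) (compose {0..1} f y)"
      by (auto simp: compose_def norm_comp_def)
    moreover have "norm_comp (compose {0..1} f x) (compose {0..1} f y) \<in> generated_dpaths B"
      using conjunct2[OF gen_concat(4)] conjunct2[OF gen_concat(5)]
      by (rule generated_dpaths.gen_concat) (simp add: compose_def gen_concat(3))
    moreover have "\<forall>s\<in>{0..1}. norm_comp x y s \<in> pts A"
      using gen_concat(4,5) by (simp add: norm_comp_def)
    ultimately show ?case by simp
  qed
  then show ?thesis using md_mapD(1)[OF f] by (simp add: directed_map_def Sp_def)
qed

text \<open>The lift over each cell is repaired as soon as it is chosen. Since \<open>G\<close>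
  forbids stops over interior points, the map reflects stops on the interior cell paths, and
  \<open>epaths_subset\<close> spreads this to all execution paths.\<close>

lemma (in cell_tower) regular_map_into_fibrant:
  fixes Q :: "'q mdspace"
  assumes Q: "mdspace T Q"
    and fac: "\<And>x. x \<in> epaths Q \<Longrightarrow>
      \<exists>c \<phi>. c \<in> epaths Q \<and> nostop (und Q) c \<and> \<phi> \<in> Rep_plus \<and> x = compose {0..1} c \<phi>"
    and fib: "trivial_q_fibration Q final_md (\<lambda>_. ())"
  shows "\<exists>f. md_map (X \<mu>) Q f \<and> (\<forall>x\<in>epaths (X \<mu>). reflects_stops f x)"
proof -
  have fin: "md_map B final_md (\<lambda>_. ())" for B :: "'x mdspace"
  proof -
    have "compose {0..1} (\<lambda>_. ()) x = const_path ()" for x :: "real \<Rightarrow> 'x"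
      by (simp add: compose_def const_path_def)
    then show ?thesis by (auto simp: md_map_def final_md_def)
  qed
  \<comment> \<open>Every map to \<open>final_md\<close> is a morphism and every square over it
    commutes, so the lifting property becomes an extension property.\<close>
  have lift: "\<exists>l. md_map B Q l \<and> (\<forall>a\<in>pts A. l (i a) = u a)"
    if "generating_cofibration A B i" "md_map A Q u" for A B i u
    using fib that fin unfolding trivial_q_fibration_def has_rlp_def by fastforce
  obtain p where p: "p \<in> states Q"
  proof -
    have "md_map (discrete_md {}) Q (\<lambda>_. undefined)"
      by (simp add: md_map_def discrete_md_def continuous_map_def)
    from lift[OF generating_cofibration.intros(2) this]
    obtain l where "md_map (discrete_md {Src :: (nat \<Rightarrow> real) globe_pt}) Q l" by blast
    from md_mapD(2)[OF this, of Src] that show thesis by (simp add: discrete_md_def)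
  qed
  define i0 where "i0 = (LEAST i::'i. True)"
  have i0: "i0 \<le> i" for i unfolding i0_def by (rule Least_le) simp
  obtain S where S: "X i0 = discrete_md S" using least[of i0] i0 by (auto simp: is_least_def)
  \<comment> \<open>All states go to the single state \<open>p\<close>. No cell obstructs this,
    because lifting also provides execution paths from \<open>p\<close> to itself.\<close>
  have g0: "md_map (X i0) Q (\<lambda>_. p)"
    using p mdspaceD(2)[OF Q p] by (auto simp: S md_map_def discrete_md_def)
  define G where "G = (\<lambda>i j h. \<forall>z\<in>disc_set (dim i j). z \<notin> sphere_set (dim i j) \<longrightarrow>
    (\<forall>a b. 0 \<le> a \<longrightarrow> a < b \<longrightarrow> b \<le> 1 \<longrightarrow> \<not> (\<lambda>s. h (glob_class (z, s)) :: 'q) constant_on {a..b}))"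
  have "\<exists>f. md_map (X \<mu>) Q f \<and> (\<forall>a\<in>pts (X i0). f (t i0 \<mu> a) = p) \<and>
    (\<forall>i j. is_succ i j \<longrightarrow> j \<le> \<mu> \<longrightarrow> i0 \<le> i \<longrightarrow>
      (\<exists>h. G i j h \<and> (\<forall>b\<in>pts (globe (disc (dim i j))). f (t j \<mu> (chr i j b)) = h b)))"
  proof (rule tower_extension[OF Q i0 g0])
    fix i j g assume ij: "is_succ i j" "j \<le> \<mu>" and g: "md_map (X i) Q g"
    have w: "md_map (globe (disc_bd (dim i j))) Q (\<lambda>a. g (att i j a))"
      using md_map_compose[OF att_map[OF ij(2,1)] g] .
    from lift[OF generating_cofibration.intros(1) this]
    obtain l where l: "md_map (globe (disc (dim i j))) Q l"
      "\<forall>a\<in>pts (globe (disc_bd (dim i j))). l a = g (att i j a)" by blast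
    from regular_filling[OF Q l(1) fac] obtain l' where
      "md_map (globe (disc (dim i j))) Q l'" "\<forall>a\<in>pts (globe (disc_bd (dim i j))). l a = l' a" "G i j l'"
      unfolding G_def by blast
    with l(2) show "\<exists>h. md_map (globe (disc (dim i j))) Q h \<and>
        (\<forall>a\<in>pts (globe (disc_bd (dim i j))). g (att i j a) = h a) \<and> G i j h"
      by (intro exI[of _ l']) auto
  qed
  then obtain f where f: "md_map (X \<mu>) Q f" and fG: "\<And>i j. is_succ i j \<Longrightarrow> j \<le> \<mu> \<Longrightarrow>
      \<exists>h. G i j h \<and> (\<forall>b\<in>pts (globe (disc (dim i j))). f (t j \<mu> (chr i j b)) = h b)"
    using i0 by blast
  define R where "R = {x \<in> epaths (X \<mu>). reflects_stops f x}"
  have B: "mdspace T (X \<mu>)" using mdX by simp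
  have "epaths (X \<mu>) \<subseteq> R"
  proof (rule epaths_subset)
    show "R \<subseteq> epaths (X \<mu>)" by (auto simp: R_def)
    show "compose {0..1} x \<phi> \<in> R" if "x \<in> R" "\<phi> \<in> Rep_plus" for x \<phi>
      using that mdspaceD(4)[OF B] reflects_stops_compose[OF _ Rep_plus_subset_nondecr] by (auto simp: R_def)
    show "norm_comp x y \<in> R" if "x \<in> R" "y \<in> R" "x 1 = y 0" for x y
      using that mdspaceD(5)[OF B] reflects_stops_norm_comp by (auto simp: R_def)
    fix i j z assume ij: "is_succ i j" "j \<le> \<mu>" and z: "z \<in> disc_set (dim i j)" "z \<notin> sphere_set (dim i j)"
    obtain h where h: "G i j h" "\<forall>b\<in>pts (globe (disc (dim i j))). f (t j \<mu> (chr i j b)) = h b"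
      using fG[OF ij] by blast
    define c where "c = (\<lambda>s\<in>{0..1::real}. t j \<mu> (chr i j (glob_class (z, s))))"
    have "c \<in> epaths (X \<mu>)"
      using globe_map_pathD[OF md_map_compose[OF chr_map[OF ij(2,1)] t_map[OF ij(2) order_refl]], of z "\<lambda>s. s"] z
      by (simp add: c_def)
    moreover have "reflects_stops f c"
      unfolding reflects_stops_def
    proof (intro allI impI)
      fix a b :: real assume ab: "0 \<le> a" "a \<le> b" "b \<le> 1" and "(\<lambda>s. f (c s)) constant_on {a..b}"
      then obtain y where y: "\<And>s. s \<in> {a..b} \<Longrightarrow> f (c s) = y" by (auto simp: constant_on_def)
      have "h (glob_class (z, s)) = y" if "s \<in> {a..b}" for s
      proof -
        have "glob_class (z, s) \<in> pts (globe (disc (dim i j)))"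
          using z that ab by (intro glob_class_in_pts) auto
        then show ?thesis using h(2) y[OF that] that ab by (simp add: c_def)
      qed
      then have "(\<lambda>s. h (glob_class (z, s))) constant_on {a..b}" unfolding constant_on_def by blast
      \<comment> \<open>\<open>G\<close> rules out nondegenerate intervals, and constancy on a
        single point is trivial.\<close>
      then have "\<not> a < b" using h(1) z ab unfolding G_def by blast
      with ab have "a = b" by simp
      then show "c constant_on {a..b}" by (auto simp: constant_on_def)
    qed
    ultimately show "(\<lambda>s\<in>{0..1}. t j \<mu> (chr i j (glob_class (z, s)))) \<in> R"
      by (simp add: R_def c_def)
  qed
  then show ?thesis using f by (auto simp: R_def)
qed

theorem theorem7p9:
  fixes T :: top_cat and Q :: "'q mdspace" and A :: "'a mdspace"
  assumes "cellular_replacement_of_final TYPE('i::wellorder) T Q"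
    and "q_cofibrant TYPE('b) TYPE('j::wellorder) T A"
  shows "\<exists>f. md_map A Q f \<and> regular_map (Sp A) (Sp Q) f"
proof -
  have cell: "cellular TYPE('i) T Q" and fib: "trivial_q_fibration Q final_md (\<lambda>_. ())"
    using assms(1) by (auto simp: cellular_replacement_of_final_def)
  obtain \<mu> :: 'i and X t dim att chr where tower: "cell_tower T \<mu> X t dim att chr" and X: "X \<mu> = Q"
    by (rule cellular_cell_tower[OF cell])
  have Q: "mdspace T Q"
    using cell_tower.mdX[OF tower, of \<mu>] X by simp
  \<comment> \<open>\<open>Q\<close> enters in two ways: its cellular structure factors its
    execution paths through stop-free ones, and its fibrancy gives the lifts over the cells of
    \<open>B\<close>.\<close>
  have fac: "\<exists>c \<phi>. c \<in> epaths Q \<and> nostop (und Q) c \<and> \<phi> \<in> Rep_plus \<and> x = compose {0..1} c \<phi>"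
    if "x \<in> epaths Q" for x
    using cell_tower.epaths_factor[OF tower] that unfolding X .
  obtain B :: "'b mdspace" where B: "cellular TYPE('j) T B" "is_retract A B" and A: "mdspace T A"
    using assms(2) by (auto simp: q_cofibrant_def)
  obtain \<mu>' :: 'j and X' t' dim' att' chr' where tower': "cell_tower T \<mu>' X' t' dim' att' chr'" and X': "X' \<mu>' = B"
    by (rule cellular_cell_tower[OF B(1)])
  obtain f where f: "md_map B Q f" "\<And>x. x \<in> epaths B \<Longrightarrow> reflects_stops f x"
    using cell_tower.regular_map_into_fibrant[OF tower' Q fac fib] unfolding X' by blast
  obtain s r where s: "md_map A B s" and r: "\<And>a. a \<in> pts A \<Longrightarrow> r (s a) = a"
    using B(2) by (auto simp: is_retract_def)
  have fs: "md_map A Q (\<lambda>a. f (s a))" using md_map_compose[OF s f(1)] .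
  have "x constant_on {0..1}" if x: "x \<in> dpaths (Sp A)" and c: "((\<lambda>a. f (s a)) \<circ> x) constant_on {0..1}" for x
  proof -
    \<comment> \<open>\<open>r\<close> inverts \<open>s\<close> only on the points of
      \<open>A\<close>, so the values of \<open>x\<close> must be known to lie there before
      constancy of \<open>s \<circ> x\<close> can be pulled back.\<close>
    have xp: "x u \<in> pts A" if "u \<in> {0..1}" for u
    proof -
      have "directed_structure (und A) (dpaths (Sp A))"
        using directed_space_Sp[OF A] by (simp add: directed_space_def Sp_def)
      then have "pathin (und A) x" using x by (auto simp: directed_structure_def paths_in_def)
      then show ?thesis
        using continuous_map_image_subset_topspace[of "top_of_set {0..1}" "und A" x] that
        by (auto simp: pathin_def image_subset_iff)
    qed
    have "compose {0..1} s x \<in> generated_dpaths B"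
      using directed_map_Sp[OF A s] x by (simp add: directed_map_def Sp_def)
    from generated_dpaths_reflect_stops[OF f(2) this]
    have rs: "reflects_stops f (compose {0..1} s x)" .
    moreover have "(\<lambda>u. f (compose {0..1} s x u)) constant_on {0..1}"
      using c by (simp add: constant_on_def compose_def)
    ultimately have "compose {0..1} s x constant_on {0..1}"
      by (simp add: reflects_stops_def)
    then obtain y where "\<And>u. u \<in> {0..1} \<Longrightarrow> s (x u) = y" by (auto simp: constant_on_def compose_def)
    then have "x u = r y" if "u \<in> {0..1}" for u using r[OF xp[OF that]] that by metis
    then show ?thesis unfolding constant_on_def by blast
  qed
  then have "regular_map (Sp A) (Sp Q) (\<lambda>a. f (s a))"
    using directed_map_Sp[OF A fs] by (simp add: regular_map_def)
  with fs show ?thesis by blast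
qed

end
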